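(* Consider Shift-ECSs extended with an empty node $\bot$ and an $\epsilon$-node. There are implementations of the operations $\mathsf{add}$, $\mathsf{prod}$, $\mathsf{union}$ and $\mathsf{shift}$ on such structures that take constant time. Furthermore, if one starts from an empty extended Shift-ECS $\mathcal{D}$ and applies $\mathsf{add}$, $\mathsf{prod}$, $\mathsf{union}$ and $\mathsf{shift}$ only to $\epsilon$-safe nodes, then the resulting node $v'$ is always an $\epsilon$-safe node, and for every node $v$ the set $[\![\mathcal{D}]\!](v)$ can be enumerated with output-linear delay without preprocessing.
   Context: Let $\Omega$ be a finite output alphabet disjoint from $\mathbb{Z}$ and from $\{\cup,\odot\}$. An extended Shift-ECS is a tuple $\mathcal{D}=(\Omega,V,\ell,r,\lambda,\bot,\epsilon)$ where $V$ is a finite set of nodes containing two special nodes $\bot,\epsilon$, $\ell,r$ are partial functions $V\to V$ whose graph is acyclic, and $\lambda:V\to\Omega\cup\mathbb{Z}\cup\{\cup,\odot,\bot,\epsilon\}$ with $\lambda(v)=\bot$ iff $v=\bot$ and $\lambda(v)=\epsilon$ iff $v=\epsilon$; $\ell(v)$ is defined iff $\lambda(v)\in\mathbb{Z}\cup\{\cup,\odot\}$ and $r(v)$ is defined iff $\lambda(v)\in\{\cup,\odot\}$. Nodes labelled in $\Omega$ are bottom nodes, $\odot$ product nodes, $\cup$ union nodes, integers shift nodes; bottom and product nodes are output nodes. With $\mathsf{sh}((o,i),k)=(o,i+k)$ extended to strings and sets, each node denotes a set of strings over $\Omega\times\mathbb{Z}$: $[\![\mathcal{D}]\!](\bot)=\emptyset$,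 $[\![\mathcal{D}]\!](\epsilon)=\{\varepsilon\}$ (the empty string), $\{(o,1)\}$ for a bottom node labelled $o$, union of children's sets for union nodes, concatenation $[\![\mathcal{D}]\!](\ell(v))\cdot[\![\mathcal{D}]\!](r(v))$ for product nodes, $\mathsf{sh}([\![\mathcal{D}]\!](\ell(v)),\lambda(v))$ for shift nodes. Output-depth: $\mathsf{odepth}(v)=0$ for output nodes, $\mathsf{odepth}(\ell(v))+1$ for union and shift nodes. A node $v$ is safe if it is a shift node and either $\ell(v)$ is an output node, or $u=\ell(v)$ is a union node with $\mathsf{odepth}(u)=1$ and $r(u)$ is a shift node with $\mathsf{odepth}(r(u))\le 2$. A node $v$ is $\epsilon$-safe if (1) $v=\epsilon$, or (2) $v$ is safe and no descendant of $v$ is $\epsilon$, or (3) $v$ is a union node with $\ell(v)=\epsilon$ and $r(v)$ safe with no descendant equal to $\epsilon$. The operations add fresh nodes only and return a node $v'$ with $[\![\mathcal{D}]\!](v')$ equal to $\{(o,1)\}$ for $\mathsf{add}(o)$ ($o\in\Omega$), $[\![\mathcal{D}]\!](v_1)\cdot[\![\mathcal{D}]\!](v_2)$ for $\mathsf{prod}(v_1,v_2)$, $[\![\mathcal{D}]\!](v_3)\cup[\![\mathcal{D}]\!](v_4)$ for $\mathsf{union}(v_3,v_4)$, and $\mathsf{sh}([\![\mathcal{D}]\!](v),k)$ for $\mathsf{shift}(v,k)$; in particular $\mathsf{prod}$ returns $\bot$ if an argument is $\bot$, $\mathsf{union}(v,\bot)=\mathsf{union}(\bot,v)$ returns $v$,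 and $\mathsf{shift}(\bot,k)$ returns $\bot$. It is assumed that $\mathsf{union}$ is only applied to nodes with disjoint sets and $\mathsf{prod}$ only when every string in the product decomposes uniquely as a concatenation of a string of $[\![\mathcal{D}]\!](v_1)$ and one of $[\![\mathcal{D}]\!](v_2)$. Output-linear delay: the time before the first output, between consecutive outputs, and after the last output is linear in the size of the next output (constant at the end). *)

theory Defs
  imports Main
begin

section \<open>Extended Shift-ECSs\<close>

text \<open>The disjointness of the output alphabet, the integers and the special labels is built into
  the constructors.\<close>

datatype 'a label = Sym 'a | Shift int | Cup | Odot | LBot | LEps

record ('a, 'v) ecs =
  nodes :: "'v set"
  lft :: "'v \<Rightarrow> 'v option"
  rgt :: "'v \<Rightarrow> 'v option"
  lab :: "'v \<Rightarrow> 'a label"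
  bot_node :: 'v
  eps_node :: 'v

definition edges :: "('a, 'v) ecs \<Rightarrow> ('v \<times> 'v) set" where
  "edges D = {(v, u). v \<in> nodes D \<and> (lft D v = Some u \<or> rgt D v = Some u)}"

definition is_ecs :: "'a set \<Rightarrow> ('a, 'v) ecs \<Rightarrow> bool" where
  "is_ecs \<Omega> D \<longleftrightarrow>
     finite (nodes D) \<and> bot_node D \<in> nodes D \<and> eps_node D \<in> nodes D \<and>
     acyclic (edges D) \<and>
     (\<forall>v \<in> nodes D.
        (\<forall>a. lab D v = Sym a \<longrightarrow> a \<in> \<Omega>) \<and>
        (lab D v = LBot \<longleftrightarrow> v = bot_node D) \<and>
        (lab D v = LEps \<longleftrightarrow> v = eps_node D) \<and>
        (lft D v \<noteq> None \<longleftrightarrow> lab D v \<in> range Shift \<union> {Cup, Odot}) \<and>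
        (rgt D v \<noteq> None \<longleftrightarrow> lab D v \<in> {Cup, Odot}) \<and>
        (\<forall>u. lft D v = Some u \<or> rgt D v = Some u \<longrightarrow> u \<in> nodes D))"

definition empty_ecs :: "'a set \<Rightarrow> ('a, 'v) ecs \<Rightarrow> bool" where
  "empty_ecs \<Omega> D \<longleftrightarrow> is_ecs \<Omega> D \<and> nodes D = {bot_node D, eps_node D}"

type_synonym 'a word = "('a \<times> int) list"

definition sh :: "'a word \<Rightarrow> int \<Rightarrow> 'a word" where
  "sh w k = map (\<lambda>(a, i). (a, i + k)) w"

text \<open>On an acyclic structure the least solution of the defining clauses is the only one; the
  clauses are recovered as equations in \<open>sem_equations\<close> below.\<close>

inductive denotes :: "('a, 'v) ecs \<Rightarrow> 'v \<Rightarrow> 'a word \<Rightarrow> bool" for D where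
  eps: "lab D v = LEps \<Longrightarrow> denotes D v []"
| sym: "lab D v = Sym a \<Longrightarrow> denotes D v [(a, 1)]"
| cup_left: "lab D v = Cup \<Longrightarrow> lft D v = Some u \<Longrightarrow> denotes D u w \<Longrightarrow> denotes D v w"
| cup_right: "lab D v = Cup \<Longrightarrow> rgt D v = Some u \<Longrightarrow> denotes D u w \<Longrightarrow> denotes D v w"
| odot: "lab D v = Odot \<Longrightarrow> lft D v = Some u1 \<Longrightarrow> rgt D v = Some u2 \<Longrightarrow>
    denotes D u1 w1 \<Longrightarrow> denotes D u2 w2 \<Longrightarrow> denotes D v (w1 @ w2)"
| shift: "lab D v = Shift k \<Longrightarrow> lft D v = Some u \<Longrightarrow> denotes D u w \<Longrightarrow> denotes D v (sh w k)"

definition sem :: "('a, 'v) ecs \<Rightarrow> 'v \<Rightarrow> 'a word set" where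
  "sem D v = {w. denotes D v w}"

definition lang_conc :: "'a word set \<Rightarrow> 'a word set \<Rightarrow> 'a word set" where
  "lang_conc A B = {x @ y | x y. x \<in> A \<and> y \<in> B}"

lemma sem_equations:
  "lab D v = LBot \<Longrightarrow> sem D v = {}"
  "lab D v = LEps \<Longrightarrow> sem D v = {[]}"
  "lab D v = Sym a \<Longrightarrow> sem D v = {[(a, 1)]}"
  "lab D v = Cup \<Longrightarrow> lft D v = Some u1 \<Longrightarrow> rgt D v = Some u2 \<Longrightarrow>
    sem D v = sem D u1 \<union> sem D u2"
  "lab D v = Odot \<Longrightarrow> lft D v = Some u1 \<Longrightarrow> rgt D v = Some u2 \<Longrightarrow>
    sem D v = lang_conc (sem D u1) (sem D u2)"
  "lab D v = Shift k \<Longrightarrow> lft D v = Some u1 \<Longrightarrow> sem D v = (\<lambda>w. sh w k) ` sem D u1"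
  unfolding sem_def lang_conc_def
  by (auto simp: denotes.simps[of D v] image_iff) blast

section \<open>Safety\<close>

definition output_node :: "('a, 'v) ecs \<Rightarrow> 'v \<Rightarrow> bool" where
  "output_node D v \<longleftrightarrow> lab D v \<in> range Sym \<union> {Odot}"

definition shift_node :: "('a, 'v) ecs \<Rightarrow> 'v \<Rightarrow> bool" where
  "shift_node D v \<longleftrightarrow> lab D v \<in> range Shift"

definition union_node :: "('a, 'v) ecs \<Rightarrow> 'v \<Rightarrow> bool" where
  "union_node D v \<longleftrightarrow> lab D v = Cup"

text \<open>The output-depth is partial: it is undefined on the two special nodes and on nodes whose
  left path ends in one of them. Hence it is given by its graph.\<close>

inductive odepth :: "('a, 'v) ecs \<Rightarrow> 'v \<Rightarrow> nat \<Rightarrow> bool" for D where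
  "output_node D v \<Longrightarrow> odepth D v 0"
| "union_node D v \<or> shift_node D v \<Longrightarrow> lft D v = Some u \<Longrightarrow> odepth D u n \<Longrightarrow> odepth D v (n + 1)"

definition safe :: "('a, 'v) ecs \<Rightarrow> 'v \<Rightarrow> bool" where
  "safe D v \<longleftrightarrow> shift_node D v \<and>
     (\<exists>u. lft D v = Some u \<and>
        (output_node D u \<or>
         (union_node D u \<and> odepth D u 1 \<and>
          (\<exists>t. rgt D u = Some t \<and> shift_node D t \<and> (\<exists>n \<le> 2. odepth D t n)))))"

definition eps_free :: "('a, 'v) ecs \<Rightarrow> 'v \<Rightarrow> bool" where
  "eps_free D v \<longleftrightarrow> (v, eps_node D) \<notin> (edges D)\<^sup>*"

definition eps_safe :: "('a, 'v) ecs \<Rightarrow> 'v \<Rightarrow> bool" where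
  "eps_safe D v \<longleftrightarrow> v \<in> nodes D \<and>
     (v = eps_node D \<or>
      (safe D v \<and> eps_free D v) \<or>
      (union_node D v \<and> lft D v = Some (eps_node D) \<and>
       (\<exists>u. rgt D v = Some u \<and> safe D u \<and> eps_free D u)))"

section \<open>The operations\<close>

text \<open>From here on nodes are natural numbers, so that they can be stored in memory.\<close>

datatype opname = OpAdd | OpProd | OpUnion | OpShift

datatype 'a call = CAdd 'a | CProd nat nat | CUnion nat nat | CShift nat int

fun call_op :: "'a call \<Rightarrow> opname" where
  "call_op (CAdd a) = OpAdd"
| "call_op (CProd v1 v2) = OpProd"
| "call_op (CUnion v3 v4) = OpUnion"
| "call_op (CShift v k) = OpShift"

fun call_nodes :: "'a call \<Rightarrow> nat set" where
  "call_nodes (CAdd a) = {}"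
| "call_nodes (CProd v1 v2) = {v1, v2}"
| "call_nodes (CUnion v3 v4) = {v3, v4}"
| "call_nodes (CShift v k) = {v}"

definition unique_decomp :: "'a word set \<Rightarrow> 'a word set \<Rightarrow> bool" where
  "unique_decomp A B \<longleftrightarrow>
     (\<forall>x \<in> A. \<forall>y \<in> B. \<forall>x' \<in> A. \<forall>y' \<in> B. x @ y = x' @ y' \<longrightarrow> x = x' \<and> y = y')"

fun call_assm :: "'a set \<Rightarrow> ('a, nat) ecs \<Rightarrow> 'a call \<Rightarrow> bool" where
  "call_assm \<Omega> D (CAdd a) \<longleftrightarrow> a \<in> \<Omega>"
| "call_assm \<Omega> D (CProd v1 v2) \<longleftrightarrow>
     v1 \<in> nodes D \<and> v2 \<in> nodes D \<and> unique_decomp (sem D v1) (sem D v2)"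
| "call_assm \<Omega> D (CUnion v3 v4) \<longleftrightarrow>
     v3 \<in> nodes D \<and> v4 \<in> nodes D \<and> sem D v3 \<inter> sem D v4 = {}"
| "call_assm \<Omega> D (CShift v k) \<longleftrightarrow> v \<in> nodes D"

fun call_sem :: "('a, nat) ecs \<Rightarrow> 'a call \<Rightarrow> 'a word set" where
  "call_sem D (CAdd a) = {[(a, 1)]}"
| "call_sem D (CProd v1 v2) = lang_conc (sem D v1) (sem D v2)"
| "call_sem D (CUnion v3 v4) = sem D v3 \<union> sem D v4"
| "call_sem D (CShift v k) = (\<lambda>w. sh w k) ` sem D v"

fun bot_behaviour :: "('a, nat) ecs \<Rightarrow> 'a call \<Rightarrow> nat \<Rightarrow> bool" where
  "bot_behaviour D (CAdd a) v' \<longleftrightarrow> True"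
| "bot_behaviour D (CProd v1 v2) v' \<longleftrightarrow>
     (v1 = bot_node D \<or> v2 = bot_node D \<longrightarrow> v' = bot_node D)"
| "bot_behaviour D (CUnion v3 v4) v' \<longleftrightarrow>
     (v4 = bot_node D \<longrightarrow> v' = v3) \<and> (v3 = bot_node D \<longrightarrow> v' = v4)"
| "bot_behaviour D (CShift v k) v' \<longleftrightarrow> (v = bot_node D \<longrightarrow> v' = bot_node D)"

definition adds_fresh_nodes :: "('a, 'v) ecs \<Rightarrow> ('a, 'v) ecs \<Rightarrow> bool" where
  "adds_fresh_nodes D D' \<longleftrightarrow>
     nodes D \<subseteq> nodes D' \<and> bot_node D' = bot_node D \<and> eps_node D' = eps_node D \<and>
     (\<forall>v \<in> nodes D. lft D' v = lft D v \<and> rgt D' v = rgt D v \<and> lab D' v = lab D v)"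

definition correct_operations ::
    "'a set \<Rightarrow> (('a, nat) ecs \<Rightarrow> 'a call \<Rightarrow> ('a, nat) ecs \<times> nat) \<Rightarrow> bool" where
  "correct_operations \<Omega> apply_op \<longleftrightarrow>
     (\<forall>D c. is_ecs \<Omega> D \<and> call_assm \<Omega> D c \<longrightarrow>
        (case apply_op D c of (D', v') \<Rightarrow>
           is_ecs \<Omega> D' \<and> adds_fresh_nodes D D' \<and> v' \<in> nodes D' \<and>
           sem D' v' = call_sem D c \<and> bot_behaviour D c v'))"

text \<open>The structures obtained from an empty one by applying operations to $\epsilon$-safe nodes
  only.\<close>

inductive eps_safely_built ::
    "'a set \<Rightarrow> (('a, nat) ecs \<Rightarrow> 'a call \<Rightarrow> ('a, nat) ecs \<times> nat) \<Rightarrow> ('a, nat) ecs \<Rightarrow> bool"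
  for \<Omega> apply_op where
  start: "empty_ecs \<Omega> D \<Longrightarrow> eps_safely_built \<Omega> apply_op D"
| step: "eps_safely_built \<Omega> apply_op D \<Longrightarrow> call_assm \<Omega> D c \<Longrightarrow>
    \<forall>v \<in> call_nodes c. eps_safe D v \<Longrightarrow> eps_safely_built \<Omega> apply_op (fst (apply_op D c))"

section \<open>The random access machine\<close>

text \<open>A unit-cost RAM with integer registers, an integer memory with indirect addressing, addition
  and subtraction, and a write-only output tape. Programs are finite syntactic objects, so they use
  finitely many registers and each of their instructions evaluates expressions of bounded size.
  Every instruction and every test contributes exactly one event to the trace of a run, so the
  length of (a segment of) the trace is the running time. \<open>Sep\<close> marks the end of an output string.\<close>

datatype aexp = N int | R nat | Plus aexp aexp | Minus aexp aexp

datatype bexp = Less aexp aexp | Eq aexp aexp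

datatype com =
    Skip
  | Assign nat aexp
  | Load nat aexp
  | Store aexp aexp
  | Out aexp aexp
  | EndOut
  | Seq com com
  | If bexp com com
  | While bexp com

record state =
  regs :: "nat \<Rightarrow> int"
  mem :: "nat \<Rightarrow> int"

datatype event = Tick | Emit int int | Sep

fun aval :: "aexp \<Rightarrow> state \<Rightarrow> int" where
  "aval (N i) s = i"
| "aval (R r) s = regs s r"
| "aval (Plus a b) s = aval a s + aval b s"
| "aval (Minus a b) s = aval a s - aval b s"

fun bval :: "bexp \<Rightarrow> state \<Rightarrow> bool" where
  "bval (Less a b) s \<longleftrightarrow> aval a s < aval b s"
| "bval (Eq a b) s \<longleftrightarrow> aval a s = aval b s"

inductive exec :: "com \<Rightarrow> state \<Rightarrow> event list \<Rightarrow> state \<Rightarrow> bool" where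
  Skip: "exec Skip s [Tick] s"
| Assign: "exec (Assign r a) s [Tick] (s\<lparr>regs := (regs s)(r := aval a s)\<rparr>)"
| Load: "exec (Load r a) s [Tick] (s\<lparr>regs := (regs s)(r := mem s (nat (aval a s)))\<rparr>)"
| Store: "exec (Store a b) s [Tick] (s\<lparr>mem := (mem s)(nat (aval a s) := aval b s)\<rparr>)"
| Out: "exec (Out a b) s [Emit (aval a s) (aval b s)] s"
| EndOut: "exec EndOut s [Sep] s"
| Seq: "exec c1 s1 tr1 s2 \<Longrightarrow> exec c2 s2 tr2 s3 \<Longrightarrow> exec (Seq c1 c2) s1 (tr1 @ tr2) s3"
| IfTrue: "bval b s \<Longrightarrow> exec c1 s tr t \<Longrightarrow> exec (If b c1 c2) s (Tick # tr) t"
| IfFalse: "\<not> bval b s \<Longrightarrow> exec c2 s tr t \<Longrightarrow> exec (If b c1 c2) s (Tick # tr) t"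
| WhileFalse: "\<not> bval b s \<Longrightarrow> exec (While b c) s [Tick] s"
| WhileTrue: "bval b s1 \<Longrightarrow> exec c s1 tr1 s2 \<Longrightarrow> exec (While b c) s2 tr2 s3 \<Longrightarrow>
    exec (While b c) s1 (Tick # tr1 @ tr2) s3"

lemma exec_deterministic:
  "exec c s tr t \<Longrightarrow> exec c s tr' t' \<Longrightarrow> tr' = tr \<and> t' = t"
proof (induction arbitrary: tr' t' rule: exec.induct)
  case (Seq c1 s1 tr1 s2 c2 tr2 s3)
  from Seq.prems show ?case by cases (use Seq.IH in blast)
next
  case (WhileTrue b s1 c tr1 s2 tr2 s3)
  from WhileTrue.prems show ?case by cases (use WhileTrue.IH WhileTrue.hyps in blast)+
qed (erule exec.cases; auto)+

section \<open>Structures in memory\<close>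

fun tag :: "'a label \<Rightarrow> int" where
  "tag LBot = 0"
| "tag LEps = 1"
| "tag (Sym a) = 2"
| "tag Cup = 3"
| "tag Odot = 4"
| "tag (Shift k) = 5"

text \<open>Node \<open>v\<close> occupies the four cells from address \<open>4 * v\<close> on: tag, symbol code or shift value,
  left child, right child. Register 0 holds the first unused node number, registers 1 and 2 the
  special nodes. All other registers and cells have arbitrary contents.\<close>

definition stores :: "('a \<Rightarrow> int) \<Rightarrow> ('a, nat) ecs \<Rightarrow> state \<Rightarrow> bool" where
  "stores code D s \<longleftrightarrow>
     regs s 0 = int (Suc (Max (nodes D))) \<and>
     regs s 1 = int (bot_node D) \<and>
     regs s 2 = int (eps_node D) \<and>
     (\<forall>v \<in> nodes D.
        mem s (4 * v) = tag (lab D v) \<and>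
        (\<forall>a. lab D v = Sym a \<longrightarrow> mem s (4 * v + 1) = code a) \<and>
        (\<forall>k. lab D v = Shift k \<longrightarrow> mem s (4 * v + 1) = k) \<and>
        (\<forall>u. lft D v = Some u \<longrightarrow> mem s (4 * v + 2) = int u) \<and>
        (\<forall>u. rgt D v = Some u \<longrightarrow> mem s (4 * v + 3) = int u))"

text \<open>Arguments are passed in registers 3 and 4, and results are returned in register 5.\<close>

fun loads_args :: "('a \<Rightarrow> int) \<Rightarrow> 'a call \<Rightarrow> state \<Rightarrow> bool" where
  "loads_args code (CAdd a) s \<longleftrightarrow> regs s 3 = code a"
| "loads_args code (CProd v1 v2) s \<longleftrightarrow> regs s 3 = int v1 \<and> regs s 4 = int v2"
| "loads_args code (CUnion v3 v4) s \<longleftrightarrow> regs s 3 = int v3 \<and> regs s 4 = int v4"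
| "loads_args code (CShift v k) s \<longleftrightarrow> regs s 3 = int v \<and> regs s 4 = k"

definition constant_time_implementation ::
    "'a set \<Rightarrow> ('a \<Rightarrow> int) \<Rightarrow> (('a, nat) ecs \<Rightarrow> 'a call \<Rightarrow> ('a, nat) ecs \<times> nat) \<Rightarrow>
     (opname \<Rightarrow> com) \<Rightarrow> bool" where
  "constant_time_implementation \<Omega> code apply_op prog \<longleftrightarrow>
     (\<exists>K. \<forall>D c s. is_ecs \<Omega> D \<and> call_assm \<Omega> D c \<and> stores code D s \<and> loads_args code c s \<longrightarrow>
        (\<exists>tr s'. exec (prog (call_op c)) s tr s' \<and> length tr \<le> K \<and>
           stores code (fst (apply_op D c)) s' \<and> regs s' 5 = int (snd (apply_op D c))))"

section \<open>Enumeration with output-linear delay\<close>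

fun emitted :: "event list \<Rightarrow> (int \<times> int) list" where
  "emitted [] = []"
| "emitted (Emit i j # tr) = (i, j) # emitted tr"
| "emitted (Tick # tr) = emitted tr"
| "emitted (Sep # tr) = emitted tr"

text \<open>The trace prints exactly the strings of the list in this order, taking linear time for each
  (the summand 1 accounts for the empty string) and constant time after the last one.\<close>

fun output_linear_delay :: "nat \<Rightarrow> (int \<times> int) list list \<Rightarrow> event list \<Rightarrow> bool" where
  "output_linear_delay K [] tr \<longleftrightarrow> set tr \<subseteq> {Tick} \<and> length tr \<le> K"
| "output_linear_delay K (w # ws) tr \<longleftrightarrow>
     (\<exists>seg rest. tr = seg @ Sep # rest \<and> Sep \<notin> set seg \<and> emitted seg = w \<and>
        length seg + 1 \<le> K * (length w + 1) \<and> output_linear_delay K ws rest)"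

text \<open>The run starts directly from the stored structure, which contains no auxiliary data, and
  leaves it intact.\<close>

definition enumerates ::
    "('a \<Rightarrow> int) \<Rightarrow> com \<Rightarrow> nat \<Rightarrow> ('a, nat) ecs \<Rightarrow> nat \<Rightarrow> bool" where
  "enumerates code prog K D v \<longleftrightarrow>
     (\<forall>s. stores code D s \<and> regs s 3 = int v \<longrightarrow>
        (\<exists>tr s' ws. exec prog s tr s' \<and> stores code D s' \<and>
           distinct ws \<and> set ws = sem D v \<and>
           output_linear_delay K (map (map (\<lambda>(a, i). (code a, i))) ws) tr))"

end

theory Submission
  imports Defs
begin

text \<open>The union of two safe nodes that both sit above unions \<open>o \<union> t\<close> and \<open>o' \<union> t'\<close> is arranged as
  \<open>o \<union> (o' \<union> (t \<union> t'))\<close>: the two output nodes come first, and all output-depths stay bounded by 4.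
  The empty word is only kept at the top, as \<open>\<epsilon> \<union> u\<close>, so below it no node produces it, and products
  are expanded by distributivity.

  Enumeration is a depth-first search with backtracking over configurations that consist of the nodes
  still to be expanded and the known suffix of the word. No branch of the search fails and every
  pending node contributes a nonempty word; since between two output nodes there are at most four
  shift and union nodes, the time from one output to the next is linear in the length of the latter.\<close>

section \<open>Loop-free programs\<close>

text \<open>Output-depth follows left children only, and safety speaks about the top of a node only.
  Two difficulties result. A union node placed above two old nodes would lengthen the left path in
  every call, so the left path has to be rebuilt from output nodes, which a safe node offers at
  distance at most two. Moreover the search meets inner nodes and may start from any node, so the
  invariant has to cover all nodes and not only the results of operations. The bound 4 arises there:
  \<open>t\<close> has depth at most 2, the shift that aligns it with \<open>t'\<close> adds one,
  their union another one, while the unions above start afresh at an output node. Empty factors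
  would ruin the delay, since arbitrarily many pending nodes could be expanded without lengthening
  the word. Concatenations are searched from the right because a linked list of letters grows at its
  front and can later be printed from there. Finally, the operations must denote the right sets for
  unsafe arguments too, hence the plain constructions kept as fallbacks.\<close>

fun loop_free :: "com \<Rightarrow> bool" where
  "loop_free (Seq c1 c2) \<longleftrightarrow> loop_free c1 \<and> loop_free c2"
| "loop_free (If b c1 c2) \<longleftrightarrow> loop_free c1 \<and> loop_free c2"
| "loop_free (While b c) \<longleftrightarrow> False"
| "loop_free _ \<longleftrightarrow> True"

text \<open>A functional evaluator, so that programs can be executed symbolically by rewriting. The
  catch-all equation also covers \<open>While\<close>, where its value is a dummy:
  \<open>exec_run\<close> is restricted to loop-free programs.\<close>

fun run :: "com \<Rightarrow> state \<Rightarrow> state" where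
  "run (Assign r a) s = s\<lparr>regs := (regs s)(r := aval a s)\<rparr>"
| "run (Load r a) s = s\<lparr>regs := (regs s)(r := mem s (nat (aval a s)))\<rparr>"
| "run (Store a b) s = s\<lparr>mem := (mem s)(nat (aval a s) := aval b s)\<rparr>"
| "run (Seq c1 c2) s = run c2 (run c1 s)"
| "run (If b c1 c2) s = (if bval b s then run c1 s else run c2 s)"
| "run _ s = s"

fun trace :: "com \<Rightarrow> state \<Rightarrow> event list" where
  "trace (Seq c1 c2) s = trace c1 s @ trace c2 (run c1 s)"
| "trace (If b c1 c2) s = Tick # (if bval b s then trace c1 s else trace c2 s)"
| "trace (Out a b) s = [Emit (aval a s) (aval b s)]"
| "trace EndOut s = [Sep]"
| "trace _ s = [Tick]"

text \<open>Adding up both branches of a conditional instead of taking the maximum is crude, but all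
  that matters is a bound independent of the state.\<close>

fun time_bound :: "com \<Rightarrow> nat" where
  "time_bound (Seq c1 c2) = time_bound c1 + time_bound c2"
| "time_bound (If b c1 c2) = 1 + time_bound c1 + time_bound c2"
| "time_bound _ = 1"

fun silent :: "com \<Rightarrow> bool" where
  "silent (Seq c1 c2) \<longleftrightarrow> silent c1 \<and> silent c2"
| "silent (If b c1 c2) \<longleftrightarrow> silent c1 \<and> silent c2"
| "silent (Out a b) \<longleftrightarrow> False"
| "silent EndOut \<longleftrightarrow> False"
| "silent (While b c) \<longleftrightarrow> False"
| "silent _ \<longleftrightarrow> True"

lemma exec_run: "loop_free c \<Longrightarrow> exec c s (trace c s) (run c s)"
  by (induction c arbitrary: s) (auto intro: exec.intros)

lemma length_trace: "length (trace c s) \<le> time_bound c"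
proof (induction c arbitrary: s)
  case (Seq c1 c2)
  then show ?case by (simp add: add_mono)
next
  case (If b c1 c2)
  then show ?case by (simp add: trans_le_add1 trans_le_add2)
qed auto

lemma silent_trace: "silent c \<Longrightarrow> set (trace c s) \<subseteq> {Tick}"
  by (induction c arbitrary: s) auto

section \<open>Adding a node\<close>

definition fresh :: "('a, nat) ecs \<Rightarrow> nat" where
  "fresh D = Suc (Max (nodes D))"

definition new_node ::
    "'a label \<Rightarrow> nat option \<Rightarrow> nat option \<Rightarrow> ('a, nat) ecs \<Rightarrow> ('a, nat) ecs \<times> nat" where
  "new_node lb l r D =
     (D\<lparr>nodes := insert (fresh D) (nodes D), lft := (lft D)(fresh D := l),
        rgt := (rgt D)(fresh D := r), lab := (lab D)(fresh D := lb)\<rparr>, fresh D)"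

abbreviation new_shift :: "int \<Rightarrow> nat \<Rightarrow> ('a, nat) ecs \<Rightarrow> ('a, nat) ecs \<times> nat" where
  "new_shift k u \<equiv> new_node (Shift k) (Some u) None"

abbreviation new_cup :: "nat \<Rightarrow> nat \<Rightarrow> ('a, nat) ecs \<Rightarrow> ('a, nat) ecs \<times> nat" where
  "new_cup u1 u2 \<equiv> new_node Cup (Some u1) (Some u2)"

abbreviation new_odot :: "nat \<Rightarrow> nat \<Rightarrow> ('a, nat) ecs \<Rightarrow> ('a, nat) ecs \<times> nat" where
  "new_odot u1 u2 \<equiv> new_node Odot (Some u1) (Some u2)"

abbreviation new_sym :: "'a \<Rightarrow> ('a, nat) ecs \<Rightarrow> ('a, nat) ecs \<times> nat" where
  "new_sym a \<equiv> new_node (Sym a) None None"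

text \<open>With well-formedness of both sides included, this is a preorder on extended Shift-ECSs.
  Operations are sequences of node creations, and their properties are chained by
  transitivity.\<close>

definition ext :: "'a set \<Rightarrow> ('a, 'v) ecs \<Rightarrow> ('a, 'v) ecs \<Rightarrow> bool" where
  "ext \<Omega> D D' \<longleftrightarrow> is_ecs \<Omega> D \<and> is_ecs \<Omega> D' \<and> adds_fresh_nodes D D'"

lemma ext_refl: "is_ecs \<Omega> D \<Longrightarrow> ext \<Omega> D D"
  by (simp add: ext_def adds_fresh_nodes_def)

lemma ext_trans: "ext \<Omega> D1 D2 \<Longrightarrow> ext \<Omega> D2 D3 \<Longrightarrow> ext \<Omega> D1 D3"
  unfolding ext_def adds_fresh_nodes_def by (auto simp: subset_iff)

lemma ext_ecs: "ext \<Omega> D D' \<Longrightarrow> is_ecs \<Omega> D'"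
  by (simp add: ext_def)

lemma ext_same:
  assumes "ext \<Omega> D D'"
  shows "bot_node D' = bot_node D" "eps_node D' = eps_node D"
    "v \<in> nodes D \<Longrightarrow> v \<in> nodes D'" "v \<in> nodes D \<Longrightarrow> lft D' v = lft D v"
    "v \<in> nodes D \<Longrightarrow> rgt D' v = rgt D v" "v \<in> nodes D \<Longrightarrow> lab D' v = lab D v"
  using assms by (auto simp: ext_def adds_fresh_nodes_def)

lemma is_ecs_node:
  assumes "is_ecs \<Omega> D" "v \<in> nodes D"
  shows "lab D v = Sym a \<Longrightarrow> a \<in> \<Omega>"
    "lab D v = LBot \<longleftrightarrow> v = bot_node D" "lab D v = LEps \<longleftrightarrow> v = eps_node D"
    "lft D v \<noteq> None \<longleftrightarrow> lab D v \<in> range Shift \<union> {Cup, Odot}"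
    "rgt D v \<noteq> None \<longleftrightarrow> lab D v \<in> {Cup, Odot}"
    "lft D v = Some u \<or> rgt D v = Some u \<Longrightarrow> u \<in> nodes D"
  using assms unfolding is_ecs_def by blast+

lemma ecs_children:
  assumes "is_ecs \<Omega> D" "v \<in> nodes D"
  shows "lft D v = Some u \<Longrightarrow> u \<in> nodes D" "rgt D v = Some u \<Longrightarrow> u \<in> nodes D"
  using is_ecs_node(6)[OF assms] by blast+

lemma ecs_lft:
  assumes "is_ecs \<Omega> D" "v \<in> nodes D" "lab D v \<in> range Shift \<union> {Cup, Odot}"
  obtains u where "lft D v = Some u" "u \<in> nodes D"
  using is_ecs_node(4,6)[OF assms(1,2)] assms(3) by blast

lemma ecs_rgt:
  assumes "is_ecs \<Omega> D" "v \<in> nodes D" "lab D v \<in> {Cup, Odot}"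
  obtains u where "rgt D v = Some u" "u \<in> nodes D"
  using is_ecs_node(5,6)[OF assms(1,2)] assms(3) by blast

lemma ecs_both:
  assumes "is_ecs \<Omega> D" "v \<in> nodes D" "lab D v \<in> {Cup, Odot}"
  obtains a b where "lft D v = Some a" "rgt D v = Some b" "a \<in> nodes D" "b \<in> nodes D"
proof -
  obtain a where "lft D v = Some a" "a \<in> nodes D" using ecs_lft[OF assms(1,2)] assms(3) by blast
  moreover obtain b where "rgt D v = Some b" "b \<in> nodes D" using ecs_rgt[OF assms] by blast
  ultimately show thesis using that by blast
qed

lemma ecs_special:
  assumes "is_ecs \<Omega> D"
  shows "bot_node D \<in> nodes D" "eps_node D \<in> nodes D"
    "lab D (bot_node D) = LBot" "lab D (eps_node D) = LEps"
  using assms unfolding is_ecs_def by blast+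

lemma sem_special:
  assumes "is_ecs \<Omega> D"
  shows "sem D (bot_node D) = {}" "sem D (eps_node D) = {[]}"
  by (simp_all add: sem_equations(1,2) ecs_special(3,4)[OF assms])

lemma ecs_acyclic: "is_ecs \<Omega> D \<Longrightarrow> acyclic (edges D)"
  by (simp add: is_ecs_def)

lemma ecs_finite: "is_ecs \<Omega> D \<Longrightarrow> finite (nodes D)"
  by (simp add: is_ecs_def)

lemma fresh_greater: "is_ecs \<Omega> D \<Longrightarrow> v \<in> nodes D \<Longrightarrow> v < fresh D"
  by (simp add: fresh_def ecs_finite less_Suc_eq_le)

lemma fresh_notin: "is_ecs \<Omega> D \<Longrightarrow> fresh D \<notin> nodes D"
  using fresh_greater by blast

text \<open>No edge enters \<open>y\<close>. Hence a path that starts elsewhere never visits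
  \<open>y\<close> and already lies in \<open>r\<close>, and a path that starts in \<open>y\<close>
  cannot return.\<close>

lemma acyclic_add_source:
  assumes "acyclic r" and "y \<notin> Range r" and "y \<notin> B"
  shows "acyclic (r \<union> {y} \<times> B)"
proof -
  let ?r = "r \<union> {y} \<times> B"
  have ran: "y \<notin> Range ?r" using assms by auto
  have "(a, b) \<in> r\<^sup>+" if "(a, b) \<in> ?r\<^sup>+" "a \<noteq> y" for a b
    using that
  proof (induction rule: trancl_induct)
    case (base b)
    then show ?case by auto
  next
    case (step b c)
    have "b \<in> Range ?r" using step.hyps(1) by (metis RangeI tranclD2)
    then have "(b, c) \<in> r" using ran step.hyps(2) by auto
    then show ?case using step by (meson trancl.trancl_into_trancl)
  qed
  moreover have "(y, y) \<notin> ?r\<^sup>+" using ran by (metis RangeI tranclD2)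
  ultimately show ?thesis using assms(1) unfolding acyclic_def by metis
qed

lemma new_node_ext:
  assumes D: "is_ecs \<Omega> D" and lb: "lb \<notin> {LBot, LEps}" "\<And>a. lb = Sym a \<Longrightarrow> a \<in> \<Omega>"
    and l: "l \<noteq> None \<longleftrightarrow> lb \<in> range Shift \<union> {Cup, Odot}" "set_option l \<subseteq> nodes D"
    and r: "r \<noteq> None \<longleftrightarrow> lb \<in> {Cup, Odot}" "set_option r \<subseteq> nodes D"
  shows "ext \<Omega> D (fst (new_node lb l r D))"
proof -
  let ?D = "fst (new_node lb l r D)" and ?n = "fresh D"
  note n = fresh_notin[OF D]
  have edges: "edges ?D = edges D \<union> {?n} \<times> (set_option l \<union> set_option r)"
    using n by (auto simp: edges_def new_node_def split: if_splits)
  have ran: "Range (edges D) \<subseteq> nodes D"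
    by (auto simp: edges_def dest: ecs_children[OF D])
  have special: "bot_node D \<noteq> ?n" "eps_node D \<noteq> ?n" using ecs_special[OF D] n by metis+
  have "acyclic (edges ?D)"
    unfolding edges using D n ran l r by (intro acyclic_add_source) (auto dest: ecs_acyclic)
  then have "is_ecs \<Omega> ?D"
    unfolding is_ecs_def
  proof (intro conjI ballI)
    fix v assume v: "v \<in> nodes ?D"
    note node = is_ecs_node[OF D, of v]
    show "\<forall>a. lab ?D v = Sym a \<longrightarrow> a \<in> \<Omega>" "lab ?D v = LBot \<longleftrightarrow> v = bot_node ?D"
      "lab ?D v = LEps \<longleftrightarrow> v = eps_node ?D"
      "lft ?D v \<noteq> None \<longleftrightarrow> lab ?D v \<in> range Shift \<union> {Cup, Odot}"
      "rgt ?D v \<noteq> None \<longleftrightarrow> lab ?D v \<in> {Cup, Odot}"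
      "\<forall>u. lft ?D v = Some u \<or> rgt ?D v = Some u \<longrightarrow> u \<in> nodes ?D"
      using v lb l r n special node(1-5)
      by (cases "v = ?n"; auto simp: new_node_def dest: ecs_children[OF D])+
  qed (use D in \<open>auto simp: new_node_def ecs_finite ecs_special\<close>)
  moreover have "adds_fresh_nodes D ?D"
    using n by (auto simp: adds_fresh_nodes_def new_node_def)
  ultimately show ?thesis using D by (simp add: ext_def)
qed

lemma new_node_sel:
  assumes "new_node lb l r D = (D', v)"
  shows "v = fresh D" "v \<in> nodes D'" "lft D' v = l" "rgt D' v = r" "lab D' v = lb"
    "nodes D' = insert v (nodes D)"
  using assms by (auto simp: new_node_def)

text \<open>Derivations only descend to children, which stay in \<open>nodes D\<close>. With two
  structures that agree with \<open>D\<close> there, both inclusions needed in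
  \<open>ext_sem\<close> are instances, \<open>D\<close> itself playing either role.\<close>

lemma denotes_transfer:
  assumes "is_ecs \<Omega> D"
    and "\<And>v. v \<in> nodes D \<Longrightarrow> lft D v = lft D1 v \<and> rgt D v = rgt D1 v \<and> lab D v = lab D1 v"
    and "\<And>v. v \<in> nodes D \<Longrightarrow> lft D v = lft D2 v \<and> rgt D v = rgt D2 v \<and> lab D v = lab D2 v"
    and "denotes D1 v w" and "v \<in> nodes D"
  shows "denotes D2 v w"
  using assms(4,5)
  by (induction rule: denotes.induct)
    (metis denotes.intros assms(2,3) ecs_children[OF assms(1)])+

lemma ext_sem:
  assumes "ext \<Omega> D D'" and v: "v \<in> nodes D"
  shows "sem D' v = sem D v"
proof -
  have D: "is_ecs \<Omega> D" using assms by (simp add: ext_def)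
  have same: "lft D v = lft D v \<and> rgt D v = rgt D v \<and> lab D v = lab D v"
    "lft D v = lft D' v \<and> rgt D v = rgt D' v \<and> lab D v = lab D' v" if "v \<in> nodes D" for v
    using ext_same(4-6)[OF assms(1) that] by simp_all
  have "denotes D' v w \<longleftrightarrow> denotes D v w" for w
    using denotes_transfer[OF D same(1) same(2) _ v] denotes_transfer[OF D same(2) same(1) _ v]
    by blast
  then show ?thesis by (simp add: sem_def)
qed

section \<open>Specification of single node creations\<close>

lemma new_shift_spec:
  assumes "is_ecs \<Omega> D" "u \<in> nodes D" "new_shift k u D = (D', v)"
  shows "ext \<Omega> D D'" "v \<in> nodes D'" "sem D' v = (\<lambda>w. sh w k) ` sem D u"
proof -
  show e: "ext \<Omega> D D'" using new_node_ext[OF assms(1), of "Shift k" "Some u" None] assms by simp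
  note s = new_node_sel[OF assms(3)]
  show "v \<in> nodes D'" by (rule s)
  show "sem D' v = (\<lambda>w. sh w k) ` sem D u"
    using sem_equations(6)[OF s(5) s(3)] ext_sem[OF e assms(2)] by simp
qed

lemma new_cup_spec:
  assumes "is_ecs \<Omega> D" "u1 \<in> nodes D" "u2 \<in> nodes D" "new_cup u1 u2 D = (D', v)"
  shows "ext \<Omega> D D'" "v \<in> nodes D'" "sem D' v = sem D u1 \<union> sem D u2"
proof -
  show e: "ext \<Omega> D D'" using new_node_ext[OF assms(1), of Cup "Some u1" "Some u2"] assms by simp
  note s = new_node_sel[OF assms(4)]
  show "v \<in> nodes D'" by (rule s)
  show "sem D' v = sem D u1 \<union> sem D u2"
    using sem_equations(4)[OF s(5) s(3,4)] ext_sem[OF e assms(2)] ext_sem[OF e assms(3)] by simp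
qed

lemma new_odot_spec:
  assumes "is_ecs \<Omega> D" "u1 \<in> nodes D" "u2 \<in> nodes D" "new_odot u1 u2 D = (D', v)"
  shows "ext \<Omega> D D'" "v \<in> nodes D'" "sem D' v = lang_conc (sem D u1) (sem D u2)"
proof -
  show e: "ext \<Omega> D D'" using new_node_ext[OF assms(1), of Odot "Some u1" "Some u2"] assms by simp
  note s = new_node_sel[OF assms(4)]
  show "v \<in> nodes D'" by (rule s)
  show "sem D' v = lang_conc (sem D u1) (sem D u2)"
    using sem_equations(5)[OF s(5) s(3,4)] ext_sem[OF e assms(2)] ext_sem[OF e assms(3)] by simp
qed

lemma new_sym_spec:
  assumes "is_ecs \<Omega> D" "a \<in> \<Omega>" "new_sym a D = (D', v)"
  shows "ext \<Omega> D D'" "v \<in> nodes D'" "sem D' v = {[(a, 1)]}"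
proof -
  show e: "ext \<Omega> D D'" using new_node_ext[OF assms(1), of "Sym a" None None] assms by auto
  note s = new_node_sel[OF assms(3)]
  show "v \<in> nodes D'" by (rule s)
  show "sem D' v = {[(a, 1)]}" using sem_equations(3)[OF s(5)] by simp
qed

section \<open>The operations\<close>

lemma sh_sh: "sh (sh w j) k = sh w (j + k)"
  by (simp add: sh_def case_prod_beta add.assoc)

lemma sh_0: "sh w 0 = w"
  by (simp add: sh_def)

lemma sh_append: "sh (x @ y) k = sh x k @ sh y k"
  by (simp add: sh_def)

lemma sh_inject: "sh w k = sh w' k \<Longrightarrow> w = w'"
  by (metis sh_sh sh_0 add.right_inverse)

lemma sh_image_sh_image: "(\<lambda>w. sh w k) ` (\<lambda>w. sh w j) ` A = (\<lambda>w. sh w (j + k)) ` A"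
  by (simp add: image_image sh_sh)

text \<open>Injectivity cancels the shift. Disjointness of children below a relative shift is
  thereby reduced to disjointness as seen from the top.\<close>

lemma sh_image_disjoint_iff:
  "(\<lambda>w. sh w k) ` A \<inter> (\<lambda>w. sh w k) ` B = {} \<longleftrightarrow> A \<inter> B = {}"
  by (metis (no_types, lifting) image_Int image_is_empty injI sh_inject)

text \<open>The result is safe if \<open>u\<close> is an output node and \<open>u'\<close> has output-depth at most 1.\<close>

definition attach :: "int \<Rightarrow> nat \<Rightarrow> int \<Rightarrow> nat \<Rightarrow> ('a, nat) ecs \<Rightarrow> ('a, nat) ecs \<times> nat" where
  "attach k u k' u' D =
     (let (D1, a) = new_shift (k' - k) u' D; (D2, b) = new_cup u a D1 in new_shift k b D2)"

text \<open>The shift by 0 changes no word; it is there because a safe node has to be a shift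
  node.\<close>

definition prod_core :: "nat \<Rightarrow> nat \<Rightarrow> ('a, nat) ecs \<Rightarrow> ('a, nat) ecs \<times> nat" where
  "prod_core p q D = (let (D1, a) = new_odot p q D in new_shift 0 a D1)"

text \<open>Two consecutive shifts are merged into one above the old child, because a shift on top
  of a shift node would not be safe.\<close>

definition shift_core :: "nat \<Rightarrow> int \<Rightarrow> ('a, nat) ecs \<Rightarrow> ('a, nat) ecs \<times> nat" where
  "shift_core v k D =
     (case lab D v of
        Shift j \<Rightarrow> new_shift (j + k) (the (lft D v)) D
      | _ \<Rightarrow> new_shift k v D)"

text \<open>The node \<open>u\<close> lies under offset \<open>k\<close> and \<open>u'\<close> under
  offset \<open>k'\<close>. Everything but the left child of \<open>u\<close> ends up under
  \<open>k'\<close>, so the right child of \<open>u\<close> is moved by \<open>k - k'\<close> to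
  compensate.\<close>

definition interleave :: "int \<Rightarrow> nat \<Rightarrow> int \<Rightarrow> nat \<Rightarrow> ('a, nat) ecs \<Rightarrow> ('a, nat) ecs \<times> nat" where
  "interleave k u k' u' D =
     (let (D1, a) = new_shift (k - k') (the (rgt D u)) D;
          (D2, b) = new_cup a (the (rgt D u')) D1;
          (D3, c) = new_cup (the (lft D u')) b D2
      in attach k (the (lft D u)) k' c D3)"

text \<open>Commutativity of union allows an output node from either side to be put on the left. For
  safe arguments one of the first three constructions always applies; \<open>new_cup\<close> keeps
  the semantics right for all other nodes.\<close>

definition union_core :: "nat \<Rightarrow> nat \<Rightarrow> ('a, nat) ecs \<Rightarrow> ('a, nat) ecs \<times> nat" where
  "union_core p q D =
     (case (lab D p, lab D q) of
        (Shift k, Shift k') \<Rightarrow>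
          (let u = the (lft D p); u' = the (lft D q) in
             if output_node D u then attach k u k' u' D
             else if output_node D u' then attach k' u' k u D
             else if union_node D u \<and> union_node D u' then interleave k u k' u' D
             else new_cup p q D)
      | _ \<Rightarrow> new_cup p q D)"

definition split_eps :: "('a, nat) ecs \<Rightarrow> nat \<Rightarrow> bool \<times> nat" where
  "split_eps D v =
     (if lab D v = Cup \<and> lft D v = Some (eps_node D) then (True, the (rgt D v)) else (False, v))"

definition join_eps :: "bool \<Rightarrow> ('a, nat) ecs \<times> nat \<Rightarrow> ('a, nat) ecs \<times> nat" where
  "join_eps f = (\<lambda>(D, v). if f then new_cup (eps_node D) v D else (D, v))"

text \<open>With the empty word split off, (\<epsilon> + A)(\<epsilon> + B) = \<epsilon> + A + B +
  AB. The summand A is present if the second argument has \<epsilon>, B if the first one has it, and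
  \<epsilon> if both do.\<close>

definition prod_op :: "nat \<Rightarrow> nat \<Rightarrow> ('a, nat) ecs \<Rightarrow> ('a, nat) ecs \<times> nat" where
  "prod_op v1 v2 D =
     (if v1 = bot_node D \<or> v2 = bot_node D then (D, bot_node D)
      else if v1 = eps_node D then (D, v2)
      else if v2 = eps_node D then (D, v1)
      else
        (let (f1, p1) = split_eps D v1; (f2, p2) = split_eps D v2;
             (D1, q1) = prod_core p1 p2 D;
             (D2, q2) = (if f2 then union_core p1 q1 D1 else (D1, q1));
             (D3, q3) = (if f1 then union_core p2 q2 D2 else (D2, q2))
         in join_eps (f1 \<and> f2) (D3, q3)))"

definition union_op :: "nat \<Rightarrow> nat \<Rightarrow> ('a, nat) ecs \<Rightarrow> ('a, nat) ecs \<times> nat" where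
  "union_op v3 v4 D =
     (if v4 = bot_node D then (D, v3)
      else if v3 = bot_node D then (D, v4)
      else if v3 = eps_node D then new_cup (eps_node D) v4 D
      else if v4 = eps_node D then new_cup (eps_node D) v3 D
      else
        (let (f3, p3) = split_eps D v3; (f4, p4) = split_eps D v4
         in join_eps (f3 \<or> f4) (union_core p3 p4 D)))"

definition shift_op :: "nat \<Rightarrow> int \<Rightarrow> ('a, nat) ecs \<Rightarrow> ('a, nat) ecs \<times> nat" where
  "shift_op v k D =
     (if v = bot_node D \<or> v = eps_node D then (D, v)
      else (let (f, p) = split_eps D v in join_eps f (shift_core p k D)))"

fun apply_op :: "('a, nat) ecs \<Rightarrow> 'a call \<Rightarrow> ('a, nat) ecs \<times> nat" where
  "apply_op D (CAdd a) = (let (D1, u) = new_sym a D in new_shift 0 u D1)"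
| "apply_op D (CProd v1 v2) = prod_op v1 v2 D"
| "apply_op D (CUnion v3 v4) = union_op v3 v4 D"
| "apply_op D (CShift v k) = shift_op v k D"

section \<open>The operations denote the right sets\<close>

lemma attach_spec:
  assumes D: "is_ecs \<Omega> D" and u: "u \<in> nodes D" "u' \<in> nodes D"
    and a: "attach k u k' u' D = (D', v)"
  shows "ext \<Omega> D D'" "v \<in> nodes D'"
    "sem D' v = (\<lambda>w. sh w k) ` sem D u \<union> (\<lambda>w. sh w k') ` sem D u'"
proof -
  obtain D1 a where 1: "new_shift (k' - k) u' D = (D1, a)" by fastforce
  obtain D2 b where 2: "new_cup u a D1 = (D2, b)" by fastforce
  have 3: "new_shift k b D2 = (D', v)" using a 1 2 by (simp add: attach_def)
  note s1 = new_shift_spec[OF D u(2) 1]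
  have u1: "u \<in> nodes D1" using ext_same(3)[OF s1(1)] u by blast
  note s2 = new_cup_spec[OF ext_ecs[OF s1(1)] u1 s1(2) 2]
  note s3 = new_shift_spec[OF ext_ecs[OF s2(1)] s2(2) 3]
  show "ext \<Omega> D D'" using s1(1) s2(1) s3(1) by (blast intro: ext_trans)
  show "v \<in> nodes D'" by (rule s3)
  show "sem D' v = (\<lambda>w. sh w k) ` sem D u \<union> (\<lambda>w. sh w k') ` sem D u'"
    using s3(3) s2(3) s1(3) ext_sem[OF s1(1) u(1)] by (simp add: image_Un sh_image_sh_image)
qed

lemma prod_core_spec:
  assumes D: "is_ecs \<Omega> D" and u: "p \<in> nodes D" "q \<in> nodes D"
    and a: "prod_core p q D = (D', v)"
  shows "ext \<Omega> D D'" "v \<in> nodes D'" "sem D' v = lang_conc (sem D p) (sem D q)"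
proof -
  obtain D1 a where 1: "new_odot p q D = (D1, a)" by fastforce
  have 2: "new_shift 0 a D1 = (D', v)" using a 1 by (simp add: prod_core_def)
  note s1 = new_odot_spec[OF D u 1]
  note s2 = new_shift_spec[OF ext_ecs[OF s1(1)] s1(2) 2]
  show "ext \<Omega> D D'" using s1(1) s2(1) by (blast intro: ext_trans)
  show "v \<in> nodes D'" by (rule s2)
  show "sem D' v = lang_conc (sem D p) (sem D q)" using s1(3) s2(3) by (simp add: sh_0)
qed

lemma shift_core_spec:
  assumes D: "is_ecs \<Omega> D" and u: "p \<in> nodes D" and a: "shift_core p k D = (D', v)"
  shows "ext \<Omega> D D' \<and> v \<in> nodes D' \<and> sem D' v = (\<lambda>w. sh w k) ` sem D p"
proof (cases "\<exists>j. lab D p = Shift j")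
  case True
  then obtain j where j: "lab D p = Shift j" by blast
  then obtain u' where u': "lft D p = Some u'" "u' \<in> nodes D" using ecs_lft[OF D u] by auto
  have 1: "new_shift (j + k) u' D = (D', v)" using a j u' by (simp add: shift_core_def)
  show ?thesis
    using new_shift_spec[OF D u'(2) 1] sem_equations(6)[OF j u'(1)]
    by (simp add: sh_image_sh_image)
next
  case False
  then have "new_shift k p D = (D', v)" using a by (auto simp: shift_core_def split: label.splits)
  then show ?thesis using new_shift_spec[OF D u] by blast
qed

lemma interleave_spec:
  assumes D: "is_ecs \<Omega> D" and u: "u \<in> nodes D" "u' \<in> nodes D" "lab D u = Cup" "lab D u' = Cup"
    and a: "interleave k u k' u' D = (D', v)"
  shows "ext \<Omega> D D' \<and> v \<in> nodes D' \<and>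
    sem D' v = (\<lambda>w. sh w k) ` sem D u \<union> (\<lambda>w. sh w k') ` sem D u'"
proof -
  obtain x y where xy: "lft D u = Some x" "rgt D u = Some y" "x \<in> nodes D" "y \<in> nodes D"
    by (rule ecs_both[OF D u(1)]) (simp add: u)
  note x = xy(1,3) and y = xy(2,4)
  obtain x' y' where xy': "lft D u' = Some x'" "rgt D u' = Some y'" "x' \<in> nodes D" "y' \<in> nodes D"
    by (rule ecs_both[OF D u(2)]) (simp add: u)
  note x' = xy'(1,3) and y' = xy'(2,4)
  obtain D1 a where 1: "new_shift (k - k') y D = (D1, a)" by fastforce
  obtain D2 b where 2: "new_cup a y' D1 = (D2, b)" by fastforce
  obtain D3 c where 3: "new_cup x' b D2 = (D3, c)" by fastforce
  have 4: "attach k x k' c D3 = (D', v)" using a 1 2 3 x y x' y' by (simp add: interleave_def)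
  note s1 = new_shift_spec[OF D y(2) 1]
  note s2 = new_cup_spec[OF ext_ecs[OF s1(1)] s1(2) ext_same(3)[OF s1(1) y'(2)] 2]
  have e2: "ext \<Omega> D D2" using s1(1) s2(1) by (rule ext_trans)
  note s3 = new_cup_spec[OF ext_ecs[OF e2] ext_same(3)[OF e2 x'(2)] s2(2) 3]
  have e3: "ext \<Omega> D D3" using e2 s3(1) by (rule ext_trans)
  note s4 = attach_spec[OF ext_ecs[OF e3] ext_same(3)[OF e3 x(2)] s3(2) 4]
  have "sem D' v = (\<lambda>w. sh w k) ` sem D u \<union> (\<lambda>w. sh w k') ` sem D u'"
    using s1(3) s2(3) s3(3) s4(3) ext_sem[OF s1(1) y'(2)] ext_sem[OF e2 x'(2)]
      ext_sem[OF e3 x(2)] sem_equations(4)[OF u(3) x(1) y(1)] sem_equations(4)[OF u(4) x'(1) y'(1)]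
    by (auto simp: image_Un sh_image_sh_image)
  then show ?thesis using ext_trans[OF e3 s4(1)] s4(2) by blast
qed

lemma union_core_spec:
  assumes D: "is_ecs \<Omega> D" and u: "p \<in> nodes D" "q \<in> nodes D"
    and a: "union_core p q D = (D', v)"
  shows "ext \<Omega> D D' \<and> v \<in> nodes D' \<and> sem D' v = sem D p \<union> sem D q"
proof (cases "new_cup p q D = (D', v)")
  case True
  then show ?thesis using new_cup_spec[OF D u] by blast
next
  case False
  then obtain k k' where k: "lab D p = Shift k" "lab D q = Shift k'"
    using a by (auto simp: union_core_def split: label.splits)
  obtain w where w: "lft D p = Some w" "w \<in> nodes D" using k ecs_lft[OF D u(1)] by auto
  obtain w' where w': "lft D q = Some w'" "w' \<in> nodes D" using k ecs_lft[OF D u(2)] by auto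
  note se = sem_equations(6)[OF k(1) w(1)] sem_equations(6)[OF k(2) w'(1)]
  consider "attach k w k' w' D = (D', v)" | "attach k' w' k w D = (D', v)"
    | "lab D w = Cup" "lab D w' = Cup" "interleave k w k' w' D = (D', v)"
    using a False k w w' by (auto simp: union_core_def union_node_def split: if_splits)
  then show ?thesis
  proof cases
    case 1
    from attach_spec[OF D w(2) w'(2) this] se show ?thesis by simp
  next
    case 2
    from attach_spec[OF D w'(2) w(2) this] se show ?thesis by (simp add: Un_commute)
  next
    case 3
    then show ?thesis using interleave_spec[OF D w(2) w'(2)] se by simp
  qed
qed

lemma split_eps_spec:
  assumes D: "is_ecs \<Omega> D" and v: "v \<in> nodes D" and s: "split_eps D v = (f, p)"
  shows "p \<in> nodes D" "sem D v = (if f then {[]} else {}) \<union> sem D p"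
proof -
  have "p \<in> nodes D \<and> sem D v = (if f then {[]} else {}) \<union> sem D p"
  proof (cases "lab D v = Cup \<and> lft D v = Some (eps_node D)")
    case True
    then obtain u where u: "rgt D v = Some u" "u \<in> nodes D" using ecs_rgt[OF D v] by auto
    have "f" "p = u" using s u True by (auto simp: split_eps_def)
    then show ?thesis
      using u True sem_equations(4)[of D v "eps_node D" u] sem_special(2)[OF D]
      by simp
  next
    case False
    then show ?thesis using s v by (auto simp: split_eps_def split: if_splits)
  qed
  then show "p \<in> nodes D" "sem D v = (if f then {[]} else {}) \<union> sem D p" by blast+
qed

lemma join_eps_spec:
  assumes D: "is_ecs \<Omega> D" and u: "p \<in> nodes D" and a: "join_eps f (D, p) = (D', v)"
  shows "ext \<Omega> D D' \<and> v \<in> nodes D' \<and> sem D' v = (if f then {[]} else {}) \<union> sem D p"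
proof (cases f)
  case True
  then have "new_cup (eps_node D) p D = (D', v)" using a by (simp add: join_eps_def)
  then show ?thesis
    using new_cup_spec[OF D ecs_special(2)[OF D] u] True sem_special(2)[OF D]
    by simp
next
  case False
  then show ?thesis using a D u by (simp add: join_eps_def ext_refl)
qed

lemma lang_conc_simps:
  "lang_conc {} B = {}" "lang_conc A {} = {}" "lang_conc {[]} B = B" "lang_conc A {[]} = A"
  "lang_conc (A \<union> A') B = lang_conc A B \<union> lang_conc A' B"
  "lang_conc A (B \<union> B') = lang_conc A B \<union> lang_conc A B'"
  by (auto simp: lang_conc_def)

lemma prod_op_spec:
  assumes D: "is_ecs \<Omega> D" and v: "v1 \<in> nodes D" "v2 \<in> nodes D" and a: "prod_op v1 v2 D = (D', v)"
  shows "ext \<Omega> D D' \<and> v \<in> nodes D' \<and> sem D' v = lang_conc (sem D v1) (sem D v2)"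
proof (cases "{v1, v2} \<inter> {bot_node D, eps_node D} = {}")
  case False
  note sem_special[OF D]
  moreover from False a have "D' = D" by (auto simp: prod_op_def split: if_splits)
  ultimately show ?thesis
    using False a v ext_refl[OF D] ecs_special(1,2)[OF D]
    by (auto simp: prod_op_def lang_conc_simps split: if_splits)
next
  case True
  obtain f1 p1 f2 p2 where sp: "split_eps D v1 = (f1, p1)" "split_eps D v2 = (f2, p2)" by fastforce
  obtain D1 q1 where 1: "prod_core p1 p2 D = (D1, q1)" by fastforce
  obtain D2 q2 where 2: "(if f2 then union_core p1 q1 D1 else (D1, q1)) = (D2, q2)" by fastforce
  obtain D3 q3 where 3: "(if f1 then union_core p2 q2 D2 else (D2, q2)) = (D3, q3)" by fastforce
  have 4: "join_eps (f1 \<and> f2) (D3, q3) = (D', v)"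
    using a True sp 1 2 3 by (simp add: prod_op_def)
  note t1 = split_eps_spec[OF D v(1) sp(1)] and t2 = split_eps_spec[OF D v(2) sp(2)]
  note s1 = prod_core_spec[OF D t1(1) t2(1) 1]
  have s2: "ext \<Omega> D1 D2 \<and> q2 \<in> nodes D2 \<and>
      sem D2 q2 = (if f2 then sem D1 p1 else {}) \<union> sem D1 q1"
    using 2 union_core_spec[OF ext_ecs[OF s1(1)] ext_same(3)[OF s1(1) t1(1)] s1(2)] s1(2)
      ext_refl[OF ext_ecs[OF s1(1)]] by (auto split: if_splits)
  then have e2: "ext \<Omega> D D2" using s1(1) ext_trans by blast
  have s3: "ext \<Omega> D2 D3 \<and> q3 \<in> nodes D3 \<and>
      sem D3 q3 = (if f1 then sem D2 p2 else {}) \<union> sem D2 q2"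
    using 3 union_core_spec[OF ext_ecs[OF e2] ext_same(3)[OF e2 t2(1)], of q2] s2
      ext_refl[OF ext_ecs[OF e2]] by (auto split: if_splits)
  then have e3: "ext \<Omega> D D3" using e2 ext_trans by blast
  have s4: "ext \<Omega> D3 D' \<and> v \<in> nodes D' \<and>
      sem D' v = (if f1 \<and> f2 then {[]} else {}) \<union> sem D3 q3"
    using join_eps_spec[OF ext_ecs[OF e3] _ 4] s3 by blast
  have "sem D' v = lang_conc (sem D v1) (sem D v2)"
    using s1(3) s2 s3 s4 t1(2) t2(2) ext_sem[OF s1(1) t1(1)] ext_sem[OF e2 t2(1)]
    by (auto simp: lang_conc_simps)
  then show ?thesis using s4 ext_trans[OF e3] by blast
qed

lemma union_op_spec:
  assumes D: "is_ecs \<Omega> D" and v: "v3 \<in> nodes D" "v4 \<in> nodes D" and a: "union_op v3 v4 D = (D', v)"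
  shows "ext \<Omega> D D' \<and> v \<in> nodes D' \<and> sem D' v = sem D v3 \<union> sem D v4"
proof (cases "{v3, v4} \<inter> {bot_node D, eps_node D} = {}")
  case False
  note sem_special[OF D]
  then show ?thesis
    using False a v ext_refl[OF D] new_cup_spec[OF D ecs_special(2)[OF D] v(1)]
      new_cup_spec[OF D ecs_special(2)[OF D] v(2)]
    by (auto simp: union_op_def split: if_splits)
next
  case True
  obtain f3 p3 f4 p4 where sp: "split_eps D v3 = (f3, p3)" "split_eps D v4 = (f4, p4)" by fastforce
  obtain D1 q where 1: "union_core p3 p4 D = (D1, q)" by fastforce
  have 2: "join_eps (f3 \<or> f4) (D1, q) = (D', v)" using a True sp 1 by (simp add: union_op_def)
  note t3 = split_eps_spec[OF D v(1) sp(1)] and t4 = split_eps_spec[OF D v(2) sp(2)]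
  note s1 = union_core_spec[OF D t3(1) t4(1) 1]
  note s2 = join_eps_spec[OF ext_ecs[OF s1[THEN conjunct1]] _ 2]
  show ?thesis using s1 s2 t3(2) t4(2) by (auto intro: ext_trans)
qed

lemma shift_op_spec:
  assumes D: "is_ecs \<Omega> D" and v: "v0 \<in> nodes D" and a: "shift_op v0 k D = (D', v)"
  shows "ext \<Omega> D D' \<and> v \<in> nodes D' \<and> sem D' v = (\<lambda>w. sh w k) ` sem D v0"
proof (cases "v0 = bot_node D \<or> v0 = eps_node D")
  case True
  note sem_special[OF D]
  then show ?thesis using True a v ext_refl[OF D] by (auto simp: shift_op_def sh_def)
next
  case False
  obtain f p where sp: "split_eps D v0 = (f, p)" by fastforce
  obtain D1 q where 1: "shift_core p k D = (D1, q)" by fastforce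
  have 2: "join_eps f (D1, q) = (D', v)" using a False sp 1 by (simp add: shift_op_def)
  note t = split_eps_spec[OF D v sp]
  note s1 = shift_core_spec[OF D t(1) 1]
  note s2 = join_eps_spec[OF ext_ecs[OF s1[THEN conjunct1]] _ 2]
  show ?thesis using s1 s2 t(2) by (auto simp: sh_def intro: ext_trans)
qed

lemma add_op_spec:
  assumes D: "is_ecs \<Omega> D" and a: "a \<in> \<Omega>" "apply_op D (CAdd a) = (D', v)"
  shows "ext \<Omega> D D' \<and> v \<in> nodes D' \<and> sem D' v = {[(a, 1)]}"
proof -
  obtain D1 u where 1: "new_sym a D = (D1, u)" by fastforce
  have 2: "new_shift 0 u D1 = (D', v)" using a(2) 1 by simp
  note s1 = new_sym_spec[OF D a(1) 1]
  note s2 = new_shift_spec[OF ext_ecs[OF s1(1)] s1(2) 2]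
  show ?thesis using s1 s2 by (auto simp: sh_0 intro: ext_trans)
qed

lemma apply_op_spec:
  assumes "is_ecs \<Omega> D" "call_assm \<Omega> D c" "apply_op D c = (D', v)"
  shows "ext \<Omega> D D' \<and> v \<in> nodes D' \<and> sem D' v = call_sem D c"
proof (cases c)
  case (CAdd a)
  then show ?thesis using add_op_spec[of \<Omega> D a] assms by simp
next
  case (CProd v1 v2)
  then show ?thesis using prod_op_spec[of \<Omega> D v1 v2] assms by simp
next
  case (CUnion v3 v4)
  then show ?thesis using union_op_spec[of \<Omega> D v3 v4] assms by simp
next
  case (CShift v k)
  then show ?thesis using shift_op_spec[of \<Omega> D v k] assms by simp
qed

lemma correct_apply_op: "correct_operations \<Omega> apply_op"
proof -
  have "bot_behaviour D c v" if "apply_op D c = (D', v)" for D :: "('a, nat) ecs" and c D' v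
    using that by (cases c) (auto simp: prod_op_def union_op_def shift_op_def split: if_splits)
  then show ?thesis
    unfolding correct_operations_def using apply_op_spec[of \<Omega>]
    by (auto simp: ext_def split: prod.splits)
qed

section \<open>Preservation of safety\<close>

text \<open>The nodes that the search may expand. The condition is local and becomes hereditary
  through \<open>node_ok\<close>, which replaces reasoning about reachability of the \<epsilon>-node
  (see \<open>good_eps_free\<close>).\<close>

definition good :: "('a, nat) ecs \<Rightarrow> nat \<Rightarrow> bool" where
  "good D v \<longleftrightarrow> v \<in> nodes D \<and> lab D v \<notin> {LBot, LEps} \<and>
     \<not> (lab D v = Cup \<and> lft D v = Some (eps_node D))"

definition child :: "('a, nat) ecs \<Rightarrow> nat \<Rightarrow> nat \<Rightarrow> bool" where
  "child D v u \<longleftrightarrow> lft D v = Some u \<or> rgt D v = Some u"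

text \<open>Output-depth 4 is reached by the unions of \<^const>\<open>interleave\<close>.\<close>

definition node_ok :: "('a, nat) ecs \<Rightarrow> nat \<Rightarrow> bool" where
  "node_ok D v \<longleftrightarrow>
     (\<forall>u. child D v u \<longrightarrow> u < v) \<and>
     (good D v \<longrightarrow> (\<exists>n \<le> 4. odepth D v n) \<and> (\<forall>u. child D v u \<longrightarrow> good D u)) \<and>
     (\<forall>a b. lab D v = Cup \<longrightarrow> lft D v = Some a \<longrightarrow> rgt D v = Some b \<longrightarrow>
        good D b \<and> sem D a \<inter> sem D b = {}) \<and>
     (\<forall>a b. lab D v = Odot \<longrightarrow> lft D v = Some a \<longrightarrow> rgt D v = Some b \<longrightarrow>
        unique_decomp (sem D a) (sem D b))"

text \<open>Auxiliary nodes that no operation returned are covered as well, because enumeration may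
  start from any node. Later fresh nodes do not affect \<open>node_ok\<close> of old ones, so that
  only the new node has to be checked in each creation.\<close>

definition well_built :: "'a set \<Rightarrow> ('a, nat) ecs \<Rightarrow> bool" where
  "well_built \<Omega> D \<longleftrightarrow> is_ecs \<Omega> D \<and> (\<forall>v \<in> nodes D. node_ok D v)"

lemma well_built_ecs: "well_built \<Omega> D \<Longrightarrow> is_ecs \<Omega> D"
  by (simp add: well_built_def)

lemma good_in: "good D v \<Longrightarrow> v \<in> nodes D"
  by (simp add: good_def)

section \<open>Stability of the invariant under extension\<close>

lemma ext_good: "ext \<Omega> D D' \<Longrightarrow> v \<in> nodes D \<Longrightarrow> good D' v \<longleftrightarrow> good D v"
  by (simp add: good_def ext_same)

lemma ext_child: "ext \<Omega> D D' \<Longrightarrow> v \<in> nodes D \<Longrightarrow> child D' v u \<longleftrightarrow> child D v u"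
  by (simp add: child_def ext_same)

lemma child_in: "is_ecs \<Omega> D \<Longrightarrow> v \<in> nodes D \<Longrightarrow> child D v u \<Longrightarrow> u \<in> nodes D"
  unfolding child_def using ecs_children by metis

lemma ext_kind:
  assumes "ext \<Omega> D D'" "v \<in> nodes D"
  shows "output_node D' v \<longleftrightarrow> output_node D v" "shift_node D' v \<longleftrightarrow> shift_node D v"
    "union_node D' v \<longleftrightarrow> union_node D v"
  using assms by (simp_all add: output_node_def shift_node_def union_node_def ext_same)

lemma ext_odepth:
  assumes "ext \<Omega> D D'"
  shows "odepth D v n \<Longrightarrow> v \<in> nodes D \<Longrightarrow> odepth D' v n"
proof (induction rule: odepth.induct)
  case (1 v)
  then show ?case using ext_kind(1)[OF assms] by (blast intro: odepth.intros)
next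
  case (2 v u n)
  have "u \<in> nodes D" using 2 assms ecs_children(1) unfolding ext_def by metis
  with 2 show ?case
    using odepth.intros(2)[of D' v u n] ext_kind[OF assms] ext_same(4)[OF assms] by simp
qed

lemma ext_safe:
  assumes e: "ext \<Omega> D D'" and v: "v \<in> nodes D" and s: "safe D v"
  shows "safe D' v"
proof -
  have D: "is_ecs \<Omega> D" using e by (simp add: ext_def)
  obtain u where u: "lft D v = Some u" "u \<in> nodes D"
    using s ecs_children(1)[OF D v] by (auto simp: safe_def)
  consider "output_node D u" | t n where "union_node D u" "odepth D u 1" "rgt D u = Some t"
      "shift_node D t" "n \<le> 2" "odepth D t n"
    using s u by (auto simp: safe_def)
  then show ?thesis
  proof cases
    case 1
    then show ?thesis using s u v ext_same(4)[OF e v] ext_kind[OF e] by (simp add: safe_def)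
  next
    case 2
    have t: "t \<in> nodes D" using ecs_children(2)[OF D u(2) 2(3)] .
    show ?thesis
      using s 2 u v t ext_same(4)[OF e v] ext_same(5)[OF e u(2)] ext_kind[OF e] ext_odepth[OF e]
      unfolding safe_def by metis
  qed
qed

lemma ext_node_ok:
  assumes e: "ext \<Omega> D D'" and v: "v \<in> nodes D" and ok: "node_ok D v"
  shows "node_ok D' v"
proof -
  have D: "is_ecs \<Omega> D" using e by (simp add: ext_def)
  have c: "good D' u \<longleftrightarrow> good D u" "sem D' u = sem D u" if "child D v u" for u
    using ext_good[OF e] ext_sem[OF e] child_in[OF D v that] by blast+
  then have c': "lft D v = Some u \<Longrightarrow> sem D' u = sem D u" "rgt D v = Some u \<Longrightarrow> sem D' u = sem D u"
    "rgt D v = Some u \<Longrightarrow> good D' u \<longleftrightarrow> good D u" for u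
    by (auto simp: child_def)
  show ?thesis
    using ok ext_odepth[OF e _ v] unfolding node_ok_def ext_child[OF e v] ext_good[OF e v]
      ext_same(4-6)[OF e v]
    by (metis c c')
qed

lemma well_built_new_node:
  assumes i: "well_built \<Omega> D" and n: "new_node lb l r D = (D', v)" and e: "ext \<Omega> D D'" and ok: "node_ok D' v"
  shows "well_built \<Omega> D'"
  using ext_ecs[OF e] ok ext_node_ok[OF e] i unfolding well_built_def new_node_sel(6)[OF n] by blast

text \<open>Children are smaller than their parents, so induction on the node number applies.
  Children of good nodes are good, hence all leaves below are symbols, and union, concatenation and
  shift preserve both nonemptiness and the absence of the empty word.\<close>

lemma good_words:
  assumes i: "well_built \<Omega> D"
  shows "good D v \<Longrightarrow> sem D v \<noteq> {} \<and> [] \<notin> sem D v"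
proof (induction v rule: less_induct)
  case (less v)
  have D: "is_ecs \<Omega> D" using i by (rule well_built_ecs)
  have v: "v \<in> nodes D" using less.prems by (rule good_in)
  have ok: "node_ok D v" using i v by (simp add: well_built_def)
  have ih: "sem D u \<noteq> {} \<and> [] \<notin> sem D u" if "child D v u" for u
    using less ok that by (auto simp: node_ok_def)
  show ?case
  proof (cases "lab D v")
    case (Sym a)
    then show ?thesis using sem_equations(3)[OF Sym] by simp
  next
    case (Shift k)
    then obtain u where u: "lft D v = Some u" using ecs_lft[OF D v] by auto
    then show ?thesis using sem_equations(6)[OF Shift u] ih[of u] by (auto simp: child_def sh_def)
  next
    case Cup
    then obtain a b where u: "lft D v = Some a" "rgt D v = Some b"
      using ecs_both[OF D v] by (metis insertI1 insertI2)
    then show ?thesis using sem_equations(4)[OF Cup u] ih[of a] ih[of b] by (simp add: child_def)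
  next
    case Odot
    then obtain a b where u: "lft D v = Some a" "rgt D v = Some b"
      using ecs_both[OF D v] by (metis insertI1 insertI2)
    then show ?thesis using sem_equations(5)[OF Odot u] ih[of a] ih[of b]
      by (auto simp: child_def lang_conc_def)
  qed (use less.prems in \<open>auto simp: good_def\<close>)
qed

lemma good_eps_free:
  assumes i: "well_built \<Omega> D" and g: "good D v"
  shows "eps_free D v"
proof -
  have "good D u" if "(v, u) \<in> (edges D)\<^sup>*" for u
    using that g
  proof (induction rule: rtrancl_induct)
    case (step y z)
    then have "node_ok D y" "child D y z"
      using i good_in by (auto simp: well_built_def edges_def child_def)
    then show ?case using step by (simp add: node_ok_def)
  qed
  moreover have "\<not> good D (eps_node D)"
    using ecs_special(4)[OF well_built_ecs[OF i]] by (simp add: good_def)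
  ultimately show ?thesis unfolding eps_free_def by blast
qed

section \<open>Node creations preserve the invariant\<close>

lemma new_shift_inv:
  assumes i: "well_built \<Omega> D" and g: "good D u" and d: "odepth D u n" "n \<le> 3"
    and n: "new_shift k u D = (D', v)"
  shows "well_built \<Omega> D'" "good D' v" "odepth D' v (Suc n)" "shift_node D' v" "lft D' v = Some u"
proof -
  note u = good_in[OF g]
  note e = new_shift_spec(1)[OF well_built_ecs[OF i] u n]
  note s = new_node_sel[OF n]
  show good: "good D' v" using s by (simp add: good_def)
  show sn: "shift_node D' v" using s by (simp add: shift_node_def)
  show "lft D' v = Some u" by (rule s)
  show od: "odepth D' v (Suc n)"
    using odepth.intros(2)[of D' v u n] sn s(3) ext_odepth[OF e d(1) u] by simp
  have "node_ok D' v"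
    unfolding node_ok_def using s od d(2) ext_good[OF e u] g fresh_greater[OF well_built_ecs[OF i] u]
    by (auto simp: child_def intro!: exI[of _ "Suc n"])
  then show "well_built \<Omega> D'" using well_built_new_node[OF i n e] by blast
qed

lemma new_cup_inv:
  assumes i: "well_built \<Omega> D" and g: "good D a" "good D b" and d: "odepth D a n" "n \<le> 3"
    and disj: "sem D a \<inter> sem D b = {}" and n: "new_cup a b D = (D', v)"
  shows "well_built \<Omega> D'" "good D' v" "odepth D' v (Suc n)" "union_node D' v"
proof -
  note a = good_in[OF g(1)] and b = good_in[OF g(2)]
  note e = new_cup_spec(1)[OF well_built_ecs[OF i] a b n]
  note s = new_node_sel[OF n]
  have "a \<noteq> eps_node D" using g(1) ecs_special(4)[OF well_built_ecs[OF i]] by (auto simp: good_def)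
  then show good: "good D' v" using s ext_same(2)[OF e] by (simp add: good_def)
  show un: "union_node D' v" using s by (simp add: union_node_def)
  show od: "odepth D' v (Suc n)"
    using odepth.intros(2)[of D' v a n] un s(3) ext_odepth[OF e d(1) a] by simp
  have "node_ok D' v"
    unfolding node_ok_def
    using s od d(2) ext_good[OF e a] ext_good[OF e b] g fresh_greater[OF well_built_ecs[OF i] a]
      fresh_greater[OF well_built_ecs[OF i] b] disj ext_sem[OF e a] ext_sem[OF e b]
    by (auto simp: child_def intro!: exI[of _ "Suc n"])
  then show "well_built \<Omega> D'" using well_built_new_node[OF i n e] by blast
qed

lemma new_odot_inv:
  assumes i: "well_built \<Omega> D" and g: "good D a" "good D b"
    and uniq: "unique_decomp (sem D a) (sem D b)" and n: "new_odot a b D = (D', v)"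
  shows "well_built \<Omega> D'" "good D' v" "odepth D' v 0" "output_node D' v"
proof -
  note a = good_in[OF g(1)] and b = good_in[OF g(2)]
  note e = new_odot_spec(1)[OF well_built_ecs[OF i] a b n]
  note s = new_node_sel[OF n]
  show good: "good D' v" using s by (simp add: good_def)
  show out: "output_node D' v" using s by (simp add: output_node_def)
  then show od: "odepth D' v 0" by (rule odepth.intros)
  have "node_ok D' v"
    unfolding node_ok_def
    using s od ext_good[OF e a] ext_good[OF e b] g fresh_greater[OF well_built_ecs[OF i] a]
      fresh_greater[OF well_built_ecs[OF i] b] uniq ext_sem[OF e a] ext_sem[OF e b]
    by (auto simp: child_def intro!: exI[of _ 0])
  then show "well_built \<Omega> D'" using well_built_new_node[OF i n e] by blast
qed

lemma new_sym_inv: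
  assumes i: "well_built \<Omega> D" and a: "a \<in> \<Omega>" and n: "new_sym a D = (D', v)"
  shows "well_built \<Omega> D'" "good D' v" "odepth D' v 0" "output_node D' v"
proof -
  note e = new_sym_spec(1)[OF well_built_ecs[OF i] a n]
  note s = new_node_sel[OF n]
  show good: "good D' v" using s by (simp add: good_def)
  show out: "output_node D' v" using s by (simp add: output_node_def)
  then show od: "odepth D' v 0" by (rule odepth.intros)
  have "node_ok D' v"
    unfolding node_ok_def using s od by (auto simp: child_def intro!: exI[of _ 0])
  then show "well_built \<Omega> D'" using well_built_new_node[OF i n e] by blast
qed

text \<open>Here the \<epsilon>-node gets a parent. The new node is not good, so
  \<open>node_ok\<close> demands no output-depth, which would be undefined; the two children are
  disjoint because the good one does not produce the empty word.\<close>

lemma new_eps_cup_inv: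
  assumes i: "well_built \<Omega> D" and g: "good D u" and n: "new_cup (eps_node D) u D = (D', v)"
  shows "well_built \<Omega> D'"
proof -
  note D = well_built_ecs[OF i]
  note u = good_in[OF g]
  note e = new_cup_spec(1)[OF D ecs_special(2)[OF D] u n]
  note s = new_node_sel[OF n]
  have "\<not> good D' v" using s ext_same(2)[OF e] by (simp add: good_def)
  moreover have "sem D' (eps_node D) \<inter> sem D' u = {}"
    using good_words[OF i g] ext_sem[OF e u] ext_sem[OF e ecs_special(2)[OF D]]
      sem_special(2)[OF D] by simp
  ultimately have "node_ok D' v"
    unfolding node_ok_def
    using s ext_good[OF e u] g fresh_greater[OF D u] fresh_greater[OF D ecs_special(2)[OF D]]
    by (auto simp: child_def)
  then show "well_built \<Omega> D'" using well_built_new_node[OF i n e] by blast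
qed

definition good_safe :: "('a, nat) ecs \<Rightarrow> nat \<Rightarrow> bool" where
  "good_safe D v \<longleftrightarrow> good D v \<and> safe D v"

lemma ext_good_safe: "ext \<Omega> D D' \<Longrightarrow> good_safe D v \<Longrightarrow> good_safe D' v"
  unfolding good_safe_def using ext_good[of \<Omega> D D' v] ext_safe[of \<Omega> D D' v] good_in[of D v] by blast

text \<open>This eliminates the reachability condition: a safe node is a shift node, hence good, and
  therefore has no \<epsilon>-node below it.\<close>

lemma eps_safe_iff:
  assumes i: "well_built \<Omega> D"
  shows "eps_safe D v \<longleftrightarrow> v = eps_node D \<or> good_safe D v \<or>
    v \<in> nodes D \<and> lab D v = Cup \<and> lft D v = Some (eps_node D) \<and> (\<exists>u. rgt D v = Some u \<and> good_safe D u)"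
proof -
  have 1: "good_safe D u \<longleftrightarrow> u \<in> nodes D \<and> safe D u \<and> eps_free D u" if "u \<in> nodes D" for u
  proof -
    have "safe D u \<Longrightarrow> good D u" using that by (auto simp: safe_def shift_node_def good_def)
    then show ?thesis using good_eps_free[OF i, of u] that by (auto simp: good_safe_def)
  qed
  have 2: "rgt D v = Some u \<Longrightarrow> v \<in> nodes D \<Longrightarrow> u \<in> nodes D" for u
    using ecs_children(2)[OF well_built_ecs[OF i]] by blast
  have 3: "good_safe D u \<Longrightarrow> u \<in> nodes D" for u by (simp add: good_safe_def good_def)
  show ?thesis
    unfolding eps_safe_def union_node_def using 1 2 3 ecs_special(2)[OF well_built_ecs[OF i]] by blast
qed

text \<open>Output-depth exactly 1 forces the left child of the union to have depth 0, that is, to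
  be an output node. This is the node around which the next union is rebuilt.\<close>

lemma good_safe_cases:
  assumes i: "well_built \<Omega> D" and s: "good_safe D v"
  obtains (out) k u where "lab D v = Shift k" "lft D v = Some u" "good D u" "output_node D u"
  | (union) k u x y n where "lab D v = Shift k" "lft D v = Some u" "good D u" "lab D u = Cup"
      "lft D u = Some x" "rgt D u = Some y" "good D x" "good D y" "output_node D x" "odepth D y n"
      "n \<le> 2" "sem D x \<inter> sem D y = {}"
proof -
  note D = well_built_ecs[OF i]
  have ok: "node_ok D u" if "good D u" for u using that i good_in by (auto simp: well_built_def)
  have v: "good D v" "safe D v" using s by (auto simp: good_safe_def)
  obtain k u where k: "lab D v = Shift k" and u: "lft D v = Some u"
    using v by (auto simp: safe_def shift_node_def)
  have gu: "good D u" using ok[OF v(1)] v u by (simp add: node_ok_def child_def)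
  show thesis
  proof (cases "output_node D u")
    case True
    then show thesis using out k u gu by blast
  next
    case False
    then obtain y n where y: "lab D u = Cup" "odepth D u 1" "rgt D u = Some y" "odepth D y n" "n \<le> 2"
      using v(2) u unfolding safe_def union_node_def by auto
    then obtain x where x: "lft D u = Some x" using ecs_lft[OF D good_in[OF gu]] by auto
    have "odepth D x 0" using y(2) x by (cases rule: odepth.cases) auto
    then have "output_node D x" by (cases rule: odepth.cases) auto
    then show thesis
      using union[OF k u gu y(1) x y(3) _ _ _ y(4,5)] ok[OF gu] gu x y
      by (auto simp: node_ok_def child_def)
  qed
qed

lemma good_safe_output:
  assumes i: "well_built \<Omega> D" and g: "good D u" and o: "output_node D u" and n: "new_shift k u D = (D', v)"
  shows "well_built \<Omega> D'" "good_safe D' v"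
proof -
  note s = new_shift_inv[OF i g odepth.intros(1)[OF o] _ n]
  note e = new_shift_spec(1)[OF well_built_ecs[OF i] good_in[OF g] n]
  show "well_built \<Omega> D'" "good_safe D' v"
    using s o ext_kind(1)[OF e good_in[OF g]] by (simp_all add: good_safe_def safe_def)
qed

lemma attach_inv:
  assumes i: "well_built \<Omega> D" and g: "good D u" "good D u'" and o: "output_node D u"
    and d: "odepth D u' n" "n \<le> 1"
    and disj: "(\<lambda>w. sh w k) ` sem D u \<inter> (\<lambda>w. sh w k') ` sem D u' = {}"
    and a: "attach k u k' u' D = (D', v)"
  shows "well_built \<Omega> D'" "good_safe D' v"
proof -
  note D = well_built_ecs[OF i]
  obtain D1 a where 1: "new_shift (k' - k) u' D = (D1, a)" by fastforce
  obtain D2 b where 2: "new_cup u a D1 = (D2, b)" by fastforce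
  have 3: "new_shift k b D2 = (D', v)" using a 1 2 by (simp add: attach_def)
  note u = good_in[OF g(1)]
  note s1 = new_shift_spec[OF D good_in[OF g(2)] 1]
  note i1 = new_shift_inv[OF i g(2) d(1) _ 1]
  have "n \<le> 3" using d by simp
  note i1 = i1[OF this]
  have g1: "good D1 u" "output_node D1 u" using ext_good[OF s1(1) u] ext_kind(1)[OF s1(1) u] g o by auto
  \<comment> \<open>Seen from above the shift by \<open>k\<close>, the node \<open>a\<close> denotes
    the words of \<open>u'\<close> shifted by \<open>k'\<close>. The assumption lives at that level,
    so disjointness is shown there and the outer shift is cancelled afterwards.\<close>
  have "(\<lambda>w. sh w k) ` sem D1 u \<inter> (\<lambda>w. sh w k) ` sem D1 a = {}"
    using disj s1(3) ext_sem[OF s1(1) u] by (simp add: sh_image_sh_image)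
  then have disj1: "sem D1 u \<inter> sem D1 a = {}" by (simp only: sh_image_disjoint_iff)
  note i2 = new_cup_inv[OF i1(1) g1(1) i1(2) odepth.intros(1)[OF g1(2)] _ disj1 2]
  note e2 = new_cup_spec(1)[OF ext_ecs[OF s1(1)] good_in[OF g1(1)] s1(2) 2]
  note i3 = new_shift_inv[OF i2(1,2,3) _ 3]
  note e3 = new_shift_spec(1)[OF ext_ecs[OF e2] good_in[OF i2(2)] 3]
  show "well_built \<Omega> D'" using i3 by simp
  note e = ext_trans[OF e2 e3] and b = good_in[OF i2(2)]
  have "union_node D' b" "odepth D' b 1" "rgt D' b = Some a"
    using i2 ext_kind(3)[OF e3 b] ext_odepth[OF e3 _ b] ext_same(5)[OF e3 b] new_node_sel(4)[OF 2]
    by simp_all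
  moreover have "shift_node D' a" "odepth D' a (Suc n)"
    using i1 ext_kind(2)[OF e s1(2)] ext_odepth[OF e _ s1(2)] by simp_all
  moreover have "Suc n \<le> 2" using d by simp
  ultimately show "good_safe D' v"
    using i3 unfolding good_safe_def safe_def by auto
qed

text \<open>The shifted \<open>y\<close> and its union with \<open>y'\<close> may use up the whole
  depth bound; the union headed by \<open>x'\<close> is back at depth 1, as
  \<open>attach_inv\<close> demands of its second node.\<close>

lemma interleave_inv:
  assumes i: "well_built \<Omega> D" and u: "good D u" "lab D u = Cup" "lft D u = Some x" "rgt D u = Some y"
      "output_node D x" "odepth D y n" "n \<le> 2"
    and u': "good D u'" "lab D u' = Cup" "lft D u' = Some x'" "rgt D u' = Some y'" "output_node D x'"
    and disj: "(\<lambda>w. sh w k) ` sem D u \<inter> (\<lambda>w. sh w k') ` sem D u' = {}"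
    and a: "interleave k u k' u' D = (D', v)"
  shows "well_built \<Omega> D'" "good_safe D' v"
proof -
  note D = well_built_ecs[OF i]
  have ok: "node_ok D u" "node_ok D u'" using u(1) u'(1) i good_in by (auto simp: well_built_def)
  then have gx: "good D x" "good D y" "good D x'" "good D y'"
    and dxy: "sem D x \<inter> sem D y = {}" "sem D x' \<inter> sem D y' = {}"
    using u u' by (auto simp: node_ok_def child_def)
  note in' = gx[THEN good_in]
  let ?S = "\<lambda>k. image (\<lambda>w. sh w k)"
  have semu: "sem D u = sem D x \<union> sem D y" "sem D u' = sem D x' \<union> sem D y'"
    using sem_equations(4)[OF u(2-4)] sem_equations(4)[OF u'(2-4)] by blast+
  \<comment> \<open>Four cross pairs come from the disjoint arguments and two from the union nodes
    themselves, all expressed with the final offsets.\<close>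
  have disj': "?S k (sem D x) \<inter> ?S k' (sem D x') = {}" "?S k (sem D x) \<inter> ?S k' (sem D y') = {}"
    "?S k (sem D y) \<inter> ?S k' (sem D x') = {}" "?S k (sem D y) \<inter> ?S k' (sem D y') = {}"
    "?S k (sem D x) \<inter> ?S k (sem D y) = {}" "?S k' (sem D x') \<inter> ?S k' (sem D y') = {}"
    using disj dxy unfolding semu sh_image_disjoint_iff by blast+
  have shift: "?S k' (?S (k - k') X) = ?S k X" for X :: "'a word set"
    by (simp add: sh_image_sh_image)
  obtain D1 a where 1: "new_shift (k - k') y D = (D1, a)" by fastforce
  obtain D2 b where 2: "new_cup a y' D1 = (D2, b)" by fastforce
  obtain D3 c where 3: "new_cup x' b D2 = (D3, c)" by fastforce
  have 4: "attach k x k' c D3 = (D', v)" using a 1 2 3 u u' by (simp add: interleave_def)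
  have n3: "n \<le> 3" "Suc n \<le> 3" using u by auto
  note s1 = new_shift_spec[OF D in'(2) 1]
  note i1 = new_shift_inv[OF i gx(2) u(6) n3(1) 1]
  have gy': "good D1 y'" using ext_good[OF s1(1) in'(4)] gx by simp
  have "?S k' (sem D1 a) \<inter> ?S k' (sem D1 y') = {}"
    using disj' s1(3) ext_sem[OF s1(1) in'(4)] by (simp add: shift)
  then have d1: "sem D1 a \<inter> sem D1 y' = {}" by (simp only: sh_image_disjoint_iff)
  note s2 = new_cup_spec[OF ext_ecs[OF s1(1)] s1(2) good_in[OF gy'] 2]
  note i2 = new_cup_inv[OF i1(1,2) gy' i1(3) n3(2) d1 2]
  have e2: "ext \<Omega> D D2" using s1(1) s2(1) by (rule ext_trans)
  have gx': "good D2 x'" "output_node D2 x'"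
    using ext_good[OF e2 in'(3)] ext_kind(1)[OF e2 in'(3)] gx u' by simp_all
  have sem_b: "?S k' (sem D2 b) = ?S k (sem D y) \<union> ?S k' (sem D y')"
    using s2(3) s1(3) ext_sem[OF s1(1) in'(4)] by (simp add: image_Un shift)
  have "?S k' (sem D2 x') \<inter> ?S k' (sem D2 b) = {}"
    using disj' sem_b ext_sem[OF e2 in'(3)] by auto
  then have d2: "sem D2 x' \<inter> sem D2 b = {}" by (simp only: sh_image_disjoint_iff)
  note s3 = new_cup_spec[OF ext_ecs[OF e2] good_in[OF gx'(1)] s2(2) 3]
  note i3 = new_cup_inv[OF i2(1) gx'(1) i2(2) odepth.intros(1)[OF gx'(2)] _ d2 3]
  have e3: "ext \<Omega> D D3" using e2 s3(1) by (rule ext_trans)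
  have gx3: "good D3 x" "output_node D3 x"
    using ext_good[OF e3 in'(1)] ext_kind(1)[OF e3 in'(1)] gx u by simp_all
  have "?S k (sem D3 x) \<inter> ?S k' (sem D3 c) = {}"
    using disj' s3(3) sem_b ext_sem[OF e2 in'(3)] ext_sem[OF e3 in'(1)] by (auto simp: image_Un)
  from attach_inv[OF i3(1) gx3(1) i3(2) gx3(2) i3(3) _ this 4]
  show "well_built \<Omega> D'" "good_safe D' v" by simp_all
qed

lemma prod_core_inv:
  assumes i: "well_built \<Omega> D" and g: "good D p" "good D q" and ud: "unique_decomp (sem D p) (sem D q)"
    and a: "prod_core p q D = (D', v)"
  shows "well_built \<Omega> D'" "good_safe D' v"
proof -
  obtain D1 a where 1: "new_odot p q D = (D1, a)" by fastforce
  have 2: "new_shift 0 a D1 = (D', v)" using a 1 by (simp add: prod_core_def)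
  note i1 = new_odot_inv[OF i g ud 1]
  show "well_built \<Omega> D'" "good_safe D' v" using good_safe_output[OF i1(1,2,4) 2] by blast+
qed

lemma shift_core_inv:
  assumes i: "well_built \<Omega> D" and g: "good_safe D p" and a: "shift_core p k D = (D', v)"
  shows "well_built \<Omega> D'" "good_safe D' v"
proof -
  have "well_built \<Omega> D' \<and> good_safe D' v"
    using i g
  proof (cases rule: good_safe_cases)
    case (out j u)
    have "new_shift (j + k) u D = (D', v)" using a out by (simp add: shift_core_def)
    from good_safe_output[OF i out(3,4) this] show ?thesis by blast
  next
    case (union j u x y n)
    have 1: "new_shift (j + k) u D = (D', v)" using a union by (simp add: shift_core_def)
    have "union_node D u" using union by (simp add: union_node_def)
    then have d: "odepth D u 1"
      using odepth.intros(2)[of D u x 0] union odepth.intros(1)[OF union(9)] by simp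
    note i1 = new_shift_inv[OF i union(3) d _ 1]
    note e = new_shift_spec(1)[OF well_built_ecs[OF i] good_in[OF union(3)] 1]
    \<comment> \<open>The new shift node has the same left child as \<open>p\<close>, and apart from
      being a shift node, safety depends only on that child.\<close>
    have "safe D p" using g by (simp add: good_safe_def)
    then have "safe D' p" using ext_safe[OF e good_in] g by (simp add: good_safe_def)
    then have "safe D' v"
      using i1 union ext_same(4)[OF e good_in[of D p]] g unfolding safe_def good_safe_def by simp
    then show ?thesis using i1 by (simp add: good_safe_def)
  qed
  then show "well_built \<Omega> D'" "good_safe D' v" by blast+
qed

lemma union_core_inv:
  assumes i: "well_built \<Omega> D" and g: "good_safe D p" "good_safe D q" and disj: "sem D p \<inter> sem D q = {}"
    and a: "union_core p q D = (D', v)"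
  shows "well_built \<Omega> D'" "good_safe D' v"
proof -
  \<comment> \<open>The child of a safe node has depth at most 1, the premise that
    \<open>attach_inv\<close> puts on its second node.\<close>
  have depth: "\<exists>n \<le> 1. odepth D u n"
    if "output_node D u \<or> lab D u = Cup \<and> lft D u = Some x \<and> output_node D x" for u x
    using that
  proof
    assume "output_node D u"
    then show ?thesis by (auto intro: odepth.intros exI[of _ 0])
  next
    assume u: "lab D u = Cup \<and> lft D u = Some x \<and> output_node D x"
    then have "odepth D u (0 + 1)"
      using odepth.intros(2)[of D u x 0] odepth.intros(1)[of D x] by (simp add: union_node_def)
    then show ?thesis by force
  qed
  obtain k u x y n where u: "lab D p = Shift k" "lft D p = Some u" "good D u"
    "output_node D u \<or> lab D u = Cup \<and> lft D u = Some x \<and> output_node D x \<and> rgt D u = Some y \<and>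
      odepth D y n \<and> n \<le> 2"
    using i g(1) by (cases rule: good_safe_cases) blast+
  obtain k' u' x' y' n' where u': "lab D q = Shift k'" "lft D q = Some u'" "good D u'"
    "output_node D u' \<or> lab D u' = Cup \<and> lft D u' = Some x' \<and> output_node D x' \<and> rgt D u' = Some y' \<and>
      odepth D y' n' \<and> n' \<le> 2"
    using i g(2) by (cases rule: good_safe_cases) blast+
  have disj1: "(\<lambda>w. sh w k) ` sem D u \<inter> (\<lambda>w. sh w k') ` sem D u' = {}"
    using disj sem_equations(6) u u' by metis
  then have disj2: "(\<lambda>w. sh w k') ` sem D u' \<inter> (\<lambda>w. sh w k) ` sem D u = {}" by blast
  have "well_built \<Omega> D' \<and> good_safe D' v"
  proof (cases "output_node D u")
    case True
    then have 1: "attach k u k' u' D = (D', v)" using a u u' by (simp add: union_core_def)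
    obtain m where "odepth D u' m" "m \<le> 1" using depth u'(4) by blast
    from attach_inv[OF i u(3) u'(3) True this disj1 1] show ?thesis by blast
  next
    case False
    show ?thesis
    proof (cases "output_node D u'")
      case True
      then have 1: "attach k' u' k u D = (D', v)" using a u u' False by (simp add: union_core_def)
      obtain m where "odepth D u m" "m \<le> 1" using depth u(4) by blast
      from attach_inv[OF i u'(3) u(3) True this disj2 1] show ?thesis by blast
    next
      case no: False
      then have "interleave k u k' u' D = (D', v)"
        using a u u' False by (simp add: union_core_def union_node_def)
      then show ?thesis
        using interleave_inv[OF i u(3) _ _ _ _ _ _ u'(3) _ _ _ _ disj1] u(4) u'(4) False no by blast
    qed
  qed
  then show "well_built \<Omega> D'" "good_safe D' v" by blast+
qed

section \<open>Safety with an optional empty word on top\<close>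

lemma join_eps_inv:
  assumes i: "well_built \<Omega> D" and g: "good_safe D u" and n: "join_eps f (D, u) = (D', v)"
  shows "well_built \<Omega> D'" "eps_safe D' v"
proof -
  have "well_built \<Omega> D' \<and> eps_safe D' v"
  proof (cases f)
    case True
    then have 1: "new_cup (eps_node D) u D = (D', v)" using n by (simp add: join_eps_def)
    have gu: "good D u" using g by (simp add: good_safe_def)
    note i' = new_eps_cup_inv[OF i gu 1]
    note D = well_built_ecs[OF i]
    note e = new_cup_spec(1)[OF D ecs_special(2)[OF D] good_in[OF gu] 1]
    show ?thesis
      using i' ext_good_safe[OF e g] new_node_sel[OF 1] ext_same(2)[OF e]
      by (simp add: eps_safe_iff[OF i'])
  next
    case False
    then show ?thesis using n i g eps_safe_iff[OF i] by (auto simp: join_eps_def)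
  qed
  then show "well_built \<Omega> D'" "eps_safe D' v" by blast+
qed

lemma split_eps_inv:
  assumes i: "well_built \<Omega> D" and v: "eps_safe D v" "v \<noteq> eps_node D" and s: "split_eps D v = (f, p)"
  shows "good_safe D p"
proof -
  consider "good_safe D v" | u where "lab D v = Cup" "lft D v = Some (eps_node D)" "rgt D v = Some u"
      "good_safe D u"
    using v unfolding eps_safe_iff[OF i] by blast
  then show ?thesis
  proof cases
    case 1
    then have "\<not> (lab D v = Cup \<and> lft D v = Some (eps_node D))" by (simp add: good_safe_def good_def)
    then show ?thesis using 1 s by (auto simp: split_eps_def)
  next
    case 2
    then show ?thesis using s by (simp add: split_eps_def)
  qed
qed

lemma eps_safe_not_bot: "well_built \<Omega> D \<Longrightarrow> eps_safe D v \<Longrightarrow> v \<noteq> bot_node D"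
  using ecs_special(3,4)[OF well_built_ecs, of \<Omega> D]
  by (auto simp: eps_safe_iff good_safe_def good_def)

lemma unique_decompD:
  "unique_decomp A B \<Longrightarrow> x \<in> A \<Longrightarrow> y \<in> B \<Longrightarrow> x' \<in> A \<Longrightarrow> y' \<in> B \<Longrightarrow> x @ y = x' @ y' \<Longrightarrow> x = x' \<and> y = y'"
  unfolding unique_decomp_def by blast

lemma unique_decomp_mono: "unique_decomp A B \<Longrightarrow> A' \<subseteq> A \<Longrightarrow> B' \<subseteq> B \<Longrightarrow> unique_decomp A' B'"
  unfolding unique_decomp_def by (meson subsetD)

text \<open>Unique decomposition of the full product has to provide everything: unique decomposition
  of the parts without \<epsilon>, and disjointness in each of the two unions that distributivity
  introduces.\<close>

lemma prod_op_inv: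
  assumes i: "well_built \<Omega> D" and s: "eps_safe D v1" "eps_safe D v2"
    and ud: "unique_decomp (sem D v1) (sem D v2)" and a: "prod_op v1 v2 D = (D', v)"
  shows "well_built \<Omega> D' \<and> eps_safe D' v"
proof (cases "v1 = eps_node D \<or> v2 = eps_node D")
  case True
  then show ?thesis using a i s eps_safe_not_bot[OF i] by (auto simp: prod_op_def split: if_splits)
next
  case False
  note D = well_built_ecs[OF i]
  have v: "v1 \<in> nodes D" "v2 \<in> nodes D" using s by (auto simp: eps_safe_def)
  obtain f1 p1 f2 p2 where sp: "split_eps D v1 = (f1, p1)" "split_eps D v2 = (f2, p2)" by fastforce
  obtain D1 q1 where 1: "prod_core p1 p2 D = (D1, q1)" by fastforce
  obtain D2 q2 where 2: "(if f2 then union_core p1 q1 D1 else (D1, q1)) = (D2, q2)" by fastforce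
  obtain D3 q3 where 3: "(if f1 then union_core p2 q2 D2 else (D2, q2)) = (D3, q3)" by fastforce
  have 4: "join_eps (f1 \<and> f2) (D3, q3) = (D', v)"
    using a False eps_safe_not_bot[OF i] s sp 1 2 3 by (auto simp: prod_op_def)
  have g: "good_safe D p1" "good_safe D p2"
    using split_eps_inv[OF i s(1) _ sp(1)] split_eps_inv[OF i s(2) _ sp(2)] False by auto
  then have g': "good D p1" "good D p2" by (auto simp: good_safe_def)
  note in' = g'[THEN good_in]
  note t1 = split_eps_spec[OF D v(1) sp(1)] and t2 = split_eps_spec[OF D v(2) sp(2)]
  have ne: "[] \<notin> sem D p1" "[] \<notin> sem D p2" using good_words[OF i] g' by blast+
  have u: "unique_decomp (sem D p1) (sem D p2)"
    using unique_decomp_mono[OF ud] t1(2) t2(2) by simp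
  note s1 = prod_core_spec[OF D t1(1) t2(1) 1]
  note i1 = prod_core_inv[OF i g' u 1]
  \<comment> \<open>A word lying in both A and AB would decompose once with an empty and once with a
    nonempty right factor.\<close>
  have d2: "sem D1 p1 \<inter> sem D1 q1 = {}" if f2
  proof -
    have "x @ [] \<noteq> y @ z" if "x \<in> sem D p1" "y \<in> sem D p1" "z \<in> sem D p2" for x y z
      using unique_decompD[OF ud, of x "[]" y z] \<open>f2\<close> that ne t1(2) t2(2) by auto
    then show ?thesis unfolding s1(3) ext_sem[OF s1(1) in'(1)] lang_conc_def by fastforce
  qed
  have s2: "ext \<Omega> D1 D2 \<and> q2 \<in> nodes D2 \<and>
      sem D2 q2 = (if f2 then sem D1 p1 else {}) \<union> sem D1 q1"
    using 2 union_core_spec[OF ext_ecs[OF s1(1)] ext_same(3)[OF s1(1) t1(1)] s1(2)] s1(2)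
      ext_refl[OF ext_ecs[OF s1(1)]] by (auto split: if_splits)
  have i2: "well_built \<Omega> D2 \<and> good_safe D2 q2"
    using 2 i1 union_core_inv[OF i1(1) ext_good_safe[OF s1(1) g(1)] i1(2) d2]
    by (cases f2) auto
  have e2: "ext \<Omega> D D2" using s1(1) s2 ext_trans by blast
  have sem2: "sem D2 q2 = (if f2 then sem D p1 else {}) \<union> lang_conc (sem D p1) (sem D p2)"
    using s2 s1(3) ext_sem[OF s1(1) in'(1)] by simp
  \<comment> \<open>Likewise with an empty left factor against AB. A word z common to A and B would
    split both as \<epsilon> followed by z and as z followed by \<epsilon>.\<close>
  have d3: "sem D2 p2 \<inter> sem D2 q2 = {}" if f1
  proof -
    have "[] @ z \<noteq> x @ y" if "x \<in> sem D p1" "y \<in> sem D p2" "z \<in> sem D p2" for x y z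
      using unique_decompD[OF ud, of "[]" z x y] \<open>f1\<close> that ne t1(2) t2(2) by auto
    moreover have "z \<notin> sem D p1" if "z \<in> sem D p2" f2 for z
      using unique_decompD[OF ud, of "[]" z z "[]"] \<open>f1\<close> that ne t1(2) t2(2) by auto
    ultimately show ?thesis unfolding sem2 ext_sem[OF e2 in'(2)] lang_conc_def by auto
  qed
  have i3: "well_built \<Omega> D3 \<and> good_safe D3 q3"
    using 3 i2 union_core_inv[OF _ ext_good_safe[OF e2 g(2)] _ d3]
    by (cases f1) auto
  show ?thesis using join_eps_inv[OF _ _ 4] i3 by blast
qed

lemma union_op_inv:
  assumes i: "well_built \<Omega> D" and s: "eps_safe D v3" "eps_safe D v4"
    and disj: "sem D v3 \<inter> sem D v4 = {}" and a: "union_op v3 v4 D = (D', v)"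
  shows "well_built \<Omega> D' \<and> eps_safe D' v"
proof -
  note D = well_built_ecs[OF i]
  have v: "v3 \<in> nodes D" "v4 \<in> nodes D" using s by (auto simp: eps_safe_def)
  obtain f3 p3 f4 p4 where sp: "split_eps D v3 = (f3, p3)" "split_eps D v4 = (f4, p4)" by fastforce
  note t3 = split_eps_spec[OF D v(1) sp(1)] and t4 = split_eps_spec[OF D v(2) sp(2)]
  note eps = sem_special(2)[OF D]
  have nb: "v3 \<noteq> bot_node D" "v4 \<noteq> bot_node D" using eps_safe_not_bot[OF i] s by auto
  \<comment> \<open>If one argument is \<epsilon>, disjointness removes the empty word from the
    other, which is then safe itself and not a union with \<epsilon>.\<close>
  have plain: "good_safe D u" if "eps_safe D u" "[] \<notin> sem D u" for u
    using that eps sem_equations(4)[of D u "eps_node D"] unfolding eps_safe_iff[OF i] by auto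
  consider "v3 = eps_node D" | "v3 \<noteq> eps_node D" "v4 = eps_node D"
    | "v3 \<noteq> eps_node D" "v4 \<noteq> eps_node D" by blast
  then show ?thesis
  proof cases
    case 1
    then have "join_eps True (D, v4) = (D', v)" using a nb by (simp add: union_op_def join_eps_def)
    from join_eps_inv[OF i _ this] show ?thesis using plain[OF s(2)] disj eps 1 by auto
  next
    case 2
    then have "join_eps True (D, v3) = (D', v)" using a nb by (simp add: union_op_def join_eps_def)
    from join_eps_inv[OF i _ this] show ?thesis using plain[OF s(1)] disj eps 2 by auto
  next
    case 3
    obtain D1 q where 1: "union_core p3 p4 D = (D1, q)" by fastforce
    have 2: "join_eps (f3 \<or> f4) (D1, q) = (D', v)" using a nb 3 sp 1 by (simp add: union_op_def)
    have g: "good_safe D p3" "good_safe D p4"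
      using split_eps_inv[OF i s(1) _ sp(1)] split_eps_inv[OF i s(2) _ sp(2)] 3 by auto
    have "sem D p3 \<inter> sem D p4 = {}" using disj t3(2) t4(2) by auto
    from union_core_inv[OF i g this 1] join_eps_inv[OF _ _ 2] show ?thesis by blast
  qed
qed

lemma shift_op_inv:
  assumes i: "well_built \<Omega> D" and s: "eps_safe D v0" and a: "shift_op v0 k D = (D', v)"
  shows "well_built \<Omega> D' \<and> eps_safe D' v"
proof (cases "v0 = eps_node D")
  case True
  then show ?thesis using a i s by (auto simp: shift_op_def)
next
  case False
  obtain f p where sp: "split_eps D v0 = (f, p)" by fastforce
  obtain D1 q where 1: "shift_core p k D = (D1, q)" by fastforce
  have 2: "join_eps f (D1, q) = (D', v)"
    using a False eps_safe_not_bot[OF i s] sp 1 by (simp add: shift_op_def)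
  from shift_core_inv[OF i split_eps_inv[OF i s False sp] 1] join_eps_inv[OF _ _ 2]
  show ?thesis by blast
qed

lemma add_op_inv:
  assumes i: "well_built \<Omega> D" and a: "a \<in> \<Omega>" "apply_op D (CAdd a) = (D', v)"
  shows "well_built \<Omega> D' \<and> eps_safe D' v"
proof -
  obtain D1 u where 1: "new_sym a D = (D1, u)" by fastforce
  have 2: "new_shift 0 u D1 = (D', v)" using a(2) 1 by simp
  note i1 = new_sym_inv[OF i a(1) 1]
  note i2 = good_safe_output[OF i1(1,2,4) 2]
  show ?thesis using i2 eps_safe_iff[OF i2(1)] by blast
qed

lemma apply_op_inv:
  assumes "well_built \<Omega> D" "call_assm \<Omega> D c" "\<forall>v \<in> call_nodes c. eps_safe D v" "apply_op D c = (D', v)"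
  shows "well_built \<Omega> D' \<and> eps_safe D' v"
proof (cases c)
  case (CAdd a)
  then show ?thesis using add_op_inv[of \<Omega> D a] assms by simp
next
  case (CProd v1 v2)
  then show ?thesis using prod_op_inv[of \<Omega> D v1 v2] assms by simp
next
  case (CUnion v3 v4)
  then show ?thesis using union_op_inv[of \<Omega> D v3 v4] assms by simp
next
  case (CShift v k)
  then show ?thesis using shift_op_inv[of \<Omega> D v k] assms by simp
qed

section \<open>Safely built structures satisfy the invariant\<close>

lemma well_built_empty:
  assumes "empty_ecs \<Omega> D"
  shows "well_built \<Omega> D"
proof -
  have D: "is_ecs \<Omega> D" and n: "nodes D = {bot_node D, eps_node D}"
    using assms by (simp_all add: empty_ecs_def)
  have "node_ok D v" if "v \<in> nodes D" for v
  proof -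
    have l: "lab D v = LBot \<or> lab D v = LEps" using that n ecs_special(3,4)[OF D] by auto
    then have "lft D v = None" "rgt D v = None" using is_ecs_node(4,5)[OF D that] by auto
    then show ?thesis using l by (auto simp: node_ok_def child_def good_def)
  qed
  then show ?thesis using D by (simp add: well_built_def)
qed

lemma eps_safely_built_well_built: "eps_safely_built \<Omega> apply_op D \<Longrightarrow> well_built \<Omega> D"
proof (induction rule: eps_safely_built.induct)
  case (start D)
  then show ?case by (rule well_built_empty)
next
  case (step D c)
  then show ?case using apply_op_inv[of \<Omega> D c] by (cases "apply_op D c") simp
qed

section \<open>Programs for the operations\<close>

definition seqs :: "com list \<Rightarrow> com" where
  "seqs cs = foldr Seq cs Skip"

text \<open>The machine has no multiplication, so the factor 4 of the memory layout is spelled out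
  by additions.\<close>

definition addr :: "aexp \<Rightarrow> nat \<Rightarrow> aexp" where
  "addr a i = Plus (Plus (Plus a a) (Plus a a)) (N (int i))"

text \<open>The later arguments are evaluated after cells have been written, but stores do not touch
  registers, so they still have their initial values (\<open>aval_mem\<close>). Fields that the
  label does not have receive a dummy.\<close>

definition new_prog :: "aexp \<Rightarrow> aexp \<Rightarrow> aexp \<Rightarrow> aexp \<Rightarrow> nat \<Rightarrow> com" where
  "new_prog t x l r d =
     seqs [Store (addr (R 0) 0) t, Store (addr (R 0) 1) x, Store (addr (R 0) 2) l,
       Store (addr (R 0) 3) r, Assign d (R 0), Assign 0 (Plus (R 0) (N 1))]"

text \<open>Loading is total: fields that the node does not have yield arbitrary values, and tests
  of the tag keep these from being used.\<close>

definition load_node :: "nat \<Rightarrow> nat \<Rightarrow> com" where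
  "load_node p d =
     seqs [Load d (addr (R p) 0), Load (d + 1) (addr (R p) 1), Load (d + 2) (addr (R p) 2),
       Load (d + 3) (addr (R p) 3)]"

lemma run_seqs [simp]:
  "run (seqs []) s = s" "run (seqs (c # cs)) s = run (seqs cs) (run c s)"
  by (simp_all add: seqs_def)

lemma loop_free_seqs [simp]:
  "loop_free (seqs []) \<longleftrightarrow> True" "loop_free (seqs (c # cs)) \<longleftrightarrow> loop_free c \<and> loop_free (seqs cs)"
  by (simp_all add: seqs_def)

lemma aval_addr [simp]: "aval (addr a i) s = 4 * aval a s + int i"
  by (simp add: addr_def)

lemma aval_mem [simp]: "aval a (s\<lparr>mem := m\<rparr>) = aval a s"
  by (induction a) auto

lemma nat_addr [simp]: "nat (4 * int n + int i) = 4 * n + i"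
  by simp

lemma tag_eq_iff:
  "tag l = 3 \<longleftrightarrow> l = Cup" "tag l = 5 \<longleftrightarrow> l \<in> range Shift" "tag l = 2 \<longleftrightarrow> l \<in> range Sym"
  "tag l = 4 \<longleftrightarrow> l = Odot"
  by (cases l; auto)+

lemma stores_cong:
  assumes "stores code D s" "mem s' = mem s" "\<And>r. r \<le> 2 \<Longrightarrow> regs s' r = regs s r"
  shows "stores code D s'"
  using assms unfolding stores_def by simp

lemma stores_regs:
  assumes "stores code D s"
  shows "regs s 0 = int (fresh D)" "regs s 1 = int (bot_node D)" "regs s 2 = int (eps_node D)"
  using assms by (simp_all add: stores_def fresh_def)

lemma new_prog_spec:
  assumes st: "stores code D s" and D: "is_ecs \<Omega> D" and n: "new_node lb l r D = (D', v)"
    and t: "aval T s = tag lb"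
    and x: "\<And>a. lb = Sym a \<Longrightarrow> aval X s = code a" "\<And>k. lb = Shift k \<Longrightarrow> aval X s = k"
    and L: "\<And>u. l = Some u \<Longrightarrow> aval L s = int u" and Q: "\<And>u. r = Some u \<Longrightarrow> aval Q s = int u"
    and d: "2 < d"
  shows "stores code D' (run (new_prog T X L Q d) s)"
    "regs (run (new_prog T X L Q d) s) = (regs s)(d := int v, 0 := int v + 1)"
proof -
  let ?s = "run (new_prog T X L Q d) s"
  let ?f = "fresh D"
  have r0: "regs s 0 = int ?f" using stores_regs[OF st] by simp
  have v: "v = ?f" using new_node_sel[OF n] by simp
  have m: "mem ?s = (mem s)(4 * ?f := aval T s, 4 * ?f + 1 := aval X s, 4 * ?f + 2 := aval L s,
      4 * ?f + 3 := aval Q s)"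
    using r0 nat_addr[of ?f 0] nat_addr[of ?f 1] nat_addr[of ?f 2] nat_addr[of ?f 3]
    unfolding new_prog_def by simp
  show rg: "regs ?s = (regs s)(d := int v, 0 := int v + 1)"
    using r0 v d by (simp add: new_prog_def)
  have old: "mem ?s (4 * w + i) = mem s (4 * w + i)" if "w \<in> nodes D" "i < 4" for w i
  proof -
    have "4 * w + i < 4 * ?f" using fresh_greater[OF D that(1)] that(2) by linarith
    then show ?thesis unfolding m by simp
  qed
  have old': "mem ?s (4 * w) = mem s (4 * w)" "mem ?s (4 * w + 1) = mem s (4 * w + 1)"
    "mem ?s (4 * w + 2) = mem s (4 * w + 2)" "mem ?s (4 * w + 3) = mem s (4 * w + 3)"
    if "w \<in> nodes D" for w
    using old[OF that, of 0] old[OF that, of 1] old[OF that, of 2] old[OF that, of 3] by simp_all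
  have new: "mem ?s (4 * v) = aval T s" "mem ?s (4 * v + 1) = aval X s"
    "mem ?s (4 * v + 2) = aval L s" "mem ?s (4 * v + 3) = aval Q s"
    unfolding m v by simp_all
  note sel = new_node_sel[OF n]
  have D': "w \<in> nodes D \<Longrightarrow> lab D' w = lab D w \<and> lft D' w = lft D w \<and> rgt D' w = rgt D w" for w
    using n fresh_notin[OF D] by (auto simp: new_node_def)
  have special: "bot_node D' = bot_node D" "eps_node D' = eps_node D"
    using n by (auto simp: new_node_def)
  have "nodes D \<noteq> {}" using ecs_special(1)[OF D] by auto
  then have "Max (nodes D') = max v (Max (nodes D))"
    unfolding sel(6) using ecs_finite[OF D] by simp
  also have "\<dots> = v" using v by (simp add: fresh_def)
  finally have "regs ?s 0 = int (Suc (Max (nodes D')))" using rg by simp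
  moreover have "regs ?s 1 = int (bot_node D')" "regs ?s 2 = int (eps_node D')"
    using rg d stores_regs[OF st] special by simp_all
  moreover have "mem ?s (4 * w) = tag (lab D' w) \<and>
        (\<forall>a. lab D' w = Sym a \<longrightarrow> mem ?s (4 * w + 1) = code a) \<and>
        (\<forall>k. lab D' w = Shift k \<longrightarrow> mem ?s (4 * w + 1) = k) \<and>
        (\<forall>u. lft D' w = Some u \<longrightarrow> mem ?s (4 * w + 2) = int u) \<and>
        (\<forall>u. rgt D' w = Some u \<longrightarrow> mem ?s (4 * w + 3) = int u)" if "w \<in> nodes D'" for w
  proof (cases "w = v")
    case True
    show ?thesis unfolding True new sel(3-5) using t x L Q by simp
  next
    case False
    then have w: "w \<in> nodes D" using that sel by blast
    show ?thesis using st w unfolding old'[OF w] stores_def using D'[OF w] by simp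
  qed
  ultimately show "stores code D' ?s" unfolding stores_def by blast
qed

lemma load_node_frame:
  shows "mem (run (load_node p d) s) = mem s"
    "r < d \<or> d + 3 < r \<Longrightarrow> regs (run (load_node p d) s) r = regs s r"
  unfolding load_node_def by (auto simp del: One_nat_def)

lemma load_node_stores: "stores code D s \<Longrightarrow> 2 < d \<Longrightarrow> stores code D (run (load_node p d) s)"
  by (erule stores_cong) (simp_all add: load_node_frame)

text \<open>The condition \<open>p < d\<close> keeps the register with the node number intact until
  the fourth load.\<close>

lemma load_node_regs:
  assumes st: "stores code D s" and v: "v \<in> nodes D" "regs s p = int v" and p: "p < d"
  shows "regs (run (load_node p d) s) d = tag (lab D v)"
    "lab D v = Sym a \<Longrightarrow> regs (run (load_node p d) s) (d + 1) = code a"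
    "lab D v = Shift k \<Longrightarrow> regs (run (load_node p d) s) (d + 1) = k"
    "lft D v = Some u \<Longrightarrow> regs (run (load_node p d) s) (d + 2) = int u"
    "rgt D v = Some u \<Longrightarrow> regs (run (load_node p d) s) (d + 3) = int u"
proof -
  let ?s = "run (load_node p d) s"
  have "regs ?s d = mem s (4 * v)" "regs ?s (d + 1) = mem s (4 * v + 1)"
    "regs ?s (d + 2) = mem s (4 * v + 2)" "regs ?s (d + 3) = mem s (4 * v + 3)"
    using v p nat_addr[of v 0] nat_addr[of v 1] nat_addr[of v 2] nat_addr[of v 3]
    unfolding load_node_def by auto
  then show "regs ?s d = tag (lab D v)" "lab D v = Sym a \<Longrightarrow> regs ?s (d + 1) = code a"
    "lab D v = Shift k \<Longrightarrow> regs ?s (d + 1) = k" "lft D v = Some u \<Longrightarrow> regs ?s (d + 2) = int u"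
    "rgt D v = Some u \<Longrightarrow> regs ?s (d + 3) = int u"
    using st v(1) unfolding stores_def by auto
qed

text \<open>The core programs take their arguments in registers 10 and 11, return their result in
  register 12 and leave the registers 1 to 11 unchanged.\<close>

definition returns :: "('a \<Rightarrow> int) \<Rightarrow> state \<Rightarrow> ('a, nat) ecs \<times> nat \<Rightarrow> state \<Rightarrow> bool" where
  "returns code s Dv s' \<longleftrightarrow>
     stores code (fst Dv) s' \<and> regs s' 12 = int (snd Dv) \<and> (\<forall>r. 0 < r \<and> r < 12 \<longrightarrow> regs s' r = regs s r)"

text \<open>Registers 40 to 43 hold \<open>k\<close>, \<open>u\<close>, \<open>k'\<close>,
  \<open>u'\<close>; registers 44 and 45 hold the two intermediate nodes.\<close>

definition attach_prog :: com where
  "attach_prog =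
     seqs [new_prog (N 5) (Minus (R 42) (R 40)) (R 43) (N 0) 44, new_prog (N 3) (N 0) (R 41) (R 44) 45,
       new_prog (N 5) (R 40) (R 45) (N 0) 12]"

lemma attach_prog_spec:
  assumes st: "stores code D s" and D: "is_ecs \<Omega> D" and u: "u \<in> nodes D" "u' \<in> nodes D"
    and r: "regs s 40 = k" "regs s 41 = int u" "regs s 42 = k'" "regs s 43 = int u'"
  shows "returns code s (attach k u k' u' D) (run attach_prog s)"
proof -
  obtain D1 a where 1: "new_shift (k' - k) u' D = (D1, a)" by fastforce
  obtain D2 b where 2: "new_cup u a D1 = (D2, b)" by fastforce
  obtain D3 c where 3: "new_shift k b D2 = (D3, c)" by fastforce
  have a: "attach k u k' u' D = (D3, c)" using 1 2 3 by (simp add: attach_def)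
  note e1 = new_shift_spec(1,2)[OF D u(2) 1]
  note e2 = new_cup_spec(1,2)[OF ext_ecs[OF e1(1)] ext_same(3)[OF e1(1) u(1)] e1(2) 2]
  define s1 where "s1 = run (new_prog (N 5) (Minus (R 42) (R 40)) (R 43) (N 0) 44) s"
  define s2 where "s2 = run (new_prog (N 3) (N 0) (R 41) (R 44) 45) s1"
  define s3 where "s3 = run (new_prog (N 5) (R 40) (R 45) (N 0) 12) s2"
  have 4: "stores code D1 s1" "regs s1 = (regs s)(44 := int a, 0 := int a + 1)"
    unfolding s1_def by (rule new_prog_spec[OF st D 1]; use r in simp)+
  have 5: "stores code D2 s2" "regs s2 = (regs s1)(45 := int b, 0 := int b + 1)"
    unfolding s2_def by (rule new_prog_spec[OF 4(1) ext_ecs[OF e1(1)] 2]; use r 4 in simp)+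
  have 6: "stores code D3 s3" "regs s3 = (regs s2)(12 := int c, 0 := int c + 1)"
    unfolding s3_def by (rule new_prog_spec[OF 5(1) ext_ecs[OF e2(1)] 3]; use r 4 5 in simp)+
  have "run attach_prog s = s3" by (simp add: attach_prog_def s1_def s2_def s3_def)
  then show ?thesis unfolding a returns_def using 4 5 6 by simp
qed

definition prod_core_prog :: com where
  "prod_core_prog =
     seqs [new_prog (N 4) (N 0) (R 10) (R 11) 20, new_prog (N 5) (N 0) (R 20) (N 0) 12]"

lemma prod_core_prog_spec:
  assumes st: "stores code D s" and D: "is_ecs \<Omega> D" and u: "p \<in> nodes D" "q \<in> nodes D"
    and r: "regs s 10 = int p" "regs s 11 = int q"
  shows "returns code s (prod_core p q D) (run prod_core_prog s)"
proof -
  obtain D1 a where 1: "new_odot p q D = (D1, a)" by fastforce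
  obtain D2 b where 2: "new_shift 0 a D1 = (D2, b)" by fastforce
  have a: "prod_core p q D = (D2, b)" using 1 2 by (simp add: prod_core_def)
  note e1 = new_odot_spec(1,2)[OF D u 1]
  define s1 where "s1 = run (new_prog (N 4) (N 0) (R 10) (R 11) 20) s"
  define s2 where "s2 = run (new_prog (N 5) (N 0) (R 20) (N 0) 12) s1"
  have 4: "stores code D1 s1" "regs s1 = (regs s)(20 := int a, 0 := int a + 1)"
    unfolding s1_def by (rule new_prog_spec[OF st D 1]; use r in simp)+
  have 5: "stores code D2 s2" "regs s2 = (regs s1)(12 := int b, 0 := int b + 1)"
    unfolding s2_def by (rule new_prog_spec[OF 4(1) ext_ecs[OF e1(1)] 2]; use r 4 in simp)+
  have "run prod_core_prog s = s2" by (simp add: prod_core_prog_def s1_def s2_def)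
  then show ?thesis unfolding a returns_def using 4 5 by simp
qed

definition shift_core_prog :: com where
  "shift_core_prog =
     Seq (load_node 10 20)
       (If (Eq (R 20) (N 5)) (new_prog (N 5) (Plus (R 21) (R 11)) (R 22) (N 0) 12)
         (new_prog (N 5) (R 11) (R 10) (N 0) 12))"

lemma shift_core_prog_spec:
  assumes st: "stores code D s" and D: "is_ecs \<Omega> D" and p: "p \<in> nodes D"
    and r: "regs s 10 = int p" "regs s 11 = k"
  shows "returns code s (shift_core p k D) (run shift_core_prog s)"
proof -
  define s1 where "s1 = run (load_node 10 20) s"
  have st1: "stores code D s1" unfolding s1_def using st by (rule load_node_stores) simp
  have f: "regs s1 r = regs s r" if "r < 20" for r
    using that by (simp add: s1_def load_node_frame)
  have l: "regs s1 20 = tag (lab D p)"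
    "lab D p = Shift j \<Longrightarrow> regs s1 21 = j" "lft D p = Some u \<Longrightarrow> regs s1 22 = int u" for j u
    using load_node_regs[OF st p r(1), of 20] by (simp_all add: s1_def)
  show ?thesis
  proof (cases "lab D p \<in> range Shift")
    case True
    then obtain j where j: "lab D p = Shift j" by blast
    obtain u where u: "lft D p = Some u" using ecs_lft[OF D p] True by blast
    obtain D' v where n: "new_shift (j + k) u D = (D', v)" by fastforce
    let ?s = "run (new_prog (N 5) (Plus (R 21) (R 11)) (R 22) (N 0) 12) s1"
    have "stores code D' ?s" "regs ?s = (regs s1)(12 := int v, 0 := int v + 1)"
      by (rule new_prog_spec[OF st1 D n]; use l j u f r in simp)+
    moreover have "shift_core p k D = (D', v)" using j u n by (simp add: shift_core_def)
    moreover have "run shift_core_prog s = ?s"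
      using l True by (simp add: shift_core_prog_def s1_def[symmetric] tag_eq_iff)
    ultimately show ?thesis using f by (simp add: returns_def)
  next
    case False
    obtain D' v where n: "new_shift k p D = (D', v)" by fastforce
    let ?s = "run (new_prog (N 5) (R 11) (R 10) (N 0) 12) s1"
    have "stores code D' ?s" "regs ?s = (regs s1)(12 := int v, 0 := int v + 1)"
      by (rule new_prog_spec[OF st1 D n]; use l f r in simp)+
    moreover have "shift_core p k D = (D', v)"
      using False n by (auto simp: shift_core_def split: label.splits)
    moreover have "run shift_core_prog s = ?s"
      using l False by (simp add: shift_core_prog_def s1_def[symmetric] tag_eq_iff)
    ultimately show ?thesis using f by (simp add: returns_def)
  qed
qed

text \<open>The registers are those filled by \<open>union_core_prog\<close>: 21 and 25 hold the two
  shift values, 32 and 33 the children of the first union node, 36 and 37 those of the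
  second.\<close>

definition interleave_prog :: com where
  "interleave_prog =
     seqs [new_prog (N 5) (Minus (R 21) (R 25)) (R 33) (N 0) 46,
       new_prog (N 3) (N 0) (R 46) (R 37) 47, new_prog (N 3) (N 0) (R 36) (R 47) 48,
       Assign 40 (R 21), Assign 41 (R 32), Assign 42 (R 25), Assign 43 (R 48), attach_prog]"

lemma interleave_prog_spec:
  assumes st: "stores code D s" and D: "is_ecs \<Omega> D" and u: "u \<in> nodes D" "u' \<in> nodes D"
    and x: "lft D u = Some x" "rgt D u = Some y" "lft D u' = Some x'" "rgt D u' = Some y'"
    and r: "regs s 21 = k" "regs s 25 = k'" "regs s 32 = int x" "regs s 33 = int y"
      "regs s 36 = int x'" "regs s 37 = int y'"
  shows "returns code s (interleave k u k' u' D) (run interleave_prog s)"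
proof -
  note c = ecs_children(1)[OF D u(1) x(1)] ecs_children(2)[OF D u(1) x(2)]
    ecs_children(1)[OF D u(2) x(3)] ecs_children(2)[OF D u(2) x(4)]
  obtain D1 a where 1: "new_shift (k - k') y D = (D1, a)" by fastforce
  obtain D2 b where 2: "new_cup a y' D1 = (D2, b)" by fastforce
  obtain D3 d where 3: "new_cup x' b D2 = (D3, d)" by fastforce
  have a: "interleave k u k' u' D = attach k x k' d D3" using 1 2 3 x by (simp add: interleave_def)
  note e1 = new_shift_spec(1,2)[OF D c(2) 1]
  note e2 = new_cup_spec(1,2)[OF ext_ecs[OF e1(1)] e1(2) ext_same(3)[OF e1(1) c(4)] 2]
  note e12 = ext_trans[OF e1(1) e2(1)]
  note e3 = new_cup_spec(1,2)[OF ext_ecs[OF e12] ext_same(3)[OF e12 c(3)] e2(2) 3]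
  note e13 = ext_trans[OF e12 e3(1)]
  define s1 where "s1 = run (new_prog (N 5) (Minus (R 21) (R 25)) (R 33) (N 0) 46) s"
  define s2 where "s2 = run (new_prog (N 3) (N 0) (R 46) (R 37) 47) s1"
  define s3 where "s3 = run (new_prog (N 3) (N 0) (R 36) (R 47) 48) s2"
  define s4 where
    "s4 = run (seqs [Assign 40 (R 21), Assign 41 (R 32), Assign 42 (R 25), Assign 43 (R 48)]) s3"
  have 4: "stores code D1 s1" "regs s1 = (regs s)(46 := int a, 0 := int a + 1)"
    unfolding s1_def by (rule new_prog_spec[OF st D 1]; use r in simp)+
  have 5: "stores code D2 s2" "regs s2 = (regs s1)(47 := int b, 0 := int b + 1)"
    unfolding s2_def by (rule new_prog_spec[OF 4(1) ext_ecs[OF e1(1)] 2]; use r 4 in simp)+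
  have 6: "stores code D3 s3" "regs s3 = (regs s2)(48 := int d, 0 := int d + 1)"
    unfolding s3_def by (rule new_prog_spec[OF 5(1) ext_ecs[OF e12] 3]; use r 4 5 in simp)+
  have 7: "regs s4 = (regs s3)(40 := k, 41 := int x, 42 := k', 43 := int d)" "mem s4 = mem s3"
    using 4 5 6 r by (simp_all add: s4_def)
  have st4: "stores code D3 s4" by (rule stores_cong[OF 6(1) 7(2)]) (simp add: 7)
  have "returns code s4 (attach k x k' d D3) (run attach_prog s4)"
    by (rule attach_prog_spec[OF st4 ext_ecs[OF e13] ext_same(3)[OF e13 c(1)] e3(2)]) (simp_all add: 7)
  moreover have "run interleave_prog s = run attach_prog s4"
    by (simp add: interleave_prog_def s1_def s2_def s3_def s4_def)
  moreover have "regs s4 r = regs s r" if "0 < r" "r < 12" for r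
    using that 4 5 6 7 by simp
  ultimately show ?thesis unfolding a returns_def by simp
qed

definition attach_args :: "nat \<Rightarrow> nat \<Rightarrow> com" where
  "attach_args i j =
     seqs [Assign 40 (R (i + 1)), Assign 41 (R (i + 2)), Assign 42 (R (j + 1)), Assign 43 (R (j + 2)),
       attach_prog]"

text \<open>Both arguments and their left children are loaded before any tag is tested. If an
  argument has no left child, the corresponding block at 30 or 34 holds garbage, but then
  \<open>cup\<close> is reached without consulting it.\<close>

definition union_core_prog :: com where
  "union_core_prog =
     (let cup = new_prog (N 3) (N 0) (R 10) (R 11) 12; l = attach_args 20 24; r = attach_args 24 20 in
      seqs [load_node 10 20, load_node 11 24, load_node 22 30, load_node 26 34,
        If (Eq (R 20) (N 5))
          (If (Eq (R 24) (N 5))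
            (If (Eq (R 30) (N 2)) l
            (If (Eq (R 30) (N 4)) l
            (If (Eq (R 34) (N 2)) r
            (If (Eq (R 34) (N 4)) r
            (If (Eq (R 30) (N 3)) (If (Eq (R 34) (N 3)) interleave_prog cup) cup))))) cup) cup])"

lemma attach_args_spec:
  assumes st: "stores code D s" and D: "is_ecs \<Omega> D" and u: "u \<in> nodes D" "u' \<in> nodes D"
    and r: "regs s (i + 1) = k" "regs s (i + 2) = int u" "regs s (j + 1) = k'" "regs s (j + 2) = int u'"
    and ij: "i < 30" "j < 30"
  shows "returns code s (attach k u k' u' D) (run (attach_args i j) s)"
proof -
  define s1 where "s1 = run (seqs [Assign 40 (R (i + 1)), Assign 41 (R (i + 2)), Assign 42 (R (j + 1)),
    Assign 43 (R (j + 2))]) s"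
  have 1: "regs s1 = (regs s)(40 := k, 41 := int u, 42 := k', 43 := int u')" "mem s1 = mem s"
    using r ij by (simp_all add: s1_def)
  have st1: "stores code D s1" by (rule stores_cong[OF st 1(2)]) (simp add: 1)
  have "returns code s1 (attach k u k' u' D) (run attach_prog s1)"
    by (rule attach_prog_spec[OF st1 D u]) (simp_all add: 1)
  moreover have "run (attach_args i j) s = run attach_prog s1"
    by (simp add: attach_args_def s1_def)
  moreover have "regs s1 r = regs s r" if "r < 12" for r using that 1 by simp
  ultimately show ?thesis unfolding returns_def by simp
qed

lemma union_core_prog_spec:
  assumes st: "stores code D s" and D: "is_ecs \<Omega> D" and u: "p \<in> nodes D" "q \<in> nodes D"
    and r: "regs s 10 = int p" "regs s 11 = int q"
  shows "returns code s (union_core p q D) (run union_core_prog s)"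
proof -
  define s1 where "s1 = run (load_node 10 20) s"
  define s2 where "s2 = run (load_node 11 24) s1"
  define s3 where "s3 = run (load_node 22 30) s2"
  define s4 where "s4 = run (load_node 26 34) s3"
  let ?cup = "new_prog (N 3) (N 0) (R 10) (R 11) 12"
  have st1: "stores code D s1" unfolding s1_def using st by (rule load_node_stores) simp
  have st2: "stores code D s2" unfolding s2_def using st1 by (rule load_node_stores) simp
  have st3: "stores code D s3" unfolding s3_def using st2 by (rule load_node_stores) simp
  have st4: "stores code D s4" unfolding s4_def using st3 by (rule load_node_stores) simp
  have f1: "regs s1 r = regs s r" if "r < 20" for r using that by (simp add: s1_def load_node_frame)
  have f2: "regs s2 r = regs s1 r" if "r < 24" for r using that by (simp add: s2_def load_node_frame)
  have f3: "regs s3 r = regs s2 r" if "r < 30" for r using that by (simp add: s3_def load_node_frame)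
  have f4: "regs s4 r = regs s3 r" if "r < 34" for r using that by (simp add: s4_def load_node_frame)
  have f: "regs s4 r = regs s r" if "r < 20" for r using that f1 f2 f3 f4 by simp
  have lp: "regs s4 20 = tag (lab D p)" "lab D p = Shift k \<Longrightarrow> regs s4 21 = k"
    "lft D p = Some w \<Longrightarrow> regs s4 22 = int w" "lft D p = Some w \<Longrightarrow> regs s2 22 = int w" for k w
    using load_node_regs[OF st u(1) r(1), of 20] f2 f3 f4 by (simp_all add: s1_def)
  have r1: "regs s1 11 = int q" using f1 r by simp
  have lq: "regs s4 24 = tag (lab D q)" "lab D q = Shift k \<Longrightarrow> regs s4 25 = k"
    "lft D q = Some w \<Longrightarrow> regs s4 26 = int w" "lft D q = Some w \<Longrightarrow> regs s3 26 = int w" for k w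
    using load_node_regs[OF st1 u(2) r1, of 24] f3 f4 by (simp_all add: s2_def)
  have run: "run union_core_prog s =
      run (let cup = ?cup; l = attach_args 20 24; r = attach_args 24 20 in If (Eq (R 20) (N 5))
          (If (Eq (R 24) (N 5))
            (If (Eq (R 30) (N 2)) l
            (If (Eq (R 30) (N 4)) l
            (If (Eq (R 34) (N 2)) r
            (If (Eq (R 34) (N 4)) r
            (If (Eq (R 30) (N 3)) (If (Eq (R 34) (N 3)) interleave_prog cup) cup))))) cup) cup) s4"
    by (simp add: union_core_prog_def Let_def s1_def s2_def s3_def s4_def del: run.simps)
  have cup: "returns code s4 (new_cup p q D) (run ?cup s4)"
  proof -
    obtain D' v where n: "new_cup p q D = (D', v)" by fastforce
    have "stores code D' (run ?cup s4)" "regs (run ?cup s4) = (regs s4)(12 := int v, 0 := int v + 1)"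
      by (rule new_prog_spec[OF st4 D n]; use r f in simp)+
    then show ?thesis by (simp add: returns_def n)
  qed
  have "returns code s4 (union_core p q D) (run union_core_prog s)"
  proof (cases "lab D p \<in> range Shift \<and> lab D q \<in> range Shift")
    case False
    then have "union_core p q D = new_cup p q D"
      by (auto simp: union_core_def split: label.splits)
    moreover have "run union_core_prog s = run ?cup s4"
      using False unfolding run by (auto simp: Let_def lp lq tag_eq_iff)
    ultimately show ?thesis using cup by simp
  next
    case True
    then obtain k k' where k: "lab D p = Shift k" "lab D q = Shift k'" by blast
    obtain w where w: "lft D p = Some w" "w \<in> nodes D" using k ecs_lft[OF D u(1)] by auto
    obtain w' where w': "lft D q = Some w'" "w' \<in> nodes D" using k ecs_lft[OF D u(2)] by auto
    have lw: "regs s4 30 = tag (lab D w)" "lft D w = Some x \<Longrightarrow> regs s4 32 = int x"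
      "rgt D w = Some x \<Longrightarrow> regs s4 33 = int x" for x
      using load_node_regs[OF st2 w(2) lp(4)[OF w(1)], of 30] f4 by (simp_all add: s3_def)
    have lw': "regs s4 34 = tag (lab D w')" "lft D w' = Some x \<Longrightarrow> regs s4 36 = int x"
      "rgt D w' = Some x \<Longrightarrow> regs s4 37 = int x" for x
      using load_node_regs[OF st3 w'(2) lq(4)[OF w'(1)], of 34] by (simp_all add: s4_def)
    have tags: "regs s4 20 = 5" "regs s4 24 = 5" using lp lq k by simp_all
    have out: "output_node D w \<longleftrightarrow> regs s4 30 = 2 \<or> regs s4 30 = 4"
      "output_node D w' \<longleftrightarrow> regs s4 34 = 2 \<or> regs s4 34 = 4"
      by (auto simp: output_node_def lw lw' tag_eq_iff)
    have un: "union_node D w \<longleftrightarrow> regs s4 30 = 3" "union_node D w' \<longleftrightarrow> regs s4 34 = 3"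
      by (auto simp: union_node_def lw lw' tag_eq_iff)
    note core = union_core_def[of p q D, unfolded k w w' Let_def, simplified]
    show ?thesis
    proof (cases "output_node D w")
      case True
      then have "run union_core_prog s = run (attach_args 20 24) s4"
        unfolding run using tags out by (auto simp: Let_def)
      moreover have "returns code s4 (attach k w k' w' D) (run (attach_args 20 24) s4)"
        by (rule attach_args_spec[OF st4 D w(2) w'(2)]) (simp_all add: lp lq k w w')
      ultimately show ?thesis using True core by simp
    next
      case no: False
      show ?thesis
      proof (cases "output_node D w'")
        case True
        then have "run union_core_prog s = run (attach_args 24 20) s4"
          unfolding run using tags out no by (auto simp: Let_def)
        moreover have "returns code s4 (attach k' w' k w D) (run (attach_args 24 20) s4)"
          by (rule attach_args_spec[OF st4 D w'(2) w(2)]) (simp_all add: lp lq k w w')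
        ultimately show ?thesis using True no core by simp
      next
        case no': False
        show ?thesis
        proof (cases "union_node D w \<and> union_node D w'")
          case True
          then have "run union_core_prog s = run interleave_prog s4"
            unfolding run using tags out no no' un by (auto simp: Let_def)
          moreover obtain x y where x: "lft D w = Some x" "rgt D w = Some y"
            using ecs_both[OF D w(2)] True unfolding union_node_def by (metis insertI1)
          moreover obtain x' y' where x': "lft D w' = Some x'" "rgt D w' = Some y'"
            using ecs_both[OF D w'(2)] True unfolding union_node_def by (metis insertI1)
          moreover have "returns code s4 (interleave k w k' w' D) (run interleave_prog s4)"
            by (rule interleave_prog_spec[OF st4 D w(2) w'(2) x x'])
              (simp_all add: lp lq k x x' lw lw')
          ultimately show ?thesis using True no no' core by simp
        next
          case False
          then have "run union_core_prog s = run ?cup s4"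
            unfolding run using tags out no no' un by (auto simp: Let_def)
          moreover have "union_core p q D = new_cup p q D" using False no no' core by auto
          ultimately show ?thesis using cup by simp
        qed
      qed
    qed
  qed
  then show ?thesis using f by (simp add: returns_def)
qed

text \<open>The flag is written before \<open>p\<close> is copied from \<open>a\<close>; hence
  \<open>f\<close> has to differ from \<open>a\<close>.\<close>

definition split_prog :: "nat \<Rightarrow> nat \<Rightarrow> nat \<Rightarrow> com" where
  "split_prog a p f =
     (let plain = Seq (Assign f (N 0)) (Assign p (R a)) in
      Seq (load_node a 20)
        (If (Eq (R 20) (N 3))
          (If (Eq (R 22) (R 2)) (Seq (Assign f (N 1)) (Assign p (R 23))) plain) plain))"

lemma split_prog_spec:
  assumes st: "stores code D s" and D: "is_ecs \<Omega> D" and v: "v \<in> nodes D" "regs s a = int v"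
    and sp: "split_eps D v = (b, u)"
    and r: "2 < p" "p < 12" "2 < f" "f < 12" "a < 12" "f \<noteq> a" "f \<noteq> p"
  shows "stores code D (run (split_prog a p f) s)"
    "x < 12 \<Longrightarrow> regs (run (split_prog a p f) s) x =
       (if x = p then int u else if x = f then of_bool b else regs s x)"
proof -
  define s1 where "s1 = run (load_node a 20) s"
  let ?s = "run (split_prog a p f) s"
  have st1: "stores code D s1" unfolding s1_def using st by (rule load_node_stores) simp
  have f: "regs s1 x = regs s x" if "x < 12" for x using that by (simp add: s1_def load_node_frame)
  have l: "regs s1 20 = tag (lab D v)" "lft D v = Some w \<Longrightarrow> regs s1 22 = int w"
    "rgt D v = Some w \<Longrightarrow> regs s1 23 = int w" for w
    using load_node_regs[OF st v, of 20] r by (simp_all add: s1_def)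
  have e: "regs s1 2 = int (eps_node D)" using stores_regs[OF st1] by simp
  have "mem ?s = mem s1 \<and> regs ?s = (regs s1)(f := of_bool b, p := int u)"
  proof (cases "lab D v = Cup")
    case True
    then obtain x y where x: "lft D v = Some x" "rgt D v = Some y"
      using ecs_both[OF D v(1)] by (metis insertI1)
    show ?thesis
      using sp True x l(1) l(2)[OF x(1)] l(3)[OF x(2)] e r f v(2)
      by (cases "x = eps_node D") (auto simp: split_prog_def Let_def s1_def[symmetric] split_eps_def)
  next
    case False
    then show ?thesis
      using sp l(1) r f v(2)
      by (auto simp: split_prog_def Let_def s1_def[symmetric] split_eps_def tag_eq_iff)
  qed
  then have m: "mem ?s = mem s1" and rg: "regs ?s = (regs s1)(f := of_bool b, p := int u)" by auto
  show "stores code D ?s" by (rule stores_cong[OF st1 m]) (use rg r in simp)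
  show "regs ?s x = (if x = p then int u else if x = f then of_bool b else regs s x)" if "x < 12"
    using rg f[OF that] r by simp
qed

text \<open>An adapter between the registers of the core programs and those of the operations:
  registers 1 to 9 survive, except for 5, which receives the result and may serve as an argument of
  the next call.\<close>

definition call_prog :: "com \<Rightarrow> nat \<Rightarrow> nat \<Rightarrow> com" where
  "call_prog c i j = seqs [Assign 10 (R i), Assign 11 (R j), c, Assign 5 (R 12)]"

lemma call_prog_spec:
  assumes st: "stores code D s" and ij: "0 < i" "i < 10" "0 < j" "j < 10"
    and c: "\<And>s'. stores code D s' \<Longrightarrow> regs s' 10 = regs s i \<Longrightarrow> regs s' 11 = regs s j \<Longrightarrow>
      returns code s' (D', v) (run c s')"
  shows "stores code D' (run (call_prog c i j) s)"
    "0 < x \<Longrightarrow> x < 10 \<Longrightarrow> regs (run (call_prog c i j) s) x = (if x = 5 then int v else regs s x)"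
proof -
  define s1 where "s1 = run (Seq (Assign 10 (R i)) (Assign 11 (R j))) s"
  let ?s = "run (call_prog c i j) s"
  have 1: "regs s1 = (regs s)(10 := regs s i, 11 := regs s j)" "mem s1 = mem s"
    using ij by (simp_all add: s1_def)
  have st1: "stores code D s1" by (rule stores_cong[OF st 1(2)]) (simp add: 1)
  have 2: "returns code s1 (D', v) (run c s1)" by (rule c[OF st1]) (simp_all add: 1)
  have 3: "?s = run (Assign 5 (R 12)) (run c s1)" by (simp add: call_prog_def s1_def)
  show "stores code D' ?s"
    using 2 unfolding 3 returns_def by (auto intro: stores_cong)
  show "0 < x \<Longrightarrow> x < 10 \<Longrightarrow> regs ?s x = (if x = 5 then int v else regs s x)"
    using 2 1 unfolding 3 returns_def by simp
qed

definition join_prog :: "nat \<Rightarrow> com" where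
  "join_prog j = new_prog (N 3) (N 0) (R 2) (R j) 5"

lemma join_prog_spec:
  assumes st: "stores code D s" and D: "is_ecs \<Omega> D" and r: "regs s j = int u"
    and n: "new_cup (eps_node D) u D = (D', v)"
  shows "stores code D' (run (join_prog j) s)" "regs (run (join_prog j) s) 5 = int v"
proof -
  have "stores code D' (run (join_prog j) s)"
    "regs (run (join_prog j) s) = (regs s)(5 := int v, 0 := int v + 1)"
    unfolding join_prog_def by (rule new_prog_spec[OF st D n]; use r stores_regs[OF st] in simp)+
  then show "stores code D' (run (join_prog j) s)" "regs (run (join_prog j) s) 5 = int v" by simp_all
qed

definition add_prog :: com where
  "add_prog = seqs [new_prog (N 2) (R 3) (N 0) (N 0) 20, new_prog (N 5) (N 0) (R 20) (N 0) 5]"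

text \<open>Registers 6 and 7 hold the arguments without \<epsilon>, 8 and 9 the flags that tell
  whether \<epsilon> was split off, and 5 the node built so far.\<close>

definition prod_prog :: com where
  "prod_prog =
     If (Eq (R 3) (R 1)) (Assign 5 (R 1))
     (If (Eq (R 4) (R 1)) (Assign 5 (R 1))
     (If (Eq (R 3) (R 2)) (Assign 5 (R 4))
     (If (Eq (R 4) (R 2)) (Assign 5 (R 3))
       (seqs [split_prog 3 6 8, split_prog 4 7 9, call_prog prod_core_prog 6 7,
          If (Eq (R 9) (N 1)) (call_prog union_core_prog 6 5) Skip,
          If (Eq (R 8) (N 1)) (call_prog union_core_prog 7 5) Skip,
          If (Eq (R 8) (N 1)) (If (Eq (R 9) (N 1)) (join_prog 5) Skip) Skip]))))"

definition union_prog :: com where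
  "union_prog =
     If (Eq (R 4) (R 1)) (Assign 5 (R 3))
     (If (Eq (R 3) (R 1)) (Assign 5 (R 4))
     (If (Eq (R 3) (R 2)) (join_prog 4)
     (If (Eq (R 4) (R 2)) (join_prog 3)
       (seqs [split_prog 3 6 8, split_prog 4 7 9, call_prog union_core_prog 6 7,
          If (Eq (R 8) (N 1)) (join_prog 5) (If (Eq (R 9) (N 1)) (join_prog 5) Skip)]))))"

definition shift_prog :: com where
  "shift_prog =
     If (Eq (R 3) (R 1)) (Assign 5 (R 3))
     (If (Eq (R 3) (R 2)) (Assign 5 (R 3))
       (seqs [split_prog 3 6 8, call_prog shift_core_prog 6 4, If (Eq (R 8) (N 1)) (join_prog 5) Skip]))"

section \<open>The four programs implement the operations\<close>

lemma assign_result: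
  assumes "stores code D s" "regs s j = int v" "run c s = run (Assign 5 (R j)) s"
  shows "stores code D (run c s) \<and> regs (run c s) 5 = int v"
  using assms(2,3) by (auto intro: stores_cong[OF assms(1)])

lemma add_prog_spec:
  assumes st: "stores code D s" and D: "is_ecs \<Omega> D" and a: "a \<in> \<Omega>" "regs s 3 = code a"
    and op: "apply_op D (CAdd a) = (D', v)"
  shows "stores code D' (run add_prog s) \<and> regs (run add_prog s) 5 = int v"
proof -
  obtain D1 u where 1: "new_sym a D = (D1, u)" by fastforce
  have 2: "new_shift 0 u D1 = (D', v)" using op 1 by simp
  note e1 = new_sym_spec(1,2)[OF D a(1) 1]
  define s1 where "s1 = run (new_prog (N 2) (R 3) (N 0) (N 0) 20) s"
  define s2 where "s2 = run (new_prog (N 5) (N 0) (R 20) (N 0) 5) s1"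
  have 4: "stores code D1 s1" "regs s1 = (regs s)(20 := int u, 0 := int u + 1)"
    unfolding s1_def by (rule new_prog_spec[OF st D 1]; use a in simp)+
  have 5: "stores code D' s2" "regs s2 = (regs s1)(5 := int v, 0 := int v + 1)"
    unfolding s2_def by (rule new_prog_spec[OF 4(1) ext_ecs[OF e1(1)] 2]; use 4 in simp)+
  have "run add_prog s = s2" by (simp add: add_prog_def s1_def s2_def)
  then show ?thesis using 5 by simp
qed

lemma prod_prog_spec:
  assumes st: "stores code D s" and D: "is_ecs \<Omega> D" and v: "v1 \<in> nodes D" "v2 \<in> nodes D"
    and r: "regs s 3 = int v1" "regs s 4 = int v2" and op: "prod_op v1 v2 D = (D', v)"
  shows "stores code D' (run prod_prog s) \<and> regs (run prod_prog s) 5 = int v"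
proof (cases "{v1, v2} \<inter> {bot_node D, eps_node D} = {}")
  case False
  note sr = stores_regs[OF st]
  consider "v1 = bot_node D" | "v1 \<noteq> bot_node D" "v2 = bot_node D"
    | "v1 \<noteq> bot_node D" "v2 \<noteq> bot_node D" "v1 = eps_node D"
    | "v1 \<noteq> bot_node D" "v2 \<noteq> bot_node D" "v1 \<noteq> eps_node D" "v2 = eps_node D" using False by blast
  then show ?thesis
  proof cases
    case 1
    then have "run prod_prog s = run (Assign 5 (R 1)) s" using r sr by (simp add: prod_prog_def)
    moreover have "D' = D" "v = bot_node D" using op 1 by (auto simp: prod_op_def)
    ultimately show ?thesis using assign_result[OF st, of 1 v] r sr by simp
  next
    case 2
    then have "run prod_prog s = run (Assign 5 (R 1)) s" using r sr by (simp add: prod_prog_def)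
    moreover have "D' = D" "v = bot_node D" using op 2 by (auto simp: prod_op_def)
    ultimately show ?thesis using assign_result[OF st, of 1 v] r sr by simp
  next
    case 3
    then have "run prod_prog s = run (Assign 5 (R 4)) s" using r sr by (simp add: prod_prog_def)
    moreover have "D' = D" "v = v2" using op 3 by (auto simp: prod_op_def)
    ultimately show ?thesis using assign_result[OF st, of 4 v] r sr by simp
  next
    case 4
    then have "run prod_prog s = run (Assign 5 (R 3)) s" using r sr by (simp add: prod_prog_def)
    moreover have "D' = D" "v = v1" using op 4 by (auto simp: prod_op_def)
    ultimately show ?thesis using assign_result[OF st, of 3 v] r sr by simp
  qed
next
  case True
  obtain f1 p1 f2 p2 where sp: "split_eps D v1 = (f1, p1)" "split_eps D v2 = (f2, p2)" by fastforce
  obtain D1 q1 where 1: "prod_core p1 p2 D = (D1, q1)" by fastforce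
  obtain D2 q2 where 2: "(if f2 then union_core p1 q1 D1 else (D1, q1)) = (D2, q2)" by fastforce
  obtain D3 q3 where 3: "(if f1 then union_core p2 q2 D2 else (D2, q2)) = (D3, q3)" by fastforce
  have 4: "join_eps (f1 \<and> f2) (D3, q3) = (D', v)"
    using op True sp 1 2 3 by (simp add: prod_op_def)
  note t1 = split_eps_spec(1)[OF D v(1) sp(1)] and t2 = split_eps_spec(1)[OF D v(2) sp(2)]
  note e1 = prod_core_spec(1,2)[OF D t1 t2 1]
  have e2: "ext \<Omega> D1 D2 \<and> q2 \<in> nodes D2"
    using 2 union_core_spec[OF ext_ecs[OF e1(1)] ext_same(3)[OF e1(1) t1] e1(2)] e1(2)
      ext_refl[OF ext_ecs[OF e1(1)]] by (auto split: if_splits)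
  then have e02: "ext \<Omega> D D2" using e1(1) ext_trans by blast
  have e3: "ext \<Omega> D2 D3"
    using 3 union_core_spec[OF ext_ecs[OF e02] ext_same(3)[OF e02 t2], of q2] e2
      ext_refl[OF ext_ecs[OF e02]] by (auto split: if_splits)
  define s1 where "s1 = run (split_prog 3 6 8) s"
  define s2 where "s2 = run (split_prog 4 7 9) s1"
  define s3 where "s3 = run (call_prog prod_core_prog 6 7) s2"
  define s4 where "s4 = run (If (Eq (R 9) (N 1)) (call_prog union_core_prog 6 5) Skip) s3"
  define s5 where "s5 = run (If (Eq (R 8) (N 1)) (call_prog union_core_prog 7 5) Skip) s4"
  define s6 where "s6 = run (If (Eq (R 8) (N 1)) (If (Eq (R 9) (N 1)) (join_prog 5) Skip) Skip) s5"
  have st1: "stores code D s1" and r1: "x < 12 \<Longrightarrow>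
      regs s1 x = (if x = 6 then int p1 else if x = 8 then of_bool f1 else regs s x)" for x
    unfolding s1_def by (rule split_prog_spec[OF st D v(1) r(1) sp(1)]; simp)+
  have r1': "regs s1 4 = int v2" using r1[of 4] r by simp
  have st2: "stores code D s2" and r2: "x < 12 \<Longrightarrow>
      regs s2 x = (if x = 7 then int p2 else if x = 9 then of_bool f2 else regs s1 x)" for x
    unfolding s2_def by (rule split_prog_spec[OF st1 D v(2) r1' sp(2)]; simp)+
  have r2': "regs s2 6 = int p1" "regs s2 7 = int p2" "regs s2 8 = of_bool f1" "regs s2 9 = of_bool f2"
    using r2 r1 by simp_all
  have c3: "returns code s' (D1, q1) (run prod_core_prog s')"
    if "stores code D s'" "regs s' 10 = regs s2 6" "regs s' 11 = regs s2 7" for s'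
    using prod_core_prog_spec[OF that(1) D t1 t2] that r2' 1 by simp
  have st3: "stores code D1 s3" and r3: "0 < x \<Longrightarrow> x < 10 \<Longrightarrow>
      regs s3 x = (if x = 5 then int q1 else regs s2 x)" for x
    unfolding s3_def by (rule call_prog_spec[OF st2 _ _ _ _ c3]; simp)+
  have s4: "stores code D2 s4 \<and> (\<forall>x. 0 < x \<and> x < 10 \<longrightarrow>
      regs s4 x = (if x = 5 then int q2 else regs s2 x))"
  proof (cases f2)
    case True
    have c4: "returns code s' (D2, q2) (run union_core_prog s')"
      if "stores code D1 s'" "regs s' 10 = regs s3 6" "regs s' 11 = regs s3 5" for s'
      using union_core_prog_spec[OF that(1) ext_ecs[OF e1(1)] ext_same(3)[OF e1(1) t1] e1(2)] that
        r2' r3 2 True by simp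
    have "s4 = run (call_prog union_core_prog 6 5) s3" unfolding s4_def using True r3 r2' by simp
    moreover have "stores code D2 (run (call_prog union_core_prog 6 5) s3)"
      "0 < x \<Longrightarrow> x < 10 \<Longrightarrow> regs (run (call_prog union_core_prog 6 5) s3) x =
        (if x = 5 then int q2 else regs s3 x)" for x
      by (rule call_prog_spec[OF st3 _ _ _ _ c4]; simp)+
    ultimately show ?thesis using r3 by simp
  next
    case False
    then have "s4 = s3" unfolding s4_def using r3 r2' by simp
    then show ?thesis using st3 r3 2 False by simp
  qed
  have s5: "stores code D3 s5 \<and> (\<forall>x. 0 < x \<and> x < 10 \<longrightarrow>
      regs s5 x = (if x = 5 then int q3 else regs s2 x))"
  proof (cases f1)
    case True
    have c5: "returns code s' (D3, q3) (run union_core_prog s')"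
      if "stores code D2 s'" "regs s' 10 = regs s4 7" "regs s' 11 = regs s4 5" for s'
      using union_core_prog_spec[OF that(1) ext_ecs[OF e02] ext_same(3)[OF e02 t2] e2[THEN conjunct2]]
        that r2' s4 3 True by simp
    have "s5 = run (call_prog union_core_prog 7 5) s4" unfolding s5_def using True s4 r2' by simp
    moreover have "stores code D3 (run (call_prog union_core_prog 7 5) s4)"
      "0 < x \<Longrightarrow> x < 10 \<Longrightarrow> regs (run (call_prog union_core_prog 7 5) s4) x =
        (if x = 5 then int q3 else regs s4 x)" for x
      by (rule call_prog_spec[OF s4[THEN conjunct1] _ _ _ _ c5]; simp)+
    ultimately show ?thesis using s4 by simp
  next
    case False
    then have "s5 = s4" unfolding s5_def using s4 r2' by simp
    then show ?thesis using s4 3 False by simp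
  qed
  have "stores code D' s6 \<and> regs s6 5 = int v"
  proof (cases "f1 \<and> f2")
    case True
    then have "s6 = run (join_prog 5) s5" unfolding s6_def using s5 r2' by simp
    moreover have "new_cup (eps_node D3) q3 D3 = (D', v)" using 4 True by (simp add: join_eps_def)
    ultimately show ?thesis using join_prog_spec[OF _ ext_ecs[OF e3], of code s5 5 q3] s5 by simp
  next
    case False
    then have "s6 = s5" unfolding s6_def using s5 r2' by auto
    then show ?thesis using s5 4 False by (auto simp: join_eps_def)
  qed
  moreover have "run prod_prog s = s6"
    using True r stores_regs[OF st]
    by (simp add: prod_prog_def s1_def s2_def s3_def s4_def s5_def s6_def)
  ultimately show ?thesis by simp
qed

lemma union_prog_spec:
  assumes st: "stores code D s" and D: "is_ecs \<Omega> D" and v: "v3 \<in> nodes D" "v4 \<in> nodes D"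
    and r: "regs s 3 = int v3" "regs s 4 = int v4" and op: "union_op v3 v4 D = (D', v)"
  shows "stores code D' (run union_prog s) \<and> regs (run union_prog s) 5 = int v"
proof -
  note sr = stores_regs[OF st]
  consider "v4 = bot_node D" | "v4 \<noteq> bot_node D" "v3 = bot_node D" | "v4 \<noteq> bot_node D" "v3 \<noteq> bot_node D" "v3 = eps_node D"
    | "v4 \<noteq> bot_node D" "v3 \<noteq> bot_node D" "v3 \<noteq> eps_node D" "v4 = eps_node D"
    | "{v3, v4} \<inter> {bot_node D, eps_node D} = {}" by blast
  then show ?thesis
  proof cases
    case 1
    then have "run union_prog s = run (Assign 5 (R 3)) s" using r sr by (simp add: union_prog_def)
    moreover have "D' = D" "v = v3" using op 1 by (auto simp: union_op_def)
    ultimately show ?thesis using assign_result[OF st, of 3 v] r sr by simp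
  next
    case 2
    then have "run union_prog s = run (Assign 5 (R 4)) s" using r sr by (simp add: union_prog_def)
    moreover have "D' = D" "v = v4" using op 2 by (auto simp: union_op_def)
    ultimately show ?thesis using assign_result[OF st, of 4 v] r sr by simp
  next
    case 3
    then have "run union_prog s = run (join_prog 4) s" using r sr by (simp add: union_prog_def)
    then show ?thesis using join_prog_spec[OF st D r(2)] op 3 by (simp add: union_op_def)
  next
    case 4
    then have "run union_prog s = run (join_prog 3) s" using r sr by (simp add: union_prog_def)
    then show ?thesis using join_prog_spec[OF st D r(1)] op 4 by (simp add: union_op_def)
  next
    case 5
    obtain f3 p3 f4 p4 where sp: "split_eps D v3 = (f3, p3)" "split_eps D v4 = (f4, p4)" by fastforce
    obtain D1 q where 1: "union_core p3 p4 D = (D1, q)" by fastforce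
    have 2: "join_eps (f3 \<or> f4) (D1, q) = (D', v)" using op 5 sp 1 by (simp add: union_op_def)
    note t3 = split_eps_spec(1)[OF D v(1) sp(1)] and t4 = split_eps_spec(1)[OF D v(2) sp(2)]
    have e1: "ext \<Omega> D D1" using union_core_spec[OF D t3 t4 1] by blast
    define s1 where "s1 = run (split_prog 3 6 8) s"
    define s2 where "s2 = run (split_prog 4 7 9) s1"
    define s3 where "s3 = run (call_prog union_core_prog 6 7) s2"
    define s4 where "s4 = run (If (Eq (R 8) (N 1)) (join_prog 5) (If (Eq (R 9) (N 1)) (join_prog 5) Skip)) s3"
    have st1: "stores code D s1" and r1: "x < 12 \<Longrightarrow>
        regs s1 x = (if x = 6 then int p3 else if x = 8 then of_bool f3 else regs s x)" for x
      unfolding s1_def by (rule split_prog_spec[OF st D v(1) r(1) sp(1)]; simp)+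
    have r1': "regs s1 4 = int v4" using r1[of 4] r by simp
    have st2: "stores code D s2" and r2: "x < 12 \<Longrightarrow>
        regs s2 x = (if x = 7 then int p4 else if x = 9 then of_bool f4 else regs s1 x)" for x
      unfolding s2_def by (rule split_prog_spec[OF st1 D v(2) r1' sp(2)]; simp)+
    have r2': "regs s2 6 = int p3" "regs s2 7 = int p4" "regs s2 8 = of_bool f3" "regs s2 9 = of_bool f4"
      using r2 r1 by simp_all
    have c3: "returns code s' (D1, q) (run union_core_prog s')"
      if "stores code D s'" "regs s' 10 = regs s2 6" "regs s' 11 = regs s2 7" for s'
      using union_core_prog_spec[OF that(1) D t3 t4] that r2' 1 by simp
    have st3: "stores code D1 s3" and r3: "0 < x \<Longrightarrow> x < 10 \<Longrightarrow>
        regs s3 x = (if x = 5 then int q else regs s2 x)" for x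
      unfolding s3_def by (rule call_prog_spec[OF st2 _ _ _ _ c3]; simp)+
    have "stores code D' s4 \<and> regs s4 5 = int v"
    proof (cases "f3 \<or> f4")
      case True
      then have "s4 = run (join_prog 5) s3" unfolding s4_def using r3 r2' by auto
      moreover have "new_cup (eps_node D1) q D1 = (D', v)" using 2 True by (simp add: join_eps_def)
      ultimately show ?thesis using join_prog_spec[OF st3 ext_ecs[OF e1], of 5 q] r3 by simp
    next
      case False
      then have "s4 = s3" unfolding s4_def using r3 r2' by auto
      then show ?thesis using st3 r3 2 False by (auto simp: join_eps_def)
    qed
    moreover have "run union_prog s = s4"
      using 5 r sr by (simp add: union_prog_def s1_def s2_def s3_def s4_def)
    ultimately show ?thesis by simp
  qed
qed

lemma shift_prog_spec:
  assumes st: "stores code D s" and D: "is_ecs \<Omega> D" and v: "v0 \<in> nodes D"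
    and r: "regs s 3 = int v0" "regs s 4 = k" and op: "shift_op v0 k D = (D', v)"
  shows "stores code D' (run shift_prog s) \<and> regs (run shift_prog s) 5 = int v"
proof (cases "v0 = bot_node D \<or> v0 = eps_node D")
  case True
  then have "run shift_prog s = run (Assign 5 (R 3)) s"
    using r stores_regs[OF st] by (auto simp: shift_prog_def)
  moreover have "D' = D" "v = v0" using op True by (auto simp: shift_op_def)
  ultimately show ?thesis using assign_result[OF st, of 3 v] r by simp
next
  case False
  obtain f p where sp: "split_eps D v0 = (f, p)" by fastforce
  obtain D1 q where 1: "shift_core p k D = (D1, q)" by fastforce
  have 2: "join_eps f (D1, q) = (D', v)" using op False sp 1 by (simp add: shift_op_def)
  note t = split_eps_spec(1)[OF D v sp]
  have e1: "ext \<Omega> D D1" using shift_core_spec[OF D t 1] by blast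
  define s1 where "s1 = run (split_prog 3 6 8) s"
  define s2 where "s2 = run (call_prog shift_core_prog 6 4) s1"
  define s3 where "s3 = run (If (Eq (R 8) (N 1)) (join_prog 5) Skip) s2"
  have st1: "stores code D s1" and r1: "x < 12 \<Longrightarrow>
      regs s1 x = (if x = 6 then int p else if x = 8 then of_bool f else regs s x)" for x
    unfolding s1_def by (rule split_prog_spec[OF st D v r(1) sp]; simp)+
  have c2: "returns code s' (D1, q) (run shift_core_prog s')"
    if "stores code D s'" "regs s' 10 = regs s1 6" "regs s' 11 = regs s1 4" for s'
    using shift_core_prog_spec[OF that(1) D t] that r1 r 1 by simp
  have st2: "stores code D1 s2" and r2: "0 < x \<Longrightarrow> x < 10 \<Longrightarrow>
      regs s2 x = (if x = 5 then int q else regs s1 x)" for x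
    unfolding s2_def by (rule call_prog_spec[OF st1 _ _ _ _ c2]; simp)+
  have "stores code D' s3 \<and> regs s3 5 = int v"
  proof (cases f)
    case True
    then have "s3 = run (join_prog 5) s2" unfolding s3_def using r2 r1 by simp
    moreover have "new_cup (eps_node D1) q D1 = (D', v)" using 2 True by (simp add: join_eps_def)
    ultimately show ?thesis using join_prog_spec[OF st2 ext_ecs[OF e1], of 5 q] r2 by simp
  next
    case False
    then have "s3 = s2" unfolding s3_def using r2 r1 by simp
    then show ?thesis using st2 r2 2 False by (auto simp: join_eps_def)
  qed
  moreover have "run shift_prog s = s3"
    using False r stores_regs[OF st] by (simp add: shift_prog_def s1_def s2_def s3_def)
  ultimately show ?thesis by simp
qed

fun op_prog :: "opname \<Rightarrow> com" where
  "op_prog OpAdd = add_prog"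
| "op_prog OpProd = prod_prog"
| "op_prog OpUnion = union_prog"
| "op_prog OpShift = shift_prog"

lemma loop_free_op_prog: "loop_free (op_prog p)"
  by (cases p)
    (simp_all add: add_prog_def prod_prog_def union_prog_def shift_prog_def join_prog_def call_prog_def
      split_prog_def Let_def load_node_def new_prog_def union_core_prog_def prod_core_prog_def
      shift_core_prog_def interleave_prog_def attach_args_def attach_prog_def)

lemma op_prog_spec:
  assumes "is_ecs \<Omega> D" "call_assm \<Omega> D c" "stores code D s" "loads_args code c s"
  shows "stores code (fst (apply_op D c)) (run (op_prog (call_op c)) s) \<and>
    regs (run (op_prog (call_op c)) s) 5 = int (snd (apply_op D c))"
proof -
  obtain D' v where op: "apply_op D c = (D', v)" by fastforce
  have "stores code D' (run (op_prog (call_op c)) s) \<and> regs (run (op_prog (call_op c)) s) 5 = int v"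
  proof (cases c)
    case (CAdd a)
    then show ?thesis using add_prog_spec[of code D s \<Omega> a D' v] assms op by simp
  next
    case (CProd v1 v2)
    then show ?thesis using prod_prog_spec[of code D s \<Omega> v1 v2 D' v] assms op by simp
  next
    case (CUnion v3 v4)
    then show ?thesis using union_prog_spec[of code D s \<Omega> v3 v4 D' v] assms op by simp
  next
    case (CShift v0 k)
    then show ?thesis using shift_prog_spec[of code D s \<Omega> v0 k D' v] assms op by simp
  qed
  then show ?thesis by (simp add: op)
qed

lemma constant_time_op_prog: "constant_time_implementation \<Omega> code apply_op op_prog"
proof -
  define K where "K = Max (time_bound ` op_prog ` {OpAdd, OpProd, OpUnion, OpShift})"
  have "time_bound (op_prog p) \<le> K" for p
    unfolding K_def by (cases p) (auto intro!: Max_ge)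
  then have "length (trace (op_prog p) s) \<le> K" for p s
    using length_trace order_trans by blast
  then show ?thesis
    unfolding constant_time_implementation_def
    using op_prog_spec exec_run[OF loop_free_op_prog] by blast
qed

section \<open>The enumeration order\<close>

text \<open>This is the exact order in which the search prints the words. The tests
  \<open>l < v\<close> and \<open>r < v\<close> make the recursion terminate on arbitrary structures
  and always succeed for the children of a node in a well-built one. In products the right factor
  varies slowest, because the search fixes it first.\<close>

function node_words :: "('a, nat) ecs \<Rightarrow> nat \<Rightarrow> 'a word list" where
  "node_words D v =
     (let l = the (lft D v); r = the (rgt D v);
          wl = (if l < v then node_words D l else []); wr = (if r < v then node_words D r else []) in
      case lab D v of
        LBot \<Rightarrow> []
      | LEps \<Rightarrow> [[]]
      | Sym a \<Rightarrow> [[(a, 1)]]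
      | Shift k \<Rightarrow> map (\<lambda>w. sh w k) wl
      | Cup \<Rightarrow> wl @ wr
      | Odot \<Rightarrow> concat (map (\<lambda>y. map (\<lambda>x. x @ y) wl) wr))"
  by pat_completeness auto
termination by (relation "measure snd") auto

declare node_words.simps [simp del]

lemma node_words_equations:
  assumes "well_built \<Omega> D" "v \<in> nodes D"
  shows "lab D v = LBot \<Longrightarrow> node_words D v = []"
    "lab D v = LEps \<Longrightarrow> node_words D v = [[]]"
    "lab D v = Sym a \<Longrightarrow> node_words D v = [[(a, 1)]]"
    "lab D v = Shift k \<Longrightarrow> lft D v = Some l \<Longrightarrow> node_words D v = map (\<lambda>w. sh w k) (node_words D l)"
    "lab D v = Cup \<Longrightarrow> lft D v = Some l \<Longrightarrow> rgt D v = Some r \<Longrightarrow>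
      node_words D v = node_words D l @ node_words D r"
    "lab D v = Odot \<Longrightarrow> lft D v = Some l \<Longrightarrow> rgt D v = Some r \<Longrightarrow>
      node_words D v = concat (map (\<lambda>y. map (\<lambda>x. x @ y) (node_words D l)) (node_words D r))"
proof -
  have "l < v" if "lft D v = Some l \<or> rgt D v = Some l" for l
    using assms that by (auto simp: well_built_def node_ok_def child_def)
  note less = this[OF disjI1] this[OF disjI2]
  show "lab D v = LBot \<Longrightarrow> node_words D v = []"
    "lab D v = LEps \<Longrightarrow> node_words D v = [[]]"
    "lab D v = Sym a \<Longrightarrow> node_words D v = [[(a, 1)]]"
    "lab D v = Shift k \<Longrightarrow> lft D v = Some l \<Longrightarrow> node_words D v = map (\<lambda>w. sh w k) (node_words D l)"
    "lab D v = Cup \<Longrightarrow> lft D v = Some l \<Longrightarrow> rgt D v = Some r \<Longrightarrow>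
      node_words D v = node_words D l @ node_words D r"
    "lab D v = Odot \<Longrightarrow> lft D v = Some l \<Longrightarrow> rgt D v = Some r \<Longrightarrow>
      node_words D v = concat (map (\<lambda>y. map (\<lambda>x. x @ y) (node_words D l)) (node_words D r))"
    by (subst node_words.simps; simp add: Let_def less)+
qed

text \<open>Within the block of one \<open>y\<close>, cancellation on the right gives distinctness;
  across blocks, unique decomposition does.\<close>

lemma distinct_conc:
  assumes "distinct xs" "distinct ys" "unique_decomp (set xs) (set ys)"
  shows "distinct (concat (map (\<lambda>y. map (\<lambda>x. x @ y) xs) ys))"
  using assms(2,3)
proof (induction ys)
  case (Cons y ys)
  have "unique_decomp (set xs) (set ys)" by (rule unique_decomp_mono[OF Cons.prems(2)]) auto
  moreover have "distinct (map (\<lambda>x. x @ y) xs)"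
    using assms(1) by (simp add: distinct_map inj_on_def)
  moreover have "x @ y \<noteq> x' @ y'" if "x \<in> set xs" "x' \<in> set xs" "y' \<in> set ys" for x x' y'
    using unique_decompD[OF Cons.prems(2), of x y x' y'] that Cons.prems(1) by auto
  ultimately show ?case using Cons by auto
qed simp

lemma node_words_correct:
  assumes i: "well_built \<Omega> D"
  shows "v \<in> nodes D \<Longrightarrow> set (node_words D v) = sem D v \<and> distinct (node_words D v)"
proof (induction v rule: less_induct)
  case (less v)
  note D = well_built_ecs[OF i] and v = less.prems
  note w = node_words_equations[OF i v]
  have ok: "node_ok D v" using i v by (simp add: well_built_def)
  have ih: "set (node_words D u) = sem D u \<and> distinct (node_words D u)" if "child D v u" for u
    using less.IH[of u] child_in[OF D v that] ok that by (simp add: node_ok_def)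
  show ?case
  proof (cases "lab D v")
    case (Sym a)
    then show ?thesis using w(3)[OF Sym] sem_equations(3)[OF Sym] by simp
  next
    case (Shift k)
    then obtain u where u: "lft D v = Some u" using ecs_lft[OF D v] by blast
    have "inj_on (\<lambda>w. sh w k) A" for A :: "'a word set" by (meson inj_onI sh_inject)
    then show ?thesis
      using w(4)[OF Shift u] sem_equations(6)[OF Shift u] ih[of u] u by (simp add: child_def distinct_map)
  next
    case Cup
    then obtain a b where u: "lft D v = Some a" "rgt D v = Some b"
      using ecs_both[OF D v] by (metis insertI1)
    then have "sem D a \<inter> sem D b = {}" using ok Cup by (simp add: node_ok_def)
    then show ?thesis
      using w(5)[OF Cup u] sem_equations(4)[OF Cup u] ih[of a] ih[of b] u by (simp add: child_def)
  next
    case Odot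
    then obtain a b where u: "lft D v = Some a" "rgt D v = Some b"
      using ecs_both[OF D v] by (metis insertI1 insertI2)
    then have "unique_decomp (sem D a) (sem D b)" using ok Odot by (simp add: node_ok_def)
    then have "distinct (node_words D v)"
      using w(6)[OF Odot u] ih[of a] ih[of b] u by (simp add: child_def distinct_conc)
    moreover have "set (node_words D v) = sem D v"
      using w(6)[OF Odot u] sem_equations(5)[OF Odot u] ih[of a] ih[of b] u
      by (auto simp: child_def lang_conc_def)
    ultimately show ?thesis by blast
  next
    case LBot
    then show ?thesis using w(1) sem_equations(1)[OF LBot] by simp
  next
    case LEps
    then show ?thesis using w(2) sem_equations(2)[OF LEps] by simp
  qed
qed

text \<open>A configuration of the search is a list of shifted nodes, to be expanded from right to left of
  the word, together with the suffix of the word that is already known.\<close>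

fun goal_words :: "('a, nat) ecs \<Rightarrow> (nat \<times> int) list \<Rightarrow> 'a word list" where
  "goal_words D [] = [[]]"
| "goal_words D ((v, k) # G) =
     concat (map (\<lambda>y. map (\<lambda>x. x @ sh y k) (goal_words D G)) (node_words D v))"

definition encode :: "('a \<Rightarrow> int) \<Rightarrow> 'a word \<Rightarrow> (int \<times> int) list" where
  "encode code w = map (\<lambda>(a, i). (code a, i)) w"

definition outputs ::
    "('a \<Rightarrow> int) \<Rightarrow> ('a, nat) ecs \<Rightarrow> (nat \<times> int) list \<times> (int \<times> int) list \<Rightarrow> (int \<times> int) list list" where
  "outputs code D = (\<lambda>(G, ds). map (\<lambda>x. encode code x @ ds) (goal_words D G))"

lemma outputs_Nil: "outputs code D ([], ds) = [ds]"
  by (simp add: outputs_def encode_def)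

text \<open>The heart of partial correctness: expanding a goal does not change the list of words
  still to come, order included, and a union cuts it into the part of the current branch and the
  part saved on the stack.\<close>

lemma outputs_step:
  assumes i: "well_built \<Omega> D" "v \<in> nodes D"
  shows "lab D v = Sym a \<Longrightarrow> outputs code D ((v, k) # G, ds) = outputs code D (G, (code a, k + 1) # ds)"
    "lab D v = Shift j \<Longrightarrow> lft D v = Some l \<Longrightarrow>
      outputs code D ((v, k) # G, ds) = outputs code D ((l, k + j) # G, ds)"
    "lab D v = Cup \<Longrightarrow> lft D v = Some l \<Longrightarrow> rgt D v = Some r \<Longrightarrow>
      outputs code D ((v, k) # G, ds) = outputs code D ((l, k) # G, ds) @ outputs code D ((r, k) # G, ds)"
    "lab D v = Odot \<Longrightarrow> lft D v = Some l \<Longrightarrow> rgt D v = Some r \<Longrightarrow>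
      outputs code D ((v, k) # G, ds) = outputs code D ((r, k) # (l, k) # G, ds)"
proof -
  note w = node_words_equations[OF i]
  show "lab D v = Sym a \<Longrightarrow> outputs code D ((v, k) # G, ds) = outputs code D (G, (code a, k + 1) # ds)"
    by (simp add: outputs_def w encode_def sh_def)
  show "lab D v = Shift j \<Longrightarrow> lft D v = Some l \<Longrightarrow>
      outputs code D ((v, k) # G, ds) = outputs code D ((l, k + j) # G, ds)"
    by (simp add: outputs_def w comp_def sh_sh add.commute)
  show "lab D v = Cup \<Longrightarrow> lft D v = Some l \<Longrightarrow> rgt D v = Some r \<Longrightarrow>
      outputs code D ((v, k) # G, ds) = outputs code D ((l, k) # G, ds) @ outputs code D ((r, k) # G, ds)"
    by (simp add: outputs_def w)
  \<comment> \<open>Associativity of concatenation on the level of enumerations: the loops over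
    right factor, left factor and remaining goals are nested in the same order on both
    sides.\<close>
  have "concat (map (\<lambda>w. map (\<lambda>x. x @ sh w k) gs) (concat (map (\<lambda>y. map (\<lambda>x. x @ y) xs) ys))) =
      concat (map (\<lambda>y. map (\<lambda>x. x @ sh y k) (concat (map (\<lambda>y. map (\<lambda>x. x @ sh y k) gs) xs))) ys)"
    for gs xs ys :: "'a word list"
    by (induction ys) (simp_all add: map_concat comp_def sh_append)
  then show "lab D v = Odot \<Longrightarrow> lft D v = Some l \<Longrightarrow> rgt D v = Some r \<Longrightarrow>
      outputs code D ((v, k) # G, ds) = outputs code D ((r, k) # (l, k) # G, ds)"
    by (simp add: outputs_def w)
qed

lemma outputs_start: "outputs code D ([(v, 0)], []) = map (encode code) (node_words D v)"
proof -
  have "concat (map (\<lambda>y. [y]) ws) = ws" for ws :: "'a word list" by (induction ws) auto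
  then show ?thesis by (simp add: outputs_def sh_0)
qed

section \<open>The enumeration program\<close>

text \<open>Lists of pairs are kept as linked lists of three-cell blocks below the address \<open>h\<close>; cells are
  never overwritten, so configurations on the stack share their tails.\<close>

fun cells :: "(nat \<Rightarrow> int) \<Rightarrow> int \<Rightarrow> int \<Rightarrow> (int \<times> int) list \<Rightarrow> bool" where
  "cells m h p [] \<longleftrightarrow> p = 0"
| "cells m h p ((a, b) # xs) \<longleftrightarrow>
     0 < p \<and> p + 3 \<le> h \<and> m (nat p) = a \<and> m (nat (p + 1)) = b \<and> cells m h (m (nat (p + 2))) xs"

text \<open>A list lies entirely below \<open>h\<close>, so writes from \<open>h\<close> on preserve
  it. This is what makes the sharing of tails sound.\<close>

lemma cells_mono:
  assumes "cells m h p xs" "h \<le> h'" "\<forall>i < nat h. m' i = m i"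
  shows "cells m' h' p xs"
  using assms(1)
proof (induction xs arbitrary: p)
  case (Cons x xs)
  obtain a b where x: "x = (a, b)" by fastforce
  have "m' (nat p) = m (nat p)" "m' (nat (p + 1)) = m (nat (p + 1))" "m' (nat (p + 2)) = m (nat (p + 2))"
    using Cons.prems x assms(3) by auto
  then show ?case using Cons x assms(2) by auto
qed simp

definition goal_cells :: "(nat \<Rightarrow> int) \<Rightarrow> int \<Rightarrow> int \<Rightarrow> (nat \<times> int) list \<Rightarrow> bool" where
  "goal_cells m h p G \<longleftrightarrow> cells m h p (map (\<lambda>(v, k). (int v, k)) G)"

text \<open>A stack entry is a pair of addresses, so the stack can reuse the cell format of the
  other lists; \<open>fs\<close> collects these addresses.\<close>

definition stack_cells ::
    "(nat \<Rightarrow> int) \<Rightarrow> int \<Rightarrow> int \<Rightarrow> ((nat \<times> int) list \<times> (int \<times> int) list) list \<Rightarrow> bool" where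
  "stack_cells m h p S \<longleftrightarrow>
     (\<exists>fs. cells m h p fs \<and>
        list_all2 (\<lambda>(g, d) (G, ds). goal_cells m h g G \<and> cells m h d ds) fs S)"

lemma goal_cells_simps:
  "goal_cells m h p [] \<longleftrightarrow> p = 0"
  "goal_cells m h p ((v, k) # G) \<longleftrightarrow>
     0 < p \<and> p + 3 \<le> h \<and> m (nat p) = int v \<and> m (nat (p + 1)) = k \<and> goal_cells m h (m (nat (p + 2))) G"
  by (simp_all add: goal_cells_def)

lemma stack_cells_simps:
  "stack_cells m h p [] \<longleftrightarrow> p = 0"
  "stack_cells m h p ((G, ds) # S) \<longleftrightarrow>
     0 < p \<and> p + 3 \<le> h \<and> goal_cells m h (m (nat p)) G \<and> cells m h (m (nat (p + 1))) ds \<and>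
     stack_cells m h (m (nat (p + 2))) S"
proof -
  show "stack_cells m h p [] \<longleftrightarrow> p = 0" by (simp add: stack_cells_def)
  show "stack_cells m h p ((G, ds) # S) \<longleftrightarrow>
     0 < p \<and> p + 3 \<le> h \<and> goal_cells m h (m (nat p)) G \<and> cells m h (m (nat (p + 1))) ds \<and>
     stack_cells m h (m (nat (p + 2))) S" (is "?L \<longleftrightarrow> ?R")
  proof
    assume ?L
    then show ?R unfolding stack_cells_def list_all2_Cons2 by auto
  next
    assume ?R
    then obtain fs where "cells m h (m (nat (p + 2))) fs"
      "list_all2 (\<lambda>(g, d) (G, ds). goal_cells m h g G \<and> cells m h d ds) fs S"
      by (auto simp: stack_cells_def)
    with \<open>?R\<close> show ?L
      unfolding stack_cells_def by (intro exI[of _ "(m (nat p), m (nat (p + 1))) # fs"]) simp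
  qed
qed

lemma goal_cells_mono:
  "goal_cells m h p G \<Longrightarrow> h \<le> h' \<Longrightarrow> \<forall>i < nat h. m' i = m i \<Longrightarrow> goal_cells m' h' p G"
  unfolding goal_cells_def by (rule cells_mono)

lemma stack_cells_mono:
  assumes "stack_cells m h p S" "h \<le> h'" "\<forall>i < nat h. m' i = m i"
  shows "stack_cells m' h' p S"
proof -
  obtain fs where "cells m h p fs"
    and *: "list_all2 (\<lambda>(g, d) (G, ds). goal_cells m h g G \<and> cells m h d ds) fs S"
    using assms(1) by (auto simp: stack_cells_def)
  then have "cells m' h' p fs" using cells_mono[OF _ assms(2,3)] by blast
  moreover have "list_all2 (\<lambda>(g, d) (G, ds). goal_cells m' h' g G \<and> cells m' h' d ds) fs S"
    using * goal_cells_mono[OF _ assms(2,3)] cells_mono[OF _ assms(2,3)]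
    by (auto elim!: list_all2_mono)
  ultimately show ?thesis by (auto simp: stack_cells_def)
qed

text \<open>Register 10 points to the remaining goals, 11 to the known suffix, 12 to the stack of
  alternatives, and 13 to the unused memory.\<close>

definition machine ::
    "('a \<Rightarrow> int) \<Rightarrow> ('a, nat) ecs \<Rightarrow> state \<Rightarrow> (nat \<times> int) list \<Rightarrow> (int \<times> int) list \<Rightarrow>
     ((nat \<times> int) list \<times> (int \<times> int) list) list \<Rightarrow> bool" where
  "machine code D s G ds S \<longleftrightarrow>
     stores code D s \<and> 4 * regs s 0 \<le> regs s 13 \<and>
     goal_cells (mem s) (regs s 13) (regs s 10) G \<and> cells (mem s) (regs s 13) (regs s 11) ds \<and>
     stack_cells (mem s) (regs s 13) (regs s 12) S"

text \<open>Register \<open>d\<close> is assigned only after the three stores, so it may occur in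
  the arguments, as it does when a list is extended in place.\<close>

definition cons_prog :: "aexp \<Rightarrow> aexp \<Rightarrow> aexp \<Rightarrow> nat \<Rightarrow> com" where
  "cons_prog a b c d =
     seqs [Store (R 13) a, Store (Plus (R 13) (N 1)) b, Store (Plus (R 13) (N 2)) c,
       Assign d (R 13), Assign 13 (Plus (R 13) (N 3))]"

text \<open>Register 14 is the flag of the main loop; an empty stack means that the search is
  complete.\<close>

definition pop_prog :: com where
  "pop_prog =
     If (Eq (R 12) (N 0)) (Assign 14 (N 0))
       (seqs [Load 10 (R 12), Load 11 (Plus (R 12) (N 1)), Load 12 (Plus (R 12) (N 2))])"

definition print_prog :: com where
  "print_prog =
     seqs [Load 15 (R 11), Load 16 (Plus (R 11) (N 1)), Load 11 (Plus (R 11) (N 2)),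
       Out (R 15) (R 16)]"

text \<open>In the union case register 24 holds the postponed goal list, which shares its tail with
  the current one. In the product case the left child is pushed before the right one, which thus
  becomes the next goal. For good goals the last branch is that of shift nodes.\<close>

definition expand_prog :: com where
  "expand_prog =
     seqs [Load 15 (R 10), Load 16 (Plus (R 10) (N 1)), Load 10 (Plus (R 10) (N 2)), load_node 15 20,
       If (Eq (R 20) (N 2)) (cons_prog (R 21) (Plus (R 16) (N 1)) (R 11) 11)
       (If (Eq (R 20) (N 3))
         (seqs [cons_prog (R 23) (R 16) (R 10) 24, cons_prog (R 24) (R 11) (R 12) 12,
            cons_prog (R 22) (R 16) (R 10) 10])
       (If (Eq (R 20) (N 4))
         (seqs [cons_prog (R 22) (R 16) (R 10) 10, cons_prog (R 23) (R 16) (R 10) 10])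
         (cons_prog (R 22) (Plus (R 16) (R 21)) (R 10) 10)))]"

definition step_prog :: com where
  "step_prog =
     If (Eq (R 10) (N 0)) (If (Eq (R 11) (N 0)) (Seq EndOut pop_prog) print_prog) expand_prog"

definition setup_prog :: com where
  "setup_prog =
     seqs [Assign 13 (addr (R 0) 0), Assign 10 (N 0), Assign 11 (N 0), Assign 12 (N 0), Assign 14 (N 1),
       cons_prog (R 3) (N 0) (R 10) 10]"

text \<open>A union with \<epsilon> on its left prints the empty word at once and is replaced by its
  right child, so that the search itself never meets the \<epsilon>-node.\<close>

definition init_prog :: com where
  "init_prog =
     Seq (load_node 3 20)
      (Seq (If (Eq (R 20) (N 3)) (If (Eq (R 22) (R 2)) (Seq (Assign 3 (R 23)) EndOut) Skip) Skip)
        setup_prog)"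

text \<open>While the flag is 0 the main loop stops at its first test. This settles the two special
  nodes; for all others \<open>setup_prog\<close> raises the flag.\<close>

definition start_prog :: com where
  "start_prog =
     Seq (Assign 14 (N 0)) (If (Eq (R 3) (R 1)) Skip (If (Eq (R 3) (R 2)) EndOut init_prog))"

definition enum_prog :: com where
  "enum_prog = Seq start_prog (While (Eq (R 14) (N 1)) step_prog)"

section \<open>Effect of the search steps on registers and memory\<close>

lemma cons_prog_frame:
  assumes "0 \<le> regs s 13" "d \<noteq> 13"
  shows "regs (run (cons_prog a b c d) s) = (regs s)(d := regs s 13, 13 := regs s 13 + 3)"
    "i < nat (regs s 13) \<Longrightarrow> mem (run (cons_prog a b c d) s) i = mem s i"
    "mem (run (cons_prog a b c d) s) (nat (regs s 13)) = aval a s"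
    "mem (run (cons_prog a b c d) s) (nat (regs s 13 + 1)) = aval b s"
    "mem (run (cons_prog a b c d) s) (nat (regs s 13 + 2)) = aval c s"
  using assms by (auto simp: cons_prog_def nat_eq_iff)

lemma stores_mem:
  assumes st: "stores code D s" and D: "is_ecs \<Omega> D"
    and r: "\<And>r. r \<le> 2 \<Longrightarrow> regs s' r = regs s r"
    and m: "\<And>i. i < nat (4 * regs s 0) \<Longrightarrow> mem s' i = mem s i"
  shows "stores code D s'"
proof -
  have "mem s' (4 * v + i) = mem s (4 * v + i)" if "v \<in> nodes D" "i < 4" for v i
    using m[of "4 * v + i"] stores_regs(1)[OF st] fresh_greater[OF D that(1)] that(2) by simp
  from this[of _ 0] this[of _ 1] this[of _ 2] this[of _ 3]
  have "mem s' (4 * v) = mem s (4 * v)" "mem s' (4 * v + 1) = mem s (4 * v + 1)"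
    "mem s' (4 * v + 2) = mem s (4 * v + 2)" "mem s' (4 * v + 3) = mem s (4 * v + 3)"
    if "v \<in> nodes D" for v
    using that by simp_all
  then show ?thesis using st r unfolding stores_def by simp
qed

text \<open>One lemma serves all uses of \<open>cons_prog\<close>: old lists survive at whatever
  address \<open>p\<close> they start, and the new cell may head a list of any of the three kinds.
  Which register plays which role is decided by the caller.\<close>

lemma machine_cons:
  assumes m: "machine code D s G ds S" and D: "is_ecs \<Omega> D"
    and s': "s' = run (cons_prog a b c d) s" and d: "2 < d" "d \<noteq> 13"
  shows "stores code D s'" "4 * regs s' 0 \<le> regs s' 13" "regs s' = (regs s)(d := regs s 13, 13 := regs s 13 + 3)"
    "goal_cells (mem s) (regs s 13) p G' \<Longrightarrow> goal_cells (mem s') (regs s' 13) p G'"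
    "cells (mem s) (regs s 13) p xs \<Longrightarrow> cells (mem s') (regs s' 13) p xs"
    "stack_cells (mem s) (regs s 13) p S' \<Longrightarrow> stack_cells (mem s') (regs s' 13) p S'"
    "aval a s = int v \<Longrightarrow> goal_cells (mem s) (regs s 13) (aval c s) G' \<Longrightarrow>
      goal_cells (mem s') (regs s' 13) (regs s' d) ((v, aval b s) # G')"
    "cells (mem s) (regs s 13) (aval c s) xs \<Longrightarrow>
      cells (mem s') (regs s' 13) (regs s' d) ((aval a s, aval b s) # xs)"
    "goal_cells (mem s) (regs s 13) (aval a s) G' \<Longrightarrow> cells (mem s) (regs s 13) (aval b s) xs \<Longrightarrow>
      stack_cells (mem s) (regs s 13) (aval c s) S' \<Longrightarrow>
      stack_cells (mem s') (regs s' 13) (regs s' d) ((G', xs) # S')"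
proof -
  have st: "stores code D s" and h: "4 * regs s 0 \<le> regs s 13" using m by (auto simp: machine_def)
  have "0 < regs s 0" using stores_regs(1)[OF st] by (simp add: fresh_def)
  then have pos: "0 < regs s 13" using h by linarith
  note f = cons_prog_frame[OF less_imp_le[OF pos] d(2), where a = a and b = b and c = c, folded s']
  have f2: "\<forall>i < nat (regs s 13). mem s' i = mem s i" using f(2) by blast
  show r: "regs s' = (regs s)(d := regs s 13, 13 := regs s 13 + 3)" by (rule f)
  have le: "regs s 13 \<le> regs s' 13" using r by simp
  show "stores code D s'"
  proof (rule stores_mem[OF st D])
    show "regs s' x = regs s x" if "x \<le> 2" for x using r d that by simp
    show "mem s' i = mem s i" if "i < nat (4 * regs s 0)" for i using f(2) h that by simp
  qed
  show "4 * regs s' 0 \<le> regs s' 13" using r h d by simp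
  show g: "goal_cells (mem s) (regs s 13) p G' \<Longrightarrow> goal_cells (mem s') (regs s' 13) p G'" for p G'
    using goal_cells_mono[OF _ le f2] .
  show c: "cells (mem s) (regs s 13) p xs \<Longrightarrow> cells (mem s') (regs s' 13) p xs" for p xs
    using cells_mono[OF _ le f2] .
  show k: "stack_cells (mem s) (regs s 13) p S' \<Longrightarrow> stack_cells (mem s') (regs s' 13) p S'" for p S'
    using stack_cells_mono[OF _ le f2] .
  have rd: "regs s' d = regs s 13" "regs s' 13 = regs s 13 + 3" using r d by simp_all
  show "aval a s = int v \<Longrightarrow> goal_cells (mem s) (regs s 13) (aval c s) G' \<Longrightarrow>
      goal_cells (mem s') (regs s' 13) (regs s' d) ((v, aval b s) # G')"
    unfolding goal_cells_simps using g[of "aval c s" G'] f(3-5) pos unfolding rd by simp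
  show "cells (mem s) (regs s 13) (aval c s) xs \<Longrightarrow>
      cells (mem s') (regs s' 13) (regs s' d) ((aval a s, aval b s) # xs)"
    using c[of "aval c s" xs] f(3-5) pos unfolding rd by simp
  show "goal_cells (mem s) (regs s 13) (aval a s) G' \<Longrightarrow> cells (mem s) (regs s 13) (aval b s) xs \<Longrightarrow>
      stack_cells (mem s) (regs s 13) (aval c s) S' \<Longrightarrow>
      stack_cells (mem s') (regs s' 13) (regs s' d) ((G', xs) # S')"
    unfolding stack_cells_simps using g[of "aval a s" G'] c[of "aval b s" xs] k[of "aval c s" S'] f(3-5) pos
    unfolding rd by simp
qed

lemma machine_expand:
  assumes m: "machine code D s ((v, k) # G) ds S" and D: "is_ecs \<Omega> D" and v: "v \<in> nodes D"
  defines "s' \<equiv> run expand_prog s"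
  shows "lab D v = Sym a \<Longrightarrow> machine code D s' G ((code a, k + 1) # ds) S"
    "lab D v = Shift j \<Longrightarrow> lft D v = Some l \<Longrightarrow> machine code D s' ((l, k + j) # G) ds S"
    "lab D v = Cup \<Longrightarrow> lft D v = Some l \<Longrightarrow> rgt D v = Some r \<Longrightarrow>
      machine code D s' ((l, k) # G) ds (((r, k) # G, ds) # S)"
    "lab D v = Odot \<Longrightarrow> lft D v = Some l \<Longrightarrow> rgt D v = Some r \<Longrightarrow>
      machine code D s' ((r, k) # (l, k) # G) ds S"
    "regs s' 14 = regs s 14"
proof -
  define s1 where
    "s1 = run (seqs [Load 15 (R 10), Load 16 (Plus (R 10) (N 1)), Load 10 (Plus (R 10) (N 2))]) s"
  define s2 where "s2 = run (load_node 15 20) s1"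
  have st: "stores code D s" and h: "4 * regs s 0 \<le> regs s 13"
    and g: "goal_cells (mem s) (regs s 13) (regs s 10) ((v, k) # G)"
    and d: "cells (mem s) (regs s 13) (regs s 11) ds"
    and S: "stack_cells (mem s) (regs s 13) (regs s 12) S"
    using m by (auto simp: machine_def)
  have 1: "mem s1 = mem s"
    "regs s1 = (regs s)(15 := int v, 16 := k, 10 := mem s (nat (regs s 10 + 2)))"
    using g by (auto simp: s1_def goal_cells_simps)
  have st1: "stores code D s1" by (rule stores_cong[OF st 1(1)]) (simp add: 1)
  have f: "regs s2 x = regs s1 x" if "x < 20" for x using that by (simp add: s2_def load_node_frame)
  have m2: "mem s2 = mem s" by (simp add: s2_def load_node_frame 1)
  have st2: "stores code D s2" unfolding s2_def using st1 by (rule load_node_stores) simp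
  have r1: "regs s1 15 = int v" by (simp add: 1)
  have l: "regs s2 20 = tag (lab D v)" "lab D v = Sym a \<Longrightarrow> regs s2 21 = code a"
    "lab D v = Shift j \<Longrightarrow> regs s2 21 = j" "lft D v = Some u \<Longrightarrow> regs s2 22 = int u"
    "rgt D v = Some u \<Longrightarrow> regs s2 23 = int u" for a j u
    using load_node_regs[OF st1 v r1, of 20] by (simp_all add: s2_def)
  have r2: "regs s2 0 = regs s 0" "regs s2 16 = k" "regs s2 10 = mem s (nat (regs s 10 + 2))"
    "regs s2 11 = regs s 11" "regs s2 12 = regs s 12" "regs s2 13 = regs s 13" "regs s2 14 = regs s 14"
    using f 1 by simp_all
  have mm: "machine code D s2 G ds S"
    using st2 h g d S unfolding machine_def m2 r2 by (simp add: goal_cells_simps)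
  then have g2: "goal_cells (mem s2) (regs s2 13) (regs s2 10) G"
    "cells (mem s2) (regs s2 13) (regs s2 11) ds" "stack_cells (mem s2) (regs s2 13) (regs s2 12) S"
    by (auto simp: machine_def)
  have run: "s' = run
      (If (Eq (R 20) (N 2)) (cons_prog (R 21) (Plus (R 16) (N 1)) (R 11) 11)
       (If (Eq (R 20) (N 3))
         (seqs [cons_prog (R 23) (R 16) (R 10) 24, cons_prog (R 24) (R 11) (R 12) 12,
            cons_prog (R 22) (R 16) (R 10) 10])
       (If (Eq (R 20) (N 4))
         (seqs [cons_prog (R 22) (R 16) (R 10) 10, cons_prog (R 23) (R 16) (R 10) 10])
         (cons_prog (R 22) (Plus (R 16) (R 21)) (R 10) 10)))) s2"
    unfolding s'_def expand_prog_def run_seqs s2_def s1_def ..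
  have pos: "0 \<le> regs s2 13" using h stores_regs(1)[OF st] r2 by simp
  show "regs s' 14 = regs s 14"
    unfolding run using pos r2 by (simp add: cons_prog_def)
  show "machine code D s' G ((code a, k + 1) # ds) S" if "lab D v = Sym a"
  proof -
    have s': "s' = run (cons_prog (R 21) (Plus (R 16) (N 1)) (R 11) 11) s2"
      unfolding run using l(1) that by simp
    note c = machine_cons[OF mm D s', simplified]
    show ?thesis unfolding machine_def
      using c(1,2) c(4)[OF g2(1)] c(6)[OF g2(3)] c(8)[OF g2(2)] c(3) l(2)[OF that] r2 by simp
  qed
  show "machine code D s' ((l, k + j) # G) ds S" if "lab D v = Shift j" "lft D v = Some l"
  proof -
    have s': "s' = run (cons_prog (R 22) (Plus (R 16) (R 21)) (R 10) 10) s2"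
      unfolding run using l(1) that by simp
    note c = machine_cons[OF mm D s', simplified]
    show ?thesis unfolding machine_def
      using c(1,2) c(5)[OF g2(2)] c(6)[OF g2(3)] c(7)[OF l(4)[OF that(2)] g2(1)] c(3) l(3)[OF that(1)] r2
      by simp
  qed
  show "machine code D s' ((r, k) # (l, k) # G) ds S"
    if "lab D v = Odot" "lft D v = Some l" "rgt D v = Some r"
  proof -
    define s3 where "s3 = run (cons_prog (R 22) (R 16) (R 10) 10) s2"
    note c = machine_cons[OF mm D s3_def, simplified]
    have m3: "machine code D s3 ((l, k) # G) ds S"
      unfolding machine_def
      using c(1,2) c(5)[OF g2(2)] c(6)[OF g2(3)] c(7)[OF l(4)[OF that(2)] g2(1)] c(3) r2 by simp
    have s': "s' = run (cons_prog (R 23) (R 16) (R 10) 10) s3"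
      unfolding run s3_def using l(1) that by simp
    note c' = machine_cons[OF m3 D s', simplified]
    have g3: "goal_cells (mem s3) (regs s3 13) (regs s3 10) ((l, k) # G)"
      "cells (mem s3) (regs s3 13) (regs s3 11) ds" "stack_cells (mem s3) (regs s3 13) (regs s3 12) S"
      using m3 by (auto simp: machine_def)
    have "regs s3 23 = int r" using c(3) l(5)[OF that(3)] by simp
    then show ?thesis unfolding machine_def
      using c'(1,2) c'(5)[OF g3(2)] c'(6)[OF g3(3)] c'(7)[OF _ g3(1)] c'(3) c(3) r2 by simp
  qed
  show "machine code D s' ((l, k) # G) ds (((r, k) # G, ds) # S)"
    if "lab D v = Cup" "lft D v = Some l" "rgt D v = Some r"
  proof -
    define s3 where "s3 = run (cons_prog (R 23) (R 16) (R 10) 24) s2"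
    define s4 where "s4 = run (cons_prog (R 24) (R 11) (R 12) 12) s3"
    note c = machine_cons[OF mm D s3_def, simplified]
    have r3: "regs s3 = (regs s2)(24 := regs s2 13, 13 := regs s2 13 + 3)" by (rule c(3))
    have m3: "machine code D s3 G ds S"
      unfolding machine_def using c(1,2) c(4)[OF g2(1)] c(5)[OF g2(2)] c(6)[OF g2(3)] r3 by simp
    have g3: "goal_cells (mem s3) (regs s3 13) (regs s3 24) ((r, k) # G)"
      using c(7)[OF l(5)[OF that(3)] g2(1)] r2 by simp
    have g3': "goal_cells (mem s3) (regs s3 13) (regs s3 10) G"
      "cells (mem s3) (regs s3 13) (regs s3 11) ds" "stack_cells (mem s3) (regs s3 13) (regs s3 12) S"
      using m3 by (auto simp: machine_def)
    note c' = machine_cons[OF m3 D s4_def, simplified]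
    have r4: "regs s4 = (regs s3)(12 := regs s3 13, 13 := regs s3 13 + 3)" by (rule c'(3))
    have m4: "machine code D s4 G ds (((r, k) # G, ds) # S)"
      unfolding machine_def
      using c'(1,2) c'(4)[OF g3'(1)] c'(5)[OF g3'(2)] c'(9)[OF g3 g3'(2) g3'(3)] r4 by simp
    have g4: "goal_cells (mem s4) (regs s4 13) (regs s4 10) G"
      "cells (mem s4) (regs s4 13) (regs s4 11) ds"
      "stack_cells (mem s4) (regs s4 13) (regs s4 12) (((r, k) # G, ds) # S)"
      using m4 by (auto simp: machine_def)
    have s': "s' = run (cons_prog (R 22) (R 16) (R 10) 10) s4"
      unfolding run s3_def s4_def using l(1) that by simp
    note c'' = machine_cons[OF m4 D s', simplified]
    have "regs s4 22 = int l" "regs s4 16 = k" using r4 r3 l(4)[OF that(2)] r2 by simp_all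
    then show ?thesis unfolding machine_def
      using c''(1,2) c''(5)[OF g4(2)] c''(6)[OF g4(3)] c''(7)[OF _ g4(1)] c''(3) by simp
  qed
qed

lemma machine_pop:
  assumes m: "machine code D s [] [] ((G, ds) # S)"
  shows "machine code D (run pop_prog s) G ds S" "regs (run pop_prog s) 14 = regs s 14"
proof -
  have st: "stores code D s" and h: "4 * regs s 0 \<le> regs s 13"
    and S: "stack_cells (mem s) (regs s 13) (regs s 12) ((G, ds) # S)"
    using m by (auto simp: machine_def)
  let ?s = "run pop_prog s"
  have r: "regs ?s = (regs s)(10 := mem s (nat (regs s 12)), 11 := mem s (nat (regs s 12 + 1)),
      12 := mem s (nat (regs s 12 + 2)))" "mem ?s = mem s"
    using S by (simp_all add: pop_prog_def stack_cells_simps)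
  have "stores code D ?s" by (rule stores_cong[OF st r(2)]) (simp add: r)
  then show "machine code D ?s G ds S"
    using S h unfolding machine_def r by (simp add: stack_cells_simps)
  show "regs ?s 14 = regs s 14" by (simp add: r)
qed

lemma machine_print:
  assumes m: "machine code D s [] ((a, b) # ds) S"
  shows "machine code D (run print_prog s) [] ds S" "regs (run print_prog s) 14 = regs s 14"
    "trace print_prog s = [Tick, Tick, Tick, Emit a b, Tick]"
proof -
  have st: "stores code D s" and h: "4 * regs s 0 \<le> regs s 13"
    and S: "stack_cells (mem s) (regs s 13) (regs s 12) S"
    and d: "cells (mem s) (regs s 13) (regs s 11) ((a, b) # ds)" and g: "regs s 10 = 0"
    using m by (auto simp: machine_def goal_cells_simps)
  let ?s = "run print_prog s"
  have r: "regs ?s = (regs s)(15 := a, 16 := b, 11 := mem s (nat (regs s 11 + 2)))" "mem ?s = mem s"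
    using d by (auto simp: print_prog_def)
  have "stores code D ?s" by (rule stores_cong[OF st r(2)]) (simp add: r)
  then show "machine code D ?s [] ds S"
    using S h d g unfolding machine_def r by (simp add: goal_cells_simps)
  show "regs ?s 14 = regs s 14" by (simp add: r)
  \<comment> \<open>The last \<open>Tick\<close> stems from the \<open>Skip\<close> that closes
    every \<open>seqs\<close>.\<close>
  show "trace print_prog s = [Tick, Tick, Tick, Emit a b, Tick]"
    using d by (simp add: print_prog_def seqs_def)
qed

section \<open>Output-linear delay\<close>

lemma emitted_append: "emitted (tr1 @ tr2) = emitted tr1 @ emitted tr2"
  by (induction tr1 rule: emitted.induct) auto

lemma emitted_silent: "set tr \<subseteq> {Tick} \<Longrightarrow> emitted tr = []"
  by (induction tr rule: emitted.induct) auto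

abbreviation loop :: com where
  "loop \<equiv> While (Eq (R 14) (N 1)) step_prog"

text \<open>Bounds an iteration of the loop together with its test (the summand 1), and also the
  whole start program, whose events count towards the first word.\<close>

definition step_cost :: nat where
  "step_cost = time_bound step_prog + time_bound start_prog + 1"

text \<open>By the potential, at most \<open>step_cost * (15 * n + 1)\<close> events are pending
  when a word of length \<open>n\<close> is complete, and four more end with its separator. The
  factor 20 absorbs the additive terms even for \<open>n = 0\<close>.\<close>

definition delay :: nat where
  "delay = 20 * step_cost"

section \<open>Unrolling the loop along its outputs\<close>

lemma loop_free_step: "loop_free step_prog"
  by (simp add: step_prog_def pop_prog_def print_prog_def expand_prog_def cons_prog_def load_node_def)

lemma length_step: "Suc (length (trace step_prog s)) \<le> step_cost"
  using length_trace[of step_prog s] by (simp add: step_cost_def)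

text \<open>Here \<open>p\<close> is the part of the trace since the last output.\<close>

definition loop_ok ::
    "('a \<Rightarrow> int) \<Rightarrow> ('a, nat) ecs \<Rightarrow> state \<Rightarrow> event list \<Rightarrow> (int \<times> int) list list \<Rightarrow> bool" where
  "loop_ok code D s p ws \<longleftrightarrow>
     (\<exists>tr s'. exec loop s tr s' \<and> stores code D s' \<and> output_linear_delay delay ws (p @ tr))"

lemma loop_ok_step:
  assumes "regs s 14 = 1" "loop_ok code D (run step_prog s) (p @ Tick # trace step_prog s) ws"
  shows "loop_ok code D s p ws"
proof -
  obtain tr s' where *: "exec loop (run step_prog s) tr s'" "stores code D s'"
      "output_linear_delay delay ws ((p @ Tick # trace step_prog s) @ tr)"
    using assms(2) by (auto simp: loop_ok_def)
  have "exec loop s (Tick # trace step_prog s @ tr) s'"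
    using exec.WhileTrue[OF _ exec_run[OF loop_free_step] *(1)] assms(1) by simp
  then show ?thesis using * unfolding loop_ok_def by force
qed

text \<open>The separator is preceded by three ticks, one for the loop test and two for the tests in
  \<open>step_prog\<close>; with \<open>Sep\<close> itself they make up the 4. Whatever the
  iteration does after the separator already belongs to the next word.\<close>

lemma loop_ok_sep:
  assumes "regs s 14 = 1" "trace step_prog s = Tick # Tick # Sep # post"
    and "loop_ok code D (run step_prog s) post ws"
    and "Sep \<notin> set p" "length p + 4 \<le> delay * (length (emitted p) + 1)"
  shows "loop_ok code D s p (emitted p # ws)"
proof -
  obtain tr s' where *: "exec loop (run step_prog s) tr s'" "stores code D s'"
      "output_linear_delay delay ws (post @ tr)"
    using assms(3) by (auto simp: loop_ok_def)
  have "exec loop s (Tick # trace step_prog s @ tr) s'"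
    using exec.WhileTrue[OF _ exec_run[OF loop_free_step] *(1)] assms(1) by simp
  moreover have "output_linear_delay delay (emitted p # ws) (p @ Tick # trace step_prog s @ tr)"
    unfolding output_linear_delay.simps
  proof (intro exI conjI)
    show "p @ Tick # trace step_prog s @ tr = (p @ [Tick, Tick, Tick]) @ Sep # (post @ tr)"
      using assms(2) by simp
  qed (use assms * in \<open>auto simp: emitted_append\<close>)
  ultimately show ?thesis using * unfolding loop_ok_def by blast
qed

lemma loop_ok_end:
  assumes "regs s 14 \<noteq> 1" "stores code D s" "set p \<subseteq> {Tick}" "length p + 1 \<le> delay"
  shows "loop_ok code D s p []"
  unfolding loop_ok_def
  using assms exec.WhileFalse[of "Eq (R 14) (N 1)" s step_prog]
  by (intro exI[of _ "[Tick]"] exI[of _ s]) auto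

definition good_goals :: "('a, nat) ecs \<Rightarrow> (nat \<times> int) list \<Rightarrow> bool" where
  "good_goals D G \<longleftrightarrow> (\<forall>(v, k) \<in> set G. good D v)"

text \<open>The potential \<open>5 (|G| + 2 |ds| + 3 |w|) - n\<close>, where \<open>w\<close> has been printed and \<open>n\<close> is the
  output-depth of the first goal, increases in every step of the search.\<close>

definition ready ::
    "('a \<Rightarrow> int) \<Rightarrow> ('a, nat) ecs \<Rightarrow> state \<Rightarrow> (nat \<times> int) list \<Rightarrow> (int \<times> int) list \<Rightarrow>
     ((nat \<times> int) list \<times> (int \<times> int) list) list \<Rightarrow> event list \<Rightarrow> bool" where
  "ready code D s G ds S p \<longleftrightarrow>
     machine code D s G ds S \<and> regs s 14 = 1 \<and> good_goals D G \<and>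
     (\<forall>(G', ds') \<in> set S. G' \<noteq> [] \<and> good_goals D G') \<and>
     Sep \<notin> set p \<and> (G \<noteq> [] \<longrightarrow> emitted p = []) \<and>
     (\<exists>n. (G \<noteq> [] \<longrightarrow> odepth D (fst (hd G)) n) \<and>
        length p + step_cost * n \<le> step_cost * (5 * (length G + 2 * length ds + 3 * length (emitted p)) + 1))"

lemma good_depth:
  assumes "well_built \<Omega> D" "good D v"
  obtains n where "odepth D v n" "n \<le> 4"
  using assms good_in[OF assms(2)] unfolding well_built_def node_ok_def by blast

lemma head_depth:
  assumes "well_built \<Omega> D" "good_goals D G"
  obtains n where "G \<noteq> [] \<longrightarrow> odepth D (fst (hd G)) n" "n \<le> 4"
proof (cases G)
  case (Cons x G')
  then have "good D (fst x)" using assms(2) by (auto simp: good_goals_def)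
  from good_depth[OF assms(1) this] show thesis using that Cons by auto
qed (use that in auto)

lemma step_expand:
  assumes "ready code D s ((v, k) # G) ds S p"
  shows "run step_prog s = run expand_prog s" "set (trace step_prog s) \<subseteq> {Tick}"
proof -
  have r: "regs s 10 \<noteq> 0" using assms by (auto simp: ready_def machine_def goal_cells_simps)
  then show "run step_prog s = run expand_prog s" by (simp add: step_prog_def)
  have "silent expand_prog"
    by (simp add: expand_prog_def cons_prog_def load_node_def seqs_def)
  then show "set (trace step_prog s) \<subseteq> {Tick}" using r silent_trace by (simp add: step_prog_def)
qed

lemma odepth_unique: "odepth D v n \<Longrightarrow> odepth D v m \<Longrightarrow> m = n"
proof (induction arbitrary: m rule: odepth.induct)
  case (1 v)
  from 1(2,1) show ?case
    by (cases rule: odepth.cases) (auto simp: output_node_def union_node_def shift_node_def)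
next
  case (2 v u n)
  from "2.prems" show ?case
  proof (cases rule: odepth.cases)
    case 1
    then show ?thesis using 2(1) by (auto simp: output_node_def union_node_def shift_node_def)
  next
    case (2 u' n')
    then show ?thesis using "2.IH" \<open>lft D v = Some u\<close> by auto
  qed
qed

text \<open>The last premise says that the potential grows by at least one. A product adds a goal
  (+5), and a symbol trades a goal for a letter (-5 + 10); both may raise the depth from 0 to 4.
  Shifts and unions lower the depth by one and change nothing else.\<close>

lemma ready_next:
  assumes i: "well_built \<Omega> D" and r: "ready code D s ((v, k) # G) ds S p"
    and m: "machine code D (run expand_prog s) G' ds' S'"
    and g: "good_goals D G'" "\<forall>(G', ds') \<in> set S'. G' \<noteq> [] \<and> good_goals D G'"
    and n: "odepth D v n" "G' \<noteq> [] \<longrightarrow> odepth D (fst (hd G')) n'"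
      "5 * (length G + 1 + 2 * length ds) + n' + 1 \<le> 5 * (length G' + 2 * length ds') + n"
  shows "ready code D (run step_prog s) G' ds' S' (p @ Tick # trace step_prog s)"
proof -
  note e = step_expand[OF r]
  have em: "emitted (p @ Tick # trace step_prog s) = []"
    using r emitted_silent[OF e(2)] by (simp add: emitted_append ready_def)
  have D: "is_ecs \<Omega> D" using i by (rule well_built_ecs)
  have m0: "machine code D s ((v, k) # G) ds S" using r by (simp add: ready_def)
  have v: "v \<in> nodes D" using r good_in by (auto simp: ready_def good_goals_def)
  \<comment> \<open>\<open>ready\<close> only provides some depth of the first goal; uniqueness of
    the output-depth identifies it with \<open>n\<close>.\<close>
  have "length p + step_cost * n \<le> step_cost * (5 * (length ((v, k) # G) + 2 * length ds + 3 * 0) + 1)"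
    using r odepth_unique[OF n(1)] by (auto simp: ready_def)
  then have "length p + step_cost + step_cost * (n + n') \<le>
      step_cost * (5 * (length G + 1 + 2 * length ds) + n' + 1) + step_cost"
    by (simp add: algebra_simps)
  also have "\<dots> \<le> step_cost * (5 * (length G' + 2 * length ds') + n) + step_cost"
    using n(3) by (simp add: mult_le_mono)
  finally have "length p + step_cost + step_cost * n' \<le> step_cost * (5 * (length G' + 2 * length ds') + 1)"
    by (simp add: algebra_simps)
  then have "length (p @ Tick # trace step_prog s) + step_cost * n' \<le>
      step_cost * (5 * (length G' + 2 * length ds' + 3 * 0) + 1)"
    using length_step[of s] by simp
  then show ?thesis
    unfolding ready_def em e(1) using m g n(2) r e(2) machine_expand(5)[OF m0 D v]
    by (auto simp: ready_def em)
qed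

lemma ready_expand:
  assumes i: "well_built \<Omega> D" and r: "ready code D s ((v, k) # G) ds S p"
  defines "p' \<equiv> p @ Tick # trace step_prog s" and "s' \<equiv> run step_prog s"
  shows "lab D v = Sym a \<Longrightarrow> ready code D s' G ((code a, k + 1) # ds) S p'"
    "lab D v = Shift j \<Longrightarrow> lft D v = Some l \<Longrightarrow> ready code D s' ((l, k + j) # G) ds S p'"
    "lab D v = Cup \<Longrightarrow> lft D v = Some l \<Longrightarrow> rgt D v = Some t \<Longrightarrow>
      ready code D s' ((l, k) # G) ds (((t, k) # G, ds) # S) p'"
    "lab D v = Odot \<Longrightarrow> lft D v = Some l \<Longrightarrow> rgt D v = Some t \<Longrightarrow>
      ready code D s' ((t, k) # (l, k) # G) ds S p'"
proof -
  have D: "is_ecs \<Omega> D" using i by (rule well_built_ecs)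
  have m: "machine code D s ((v, k) # G) ds S" and gv: "good D v" and gG: "good_goals D G"
    and gS: "\<forall>(G', ds') \<in> set S. G' \<noteq> [] \<and> good_goals D G'"
    using r by (auto simp: ready_def good_goals_def)
  have v: "v \<in> nodes D" using gv by (rule good_in)
  have child: "good D u" if "child D v u" for u
    using i v gv that by (simp add: well_built_def node_ok_def)
  note exp = machine_expand[OF m D v]
  have out: "odepth D v 0" if "lab D v = Sym a \<or> lab D v = Odot" for a
    using that by (auto intro!: odepth.intros simp: output_node_def)
  have inner: "\<exists>n. odepth D v (n + 1) \<and> odepth D l n"
    if "lab D v \<in> range Shift \<union> {Cup}" "lft D v = Some l" for l
  proof -
    have "good D l" using child that by (simp add: child_def)
    then obtain n where n: "odepth D l n" using good_depth[OF i] by blast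
    have "union_node D v \<or> shift_node D v" using that by (auto simp: union_node_def shift_node_def)
    from odepth.intros(2)[OF this that(2) n] n show ?thesis by blast
  qed
  show "ready code D s' G ((code a, k + 1) # ds) S p'" if "lab D v = Sym a"
  proof -
    have o: "odepth D v 0" using out that by blast
    obtain n where n: "G \<noteq> [] \<longrightarrow> odepth D (fst (hd G)) n" "n \<le> 4" using head_depth[OF i gG] .
    show ?thesis unfolding p'_def s'_def
      by (rule ready_next[OF i r exp(1)[OF that] gG gS o n(1)])
        (use n in simp_all)
  qed
  show "ready code D s' ((l, k + j) # G) ds S p'" if "lab D v = Shift j" "lft D v = Some l"
  proof -
    note lab = that
    obtain n where n: "odepth D v (n + 1)" "odepth D l n" using inner[of l] lab by auto
    have g: "good_goals D ((l, k + j) # G)" using child that gG by (simp add: good_goals_def child_def)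
    show ?thesis unfolding p'_def s'_def
      by (rule ready_next[OF i r exp(2)[OF that] g gS n(1), where n' = n])
        (use n in simp_all)
  qed
  show "ready code D s' ((l, k) # G) ds (((t, k) # G, ds) # S) p'"
    if "lab D v = Cup" "lft D v = Some l" "rgt D v = Some t"
  proof -
    note lab = that
    obtain n where n: "odepth D v (n + 1)" "odepth D l n" using inner[of l] lab by auto
    have g: "good_goals D ((l, k) # G)" "good_goals D ((t, k) # G)"
      using child that gG by (simp_all add: good_goals_def child_def)
    show ?thesis unfolding p'_def s'_def
      by (rule ready_next[OF i r exp(3)[OF that] g(1) _ n(1), where n' = n])
        (use n g gS in simp_all)
  qed
  show "ready code D s' ((t, k) # (l, k) # G) ds S p'"
    if "lab D v = Odot" "lft D v = Some l" "rgt D v = Some t"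
  proof -
    have o: "odepth D v 0" using out that by blast
    have g: "good_goals D ((t, k) # (l, k) # G)"
      using child that gG by (simp add: good_goals_def child_def)
    obtain n where n: "(t, k) # (l, k) # G \<noteq> [] \<longrightarrow> odepth D (fst (hd ((t, k) # (l, k) # G))) n" "n \<le> 4"
      using head_depth[OF i g] .
    show ?thesis unfolding p'_def s'_def
      by (rule ready_next[OF i r exp(4)[OF that] g gS o n(1)])
        (use n in simp_all)
  qed
qed

text \<open>Printing turns a stored letter of weight 10 into a printed one of weight 15, which pays
  for the iteration.\<close>

lemma ready_print:
  assumes r: "ready code D s [] ((a, b) # ds) S p"
  shows "ready code D (run step_prog s) [] ds S (p @ Tick # trace step_prog s)"
    "emitted (p @ Tick # trace step_prog s) = emitted p @ [(a, b)]"
proof -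
  have m: "machine code D s [] ((a, b) # ds) S" using r by (simp add: ready_def)
  then have "regs s 10 = 0" "regs s 11 \<noteq> 0" by (auto simp: machine_def goal_cells_simps)
  then have run: "run step_prog s = run print_prog s"
    and tr: "trace step_prog s = Tick # Tick # trace print_prog s" by (simp_all add: step_prog_def)
  note pr = machine_print[OF m]
  show em: "emitted (p @ Tick # trace step_prog s) = emitted p @ [(a, b)]"
    unfolding tr pr(3) by (simp add: emitted_append)
  have "length p \<le> step_cost * (5 * (0 + 2 * length ((a, b) # ds) + 3 * length (emitted p)) + 1)"
    using r unfolding ready_def by auto
  then have "length (p @ Tick # trace step_prog s) + step_cost * 0 \<le>
      step_cost * (5 * (length ([] :: (nat \<times> int) list) + 2 * length ds + 3 * length (emitted p @ [(a, b)])) + 1)"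
    using length_step[of s] by (simp add: algebra_simps)
  moreover have "Sep \<notin> set (p @ Tick # trace step_prog s)" using r pr(3) tr by (simp add: ready_def)
  ultimately show "ready code D (run step_prog s) [] ds S (p @ Tick # trace step_prog s)"
    using r pr(1,2) unfolding ready_def em run by (auto intro!: exI[of _ 0])
qed

lemma ready_budget:
  assumes r: "ready code D s [] [] S p"
  shows "length p + 4 \<le> delay * (length (emitted p) + 1)"
proof -
  have "length p \<le> step_cost * (15 * length (emitted p) + 1)" using r by (auto simp: ready_def)
  moreover have "4 \<le> 4 * step_cost" by (simp add: step_cost_def)
  ultimately show ?thesis by (simp add: delay_def algebra_simps)
qed

lemma silent_pop: "set (trace pop_prog s) \<subseteq> {Tick}"
  by (rule silent_trace) (simp add: pop_prog_def seqs_def)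

lemma step_sep:
  assumes "machine code D s [] [] S"
  shows "run step_prog s = run pop_prog s" "trace step_prog s = Tick # Tick # Sep # trace pop_prog s"
  using assms by (simp_all add: machine_def goal_cells_simps step_prog_def)

text \<open>The pending trace restarts with the events of the pop. Stacked goal lists are nonempty,
  so 5 units are available, against a depth of at most 4 and the cost of the pop.\<close>

lemma ready_pop:
  assumes i: "well_built \<Omega> D" and r: "ready code D s [] [] ((G, ds) # S) p"
  shows "ready code D (run step_prog s) G ds S (trace pop_prog s)"
proof -
  have m: "machine code D s [] [] ((G, ds) # S)" and G: "G \<noteq> []" "good_goals D G"
    using r by (auto simp: ready_def)
  note e = step_sep[OF m] and pop = machine_pop[OF m]
  obtain n where n: "G \<noteq> [] \<longrightarrow> odepth D (fst (hd G)) n" "n \<le> 4" using head_depth[OF i G(2)] .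
  have "length (trace pop_prog s) + step_cost * n \<le> step_cost + step_cost * 4"
    using length_step[of s] e(2) n(2) by (intro add_mono) auto
  also have "\<dots> = step_cost * 5" by simp
  also have "\<dots> \<le> step_cost * (5 * (length G + 2 * length ds + 3 * 0) + 1)"
    using G by (intro mult_le_mono2) (cases G; simp)
  finally have "length (trace pop_prog s) + step_cost * n \<le>
      step_cost * (5 * (length G + 2 * length ds + 3 * 0) + 1)" .
  then show ?thesis
    using r pop n silent_pop[of s] emitted_silent[OF silent_pop, of s] G
    unfolding ready_def e(1) by auto
qed

text \<open>A termination measure that relies on children being smaller. The inner powers pay for
  products, which replace one goal by two, and the outer power pays for unions, which replace one
  configuration by two. With base 3 two smaller powers always sum to strictly less
  (\<open>power_3_less\<close>).\<close>

definition weight :: "(nat \<times> int) list \<Rightarrow> nat" where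
  "weight G = 3 ^ sum_list (map (\<lambda>(v, k). 3 ^ v) G)"

lemma power_3_less:
  assumes "a < c" "b < c"
  shows "(3 :: nat) ^ a + 3 ^ b < 3 ^ c"
proof -
  obtain d where c: "c = Suc d" using assms by (cases c) auto
  have "(3 :: nat) ^ a \<le> 3 ^ d" "(3 :: nat) ^ b \<le> 3 ^ d"
    using assms c by (auto intro!: power_increasing)
  moreover have "0 < (3 :: nat) ^ d" by simp
  ultimately show ?thesis unfolding c power_Suc by linarith
qed

lemma weight_less:
  "weight G < weight ((v, k) # G)"
  "l < v \<Longrightarrow> weight ((l, j) # G) < weight ((v, k) # G)"
  "l < v \<Longrightarrow> t < v \<Longrightarrow> weight ((l, j) # G) + weight ((t, j) # G) < weight ((v, k) # G)"
  "l < v \<Longrightarrow> t < v \<Longrightarrow> weight ((t, j) # (l, j) # G) < weight ((v, k) # G)"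
  using power_3_less[of t v l]
  by (auto simp: weight_def intro!: power_3_less power_strict_increasing)

text \<open>\<open>emitted p\<close> is the printed prefix of the current word, possibly nonempty
  only once all goals are expanded. The induction is on the total weight of the current and the
  stacked configurations; printing a letter leaves this unchanged and decreases
  \<open>length ds\<close> instead.\<close>

lemma loop_ok_ready:
  assumes i: "well_built \<Omega> D"
  shows "ready code D s G ds S p \<Longrightarrow>
    loop_ok code D s p (map ((@) (emitted p)) (outputs code D (G, ds)) @ concat (map (outputs code D) S))"
proof (induction "(weight G + sum_list (map (weight \<circ> fst) S), length ds)" arbitrary: s G ds S p
    rule: wf_induct_rule[OF wf_lex_prod[OF wf_less_than wf_less_than]])
  case (1 G ds S s p)
  note r = 1(2)
  have ih: "loop_ok code D s' p' (map ((@) (emitted p')) (outputs code D (G', ds')) @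
      concat (map (outputs code D) S'))"
    if "weight G' + sum_list (map (weight \<circ> fst) S') < weight G + sum_list (map (weight \<circ> fst) S) \<or>
      weight G' + sum_list (map (weight \<circ> fst) S') = weight G + sum_list (map (weight \<circ> fst) S) \<and>
      length ds' < length ds" "ready code D s' G' ds' S' p'" for s' G' ds' S' p'
    using 1(1)[OF _ that(2)] that(1) by auto
  have run: "regs s 14 = 1" using r by (simp add: ready_def)
  show ?case
  proof (cases G)
    case (Cons x G0)
    obtain v k where x: "x = (v, k)" by fastforce
    have r: "ready code D s ((v, k) # G0) ds S p" using r Cons x by simp
    let ?p = "p @ Tick # trace step_prog s" and ?s = "run step_prog s"
    have em: "emitted p = []" "emitted ?p = []"
      using r emitted_silent[OF step_expand(2)[OF r]] by (simp_all add: emitted_append ready_def)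
    have gv: "good D v" using r by (auto simp: ready_def good_goals_def)
    have v: "v \<in> nodes D" using gv by (rule good_in)
    have ok: "node_ok D v" using i v by (simp add: well_built_def)
    have lt: "lft D v = Some u \<Longrightarrow> u < v" "rgt D v = Some u \<Longrightarrow> u < v" for u
      using ok by (auto simp: node_ok_def child_def)
    note exp = ready_expand[OF i r] and out = outputs_step[OF i v] and D = well_built_ecs[OF i]
    have id: "map ((@) []) xs = xs" for xs :: "(int \<times> int) list list" by (induction xs) auto
    have "loop_ok code D ?s ?p (outputs code D ((v, k) # G0, ds) @ concat (map (outputs code D) S))"
    proof (cases "lab D v")
      case (Sym a)
      show ?thesis
        using ih[OF _ exp(1)[OF Sym]] weight_less(1)[of G0 v k] out(1)[OF Sym] em Cons x
        by (simp add: id)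
    next
      case (Shift j)
      then obtain l where l: "lft D v = Some l" using ecs_lft[OF D v] by blast
      show ?thesis
        using ih[OF _ exp(2)[OF Shift l]] weight_less(2)[OF lt(1)[OF l], of "k + j" G0 k]
          out(2)[OF Shift l] em Cons x
        by (simp add: id)
    next
      case Cup
      then obtain l t where l: "lft D v = Some l" "rgt D v = Some t"
        using ecs_both[OF D v] by (metis insertI1)
      show ?thesis
        using ih[OF _ exp(3)[OF Cup l]] weight_less(3)[OF lt(1)[OF l(1)] lt(2)[OF l(2)], of k G0 k]
          out(3)[OF Cup l] em Cons x
        by (simp add: id)
    next
      case Odot
      then obtain l t where l: "lft D v = Some l" "rgt D v = Some t"
        using ecs_both[OF D v] by (metis insertI1 insertI2)
      show ?thesis
        using ih[OF _ exp(4)[OF Odot l]] weight_less(4)[OF lt(1)[OF l(1)] lt(2)[OF l(2)], of k G0 k]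
          out(4)[OF Odot l] em Cons x
        by (simp add: id)
    qed (use gv in \<open>auto simp: good_def\<close>)
    then show ?thesis using loop_ok_step[OF run] Cons x em by (simp add: id)
  next
    case Nil
    show ?thesis
    proof (cases ds)
      case (Cons x ds0)
      obtain a b where x: "x = (a, b)" by fastforce
      have r: "ready code D s [] ((a, b) # ds0) S p" using r Cons x Nil by simp
      note pr = ready_print[OF r]
      have "loop_ok code D (run step_prog s) (p @ Tick # trace step_prog s)
          ((emitted p @ ds) # concat (map (outputs code D) S))"
        using ih[OF _ pr(1)] pr(2) Nil Cons x by (simp add: outputs_Nil)
      then show ?thesis using loop_ok_step[OF run] Nil by (simp add: outputs_Nil)
    next
      case ds: Nil
      have r: "ready code D s [] [] S p" using r Nil ds by simp
      have m: "machine code D s [] [] S" using r by (simp add: ready_def)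
      note e = step_sep[OF m]
      have "loop_ok code D (run step_prog s) (trace pop_prog s) (concat (map (outputs code D) S))"
      proof (cases S)
        case Nil
        then have "regs s 12 = 0" using m by (simp add: machine_def stack_cells_simps)
        then have pop: "run pop_prog s = s\<lparr>regs := (regs s)(14 := 0)\<rparr>" by (simp add: pop_prog_def)
        have "stores code D s" using m by (simp add: machine_def)
        then have "stores code D (run pop_prog s)" unfolding pop by (rule stores_cong) simp_all
        moreover have "length (trace pop_prog s) + 1 \<le> delay"
          using length_step[of s] e(2) by (simp add: delay_def)
        ultimately show ?thesis
          using loop_ok_end[of "run pop_prog s" code D "trace pop_prog s"] silent_pop[of s] Nil e(1) pop
          by simp
      next
        case (Cons y S0)
        obtain G1 ds1 where y: "y = (G1, ds1)" by fastforce
        have r1: "ready code D (run step_prog s) G1 ds1 S0 (trace pop_prog s)"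
          using ready_pop[OF i] r Cons y by blast
        have id: "map ((@) []) xs = xs" for xs :: "(int \<times> int) list list" by (induction xs) auto
        \<comment> \<open>The finished configuration still has weight 1, so dropping it in favour of
          a stacked one decreases the sum.\<close>
        have "0 < weight []" by (simp add: weight_def)
        then show ?thesis
          using ih[OF _ r1] Cons y \<open>G = []\<close> emitted_silent[OF silent_pop, of s] by (simp add: id)
      qed
      then show ?thesis
        using loop_ok_sep[OF run e(2) _ _ ready_budget[OF r]] r Nil ds by (simp add: outputs_Nil ready_def)
    qed
  qed
qed

lemma setup_machine:
  assumes st: "stores code D s" and D: "is_ecs \<Omega> D" and u: "regs s 3 = int u"
  shows "machine code D (run setup_prog s) [(u, 0)] [] []" "regs (run setup_prog s) 14 = 1"
proof -
  define s1 where "s1 = run (seqs [Assign 13 (addr (R 0) 0), Assign 10 (N 0), Assign 11 (N 0),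
    Assign 12 (N 0), Assign 14 (N 1)]) s"
  have s': "run setup_prog s = run (cons_prog (R 3) (N 0) (R 10) 10) s1"
    by (simp add: setup_prog_def s1_def)
  have 1: "mem s1 = mem s" "regs s1 = (regs s)(13 := 4 * regs s 0, 10 := 0, 11 := 0, 12 := 0, 14 := 1)"
    by (simp_all add: s1_def)
  have "stores code D s1" by (rule stores_cong[OF st 1(1)]) (simp add: 1)
  then have m: "machine code D s1 [] [] []"
    unfolding machine_def by (simp add: 1 goal_cells_simps stack_cells_simps)
  note c = machine_cons[OF m D s', simplified]
  have "goal_cells (mem s1) (regs s1 13) (regs s1 10) []" "cells (mem s1) (regs s1 13) (regs s1 11) []"
    "stack_cells (mem s1) (regs s1 13) (regs s1 12) []"
    using m by (simp_all add: machine_def)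
  moreover have "regs s1 3 = int u" using u by (simp add: 1)
  ultimately show "machine code D (run setup_prog s) [(u, 0)] [] []"
    unfolding machine_def using c(1,2,3) c(5) c(6) c(7) by simp
  show "regs (run setup_prog s) 14 = 1" using c(3) by (simp add: 1)
qed

lemma ready_setup:
  assumes i: "well_built \<Omega> D" and st: "stores code D s" and u: "regs s 3 = int u" "good D u"
    and p: "set p \<subseteq> {Tick}" "length p \<le> step_cost"
  shows "loop_ok code D (run setup_prog s) p (map (encode code) (node_words D u))"
proof -
  obtain n where n: "odepth D u n" "n \<le> 4" using good_depth[OF i u(2)] .
  \<comment> \<open>The single goal is worth 5 units: up to 4 cover its depth and one covers the
    start program.\<close>
  have "length p + step_cost * n \<le> step_cost + step_cost * 4" using p(2) n(2) by (intro add_mono) auto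
  then have "ready code D (run setup_prog s) [(u, 0)] [] [] p"
    unfolding ready_def using setup_machine[OF st well_built_ecs[OF i] u(1)] u(2) p n emitted_silent[OF p(1)]
    by (auto simp: good_goals_def intro!: exI[of _ n])
  from loop_ok_ready[OF i this] show ?thesis
    using emitted_silent[OF p(1)] by (simp add: outputs_start comp_def)
qed

section \<open>The start of the enumeration and the empty word\<close>

lemma loop_free_start: "loop_free start_prog"
  by (simp add: start_prog_def init_prog_def setup_prog_def cons_prog_def load_node_def)

lemma length_start: "length (trace start_prog s) \<le> step_cost"
  using length_trace[of start_prog s] by (simp add: step_cost_def)

lemma start_ok:
  assumes i: "well_built \<Omega> D" and v: "v \<in> nodes D" and st: "stores code D s" and r: "regs s 3 = int v"
  shows "\<exists>tr s'. exec loop (run start_prog s) tr s' \<and> stores code D s' \<and>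
    output_linear_delay delay (map (encode code) (node_words D v)) (trace start_prog s @ tr)"
proof -
  note D = well_built_ecs[OF i]
  note sp = ecs_special(3,4)[OF D] and w = node_words_equations[OF i v]
  define s1 where "s1 = s\<lparr>regs := (regs s)(14 := 0)\<rparr>"
  have st1: "stores code D s1" unfolding s1_def using st by (rule stores_cong) simp_all
  have r1: "regs s1 3 = int v" using r by (simp add: s1_def)
  note sr = stores_regs[OF st1]
  have run: "run start_prog s =
      run (If (Eq (R 3) (R 1)) Skip (If (Eq (R 3) (R 2)) EndOut init_prog)) s1"
    and tr: "trace start_prog s =
      Tick # trace (If (Eq (R 3) (R 1)) Skip (If (Eq (R 3) (R 2)) EndOut init_prog)) s1"
    by (simp_all add: start_prog_def s1_def)
  have stop: "regs s1 14 \<noteq> 1" by (simp add: s1_def)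
  have delay: "4 \<le> delay" by (simp add: delay_def step_cost_def)
  \<comment> \<open>The empty word consists of its separator alone; the silent part \<open>p\<close>
    before it must fit into one \<open>delay\<close>, and \<open>p'\<close> opens the segment of the
    next word.\<close>
  have eps: "\<exists>tr s'. exec loop t tr s' \<and> stores code D s' \<and>
      output_linear_delay delay ([] # ws) ((p @ Sep # p') @ tr)"
    if "loop_ok code D t p' ws" "set p \<subseteq> {Tick}" "length p + 1 \<le> delay" for t p p' ws
    using that emitted_silent[OF that(2)] unfolding loop_ok_def output_linear_delay.simps by fastforce
  consider "v = bot_node D" | "v = eps_node D" | "v \<noteq> bot_node D" "v \<noteq> eps_node D" by blast
  then show ?thesis
  proof cases
    case 1
    have "loop_ok code D s1 [Tick, Tick, Tick] []"
      using loop_ok_end[OF stop st1] delay by simp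
    then show ?thesis
      using run tr 1 r1 sr w(1) sp(1) by (simp add: loop_ok_def)
  next
    case 2
    have ne: "int v \<noteq> int (bot_node D)" using sp 2 by auto
    have "loop_ok code D s1 [] []"
      using loop_ok_end[OF stop st1] delay by simp
    from eps[OF this, of "[Tick, Tick, Tick]"] delay show ?thesis
      using run tr 2 ne r1 sr w(2) sp(2) by (simp add: encode_def)
  next
    case 3
    define s2 where "s2 = run (load_node 3 20) s1"
    let ?test = "If (Eq (R 20) (N 3)) (If (Eq (R 22) (R 2)) (Seq (Assign 3 (R 23)) EndOut) Skip) Skip"
    have run2: "run start_prog s = run setup_prog (run ?test s2)"
      and tr2: "trace start_prog s = [Tick, Tick, Tick] @ trace (load_node 3 20) s1 @
        trace ?test s2 @ trace setup_prog (run ?test s2)"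
      using run tr 3 r1 sr by (simp_all add: init_prog_def s2_def)
    have st2: "stores code D s2" unfolding s2_def using st1 by (rule load_node_stores) simp
    have r2: "regs s2 3 = int v" "regs s2 2 = int (eps_node D)"
      using r1 sr by (simp_all add: s2_def load_node_frame)
    have l: "regs s2 20 = tag (lab D v)" "lft D v = Some u \<Longrightarrow> regs s2 22 = int u"
      "rgt D v = Some u \<Longrightarrow> regs s2 23 = int u" for u
      using load_node_regs[OF st1 v r1, of 20] by (simp_all add: s2_def)
    have silent: "set (trace (load_node 3 20) s1) \<subseteq> {Tick}" "set (trace setup_prog t) \<subseteq> {Tick}" for t
      by (rule silent_trace; simp add: load_node_def setup_prog_def cons_prog_def seqs_def)+
    show ?thesis
    proof (cases "lab D v = Cup \<and> lft D v = Some (eps_node D)")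
      case True
      then obtain u where u: "rgt D v = Some u" using ecs_rgt[OF D v] by auto
      define s3 where "s3 = s2\<lparr>regs := (regs s2)(3 := int u)\<rparr>"
      have t: "run ?test s2 = s3" "trace ?test s2 = [Tick, Tick, Tick, Sep]"
        using True l u r2 by (simp_all add: s3_def)
      have st3: "stores code D s3" unfolding s3_def using st2 by (rule stores_cong) simp_all
      have gu: "good D u" using i v True u by (auto simp: well_built_def node_ok_def)
      note len = length_start[of s, unfolded tr2 t, simplified]
      have "loop_ok code D (run setup_prog s3) (trace setup_prog s3) (map (encode code) (node_words D u))"
        by (rule ready_setup[OF i st3 _ gu silent(2)]) (use len in \<open>simp_all add: s3_def\<close>)
      from eps[OF this, of "[Tick, Tick, Tick] @ trace (load_node 3 20) s1 @ [Tick, Tick, Tick]"]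
      have "\<exists>tr s'. exec loop (run start_prog s) tr s' \<and> stores code D s' \<and>
          output_linear_delay delay ([] # map (encode code) (node_words D u)) (trace start_prog s @ tr)"
        using silent(1) len unfolding run2 tr2 t by (simp add: delay_def)
      moreover have "node_words D v = [] # node_words D u"
        using True u w(5) node_words_equations(2)[OF i ecs_special(2)[OF D] sp(2)] by simp
      ultimately show ?thesis by (simp add: encode_def)
    next
      case False
      have "run ?test s2 = s2 \<and> set (trace ?test s2) \<subseteq> {Tick}"
      proof (cases "lab D v = Cup")
        case True
        then obtain l' where "lft D v = Some l'" using ecs_lft[OF D v] by auto
        then show ?thesis using l True False r2 by simp
      next
        case False
        then show ?thesis using l by (simp add: tag_eq_iff)
      qed
      then have t: "run ?test s2 = s2" "set (trace ?test s2) \<subseteq> {Tick}" by auto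
      \<comment> \<open>Every node that is neither special nor a union with \<epsilon> on its left
        is good, so the search handles all remaining nodes, safe or not.\<close>
      have g: "good D v"
        using False 3 v is_ecs_node(2,3)[OF D v] by (auto simp: good_def)
      have "loop_ok code D (run setup_prog s2) (trace start_prog s) (map (encode code) (node_words D v))"
      proof (rule ready_setup[OF i st2 r2(1) g _ length_start])
        show "set (trace start_prog s) \<subseteq> {Tick}" unfolding tr2 t(1) using silent t(2) by simp
      qed
      then show ?thesis unfolding loop_ok_def run2 t(1) .
    qed
  qed
qed

lemma enumerates_enum_prog:
  assumes i: "well_built \<Omega> D" and v: "v \<in> nodes D"
  shows "enumerates code enum_prog delay D v"
  unfolding enumerates_def
proof (intro allI impI)
  fix s assume "stores code D s \<and> regs s 3 = int v"
  then obtain tr s' where *: "exec loop (run start_prog s) tr s'" "stores code D s'"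
      "output_linear_delay delay (map (encode code) (node_words D v)) (trace start_prog s @ tr)"
    using start_ok[OF i v] by blast
  have "exec enum_prog s (trace start_prog s @ tr) s'"
    unfolding enum_prog_def using exec_run[OF loop_free_start] *(1) by (rule exec.Seq)
  then show "\<exists>tr s' ws. exec enum_prog s tr s' \<and> stores code D s' \<and> distinct ws \<and> set ws = sem D v \<and>
      output_linear_delay delay (map (map (\<lambda>(a, i). (code a, i))) ws) tr"
    using *(2,3) node_words_correct[OF i v] unfolding encode_def by blast
qed

theorem mainTheorem3:
  fixes \<Omega> :: "'a set" and code :: "'a \<Rightarrow> int"
  assumes "finite \<Omega>" and "inj_on code \<Omega>"
  shows "\<exists>apply_op op_prog.
    correct_operations \<Omega> apply_op \<and>
    constant_time_implementation \<Omega> code apply_op op_prog \<and>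
    (\<forall>D c. eps_safely_built \<Omega> apply_op D \<and> call_assm \<Omega> D c \<and>
       (\<forall>v \<in> call_nodes c. eps_safe D v) \<longrightarrow>
         (case apply_op D c of (D', v') \<Rightarrow> eps_safe D' v')) \<and>
    (\<exists>enum_prog K. \<forall>D v. eps_safely_built \<Omega> apply_op D \<and> v \<in> nodes D \<longrightarrow>
       enumerates code enum_prog K D v)"
proof (intro exI conjI)
  show "correct_operations \<Omega> apply_op" by (rule correct_apply_op)
  show "constant_time_implementation \<Omega> code apply_op op_prog" by (rule constant_time_op_prog)
  show "\<forall>D c. eps_safely_built \<Omega> apply_op D \<and> call_assm \<Omega> D c \<and> (\<forall>v \<in> call_nodes c. eps_safe D v) \<longrightarrow>
      (case apply_op D c of (D', v') \<Rightarrow> eps_safe D' v')"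
    using apply_op_inv[OF eps_safely_built_well_built, of \<Omega>] by (auto split: prod.splits)
  show "\<forall>D v. eps_safely_built \<Omega> apply_op D \<and> v \<in> nodes D \<longrightarrow> enumerates code enum_prog delay D v"
    using enumerates_enum_prog[OF eps_safely_built_well_built] by blast
qed

end
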